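(* Let $K$ and $L$ be Sylow-conjugate number fields of prime degree over $\mathbb{Q}$ which are solvable, i.e. $\mathrm{Gal}(M/\mathbb{Q})$ is solvable, where $M$ is the common Galois closure of $K/\mathbb{Q}$ and $L/\mathbb{Q}$. Then $K$ and $L$ are isomorphic.
   Context: Fix an algebraic closure $\overline{\mathbb{Q}}$ of $\mathbb{Q}$. A number field is a finite extension of $\mathbb{Q}$ contained in $\overline{\mathbb{Q}}$, and $\mathrm{Gal}(K)=\mathrm{Gal}(\overline{\mathbb{Q}}/K)$. Two number fields $K$ and $L$ are called Sylow-conjugate if for every prime $p$, the $p$-Sylow subgroups of $\mathrm{Gal}(K)$ and $\mathrm{Gal}(L)$ are conjugate in $\mathrm{Gal}(\mathbb{Q})$. Two Sylow-conjugate number fields have the same Galois closure over $\mathbb{Q}$, called their common Galois closure. *)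

theory Defs
  imports
    "HOL-Analysis.Abstract_Topology"
    "HOL-Algebra.Algebra"
    "HOL-Algebra.Solvable_Groups"
    "HOL-Algebra.Algebraic_Closure_Type"
begin

text \<open>
  The algebraic closure of the rationals is the whole of a type of sort \<open>field_char_0\<close> and
  \<open>alg_closed_field\<close>, all of whose elements are algebraic; that last condition is a hypothesis of
  the theorem. The prime field of such a type is \<^term>\<open>\<rat>\<close>, and subfields are sets.
\<close>

abbreviation Qbar :: "'a::field ring"
  where "Qbar \<equiv> ring_of_type_algebra"

definition number_field :: "'a::field_char_0 set \<Rightarrow> bool"
  where "number_field K \<longleftrightarrow> subfield K Qbar \<and> ring.finite_dimension Qbar \<rat> K"

text \<open>
  \<open>gal E F\<close> is the group of field automorphisms of \<open>E\<close> that fix \<open>F\<close> pointwise. As in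
  \<^const>\<open>BijGroup\<close>, automorphisms are taken extensional on \<open>E\<close>, so that distinct
  functions are distinct automorphisms.
\<close>

definition gal :: "'a::field set \<Rightarrow> 'a set \<Rightarrow> ('a \<Rightarrow> 'a) monoid"
  where "gal E F = (BijGroup E)
    \<lparr>carrier := {\<sigma> \<in> extensional E.
       \<sigma> \<in> ring_iso (Qbar\<lparr>carrier := E\<rparr>) (Qbar\<lparr>carrier := E\<rparr>) \<and> (\<forall>x\<in>F. \<sigma> x = x)}\<rparr>"

abbreviation abs_gal :: "'a::field set \<Rightarrow> ('a \<Rightarrow> 'a) monoid"
  where "abs_gal K \<equiv> gal UNIV K"

definition krull_topology :: "'a::field set \<Rightarrow> ('a \<Rightarrow> 'a) topology"
  where "krull_topology K = topology_generated_by
    {\<sigma> <#\<^bsub>abs_gal K\<^esub> carrier (abs_gal F) | \<sigma> F.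
       \<sigma> \<in> carrier (abs_gal K) \<and> subfield F Qbar \<and> K \<subseteq> F \<and> ring.finite_dimension Qbar K F}"

text \<open>
  In the next two definitions \<open>G\<close> is meant to be a profinite group with topology \<open>T\<close>.
  The index of a closed subgroup \<open>P\<close> is the supernatural number given by the least common
  multiple of the indices of the images of \<open>P\<close> in the finite quotients \<open>G/N\<close>, that is, of
  \<open>(G : PN)\<close>. A Sylow subgroup is a closed pro-\<open>p\<close> subgroup of index prime to \<open>p\<close>.
\<close>

definition pro_p_group :: "nat \<Rightarrow> ('g, 'b) monoid_scheme \<Rightarrow> 'g topology \<Rightarrow> bool"
  where "pro_p_group p G T \<longleftrightarrow> (\<forall>N. N \<lhd> G \<and> openin T N \<longrightarrow> (\<exists>n. Coset.order (G Mod N) = p ^ n))"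

definition sylow_subgroup ::
    "nat \<Rightarrow> ('g, 'b) monoid_scheme \<Rightarrow> 'g topology \<Rightarrow> 'g set \<Rightarrow> bool"
  where "sylow_subgroup p G T P \<longleftrightarrow>
    subgroup P G \<and> closedin T P \<and>
    pro_p_group p (G\<lparr>carrier := P\<rparr>) (subtopology T P) \<and>
    (\<forall>N. N \<lhd> G \<and> openin T N \<longrightarrow> \<not> p dvd card (rcosets\<^bsub>G\<^esub> (P <#>\<^bsub>G\<^esub> N)))"

definition conjugate_in :: "('g, 'b) monoid_scheme \<Rightarrow> 'g set \<Rightarrow> 'g set \<Rightarrow> bool"
  where "conjugate_in G P P' \<longleftrightarrow> (\<exists>g\<in>carrier G. P' = (g <#\<^bsub>G\<^esub> P) #>\<^bsub>G\<^esub> inv\<^bsub>G\<^esub> g)"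

definition sylow_conjugate :: "'a::field_char_0 set \<Rightarrow> 'a set \<Rightarrow> bool"
  where "sylow_conjugate K L \<longleftrightarrow>
    (\<forall>p::nat. Factorial_Ring.prime p \<longrightarrow>
      (\<forall>P P'. sylow_subgroup p (abs_gal K) (krull_topology K) P \<and>
              sylow_subgroup p (abs_gal L) (krull_topology L) P' \<longrightarrow>
              conjugate_in (abs_gal \<rat>) P P'))"

text \<open>
  For algebraic extensions, being Galois means that only \<^term>\<open>\<rat>\<close> is fixed by all automorphisms.
\<close>

definition galois_over_rat :: "'a::field_char_0 set \<Rightarrow> bool"
  where "galois_over_rat E \<longleftrightarrow>
    subfield E Qbar \<and> {x \<in> E. \<forall>\<sigma>\<in>carrier (gal E \<rat>). \<sigma> x = x} = \<rat>"

definition galois_closure :: "'a::field_char_0 set \<Rightarrow> 'a set"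
  where "galois_closure K = \<Inter> {E. galois_over_rat E \<and> K \<subseteq> E}"

end

theory Submission
  imports Defs
begin

text \<open>
  Let \<open>G = Gal(\<rat>)\<close>, \<open>V = Gal(K)\<close> and \<open>W = Gal(L)\<close>. As \<open>K\<close> and \<open>L\<close> are the fixed fields of \<open>V\<close>
  and \<open>W\<close>, an element of \<open>G\<close> that conjugates \<open>W\<close> to \<open>V\<close> maps \<open>L\<close> onto \<open>K\<close>
  (\<open>conjugate_abs_gal_isomorphic\<close>). So the claim is that \<open>V\<close> and \<open>W\<close> are conjugate in \<open>G\<close>.

  Suppose that for each prime the Sylow subgroups of \<open>V\<close> and \<open>W\<close> are conjugate in \<open>G\<close>. Comparing \<open>p\<close>-parts of
  indices shows that \<open>V\<close> and \<open>W\<close> have the same index (\<open>sylow_conjugate_index_eq\<close>). Moreover \<open>W\<close> contains every normal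
  subgroup of \<open>G\<close> that is contained in \<open>V\<close> (\<open>sylow_conjugate_normal_subset\<close>), in particular the normal core
  \<open>N\<close> of \<open>V\<close>. In the finite group \<open>G/N\<close>, the subgroups \<open>V/N\<close> and \<open>W/N\<close> have the same order, \<open>V/N\<close> contains
  no nontrivial normal subgroup, and its index is the prime degree of \<open>K\<close> (\<open>index_abs_gal\<close>). The group \<open>G/N\<close> is
  solvable, being the Galois group of the Galois closure of \<open>K\<close> (\<open>derived_series_fixes\<close>). By a theorem of Galois it is
  then a group of affine transformations of a prime field with \<open>V/N\<close> as a point stabilizer, and
  any other subgroup of that order is conjugate to \<open>V/N\<close> (\<open>solvable_prime_index_conjugate\<close>).

  Sylow-conjugacy quantifies over all pairs of Sylow subgroups, so it says something only because Sylow subgroups exist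
  (\<open>exists_sylow_subgroup_abs_gal\<close>). The algebraic closure being countable, the Krull topology is given by a descending
  sequence of normal subgroups of finite index, with respect to which \<open>Gal(K)\<close> is complete. A Sylow subgroup is the limit
  of compatible choices of Sylow subgroups in the finite quotients (\<open>exists_sylow_filtration\<close>).

  Galois theory enters through one fact: every element outside of \<open>K\<close> is moved by some element of \<open>Gal(K)\<close>
  (\<open>automorphism_moving\<close>). It follows from extending embeddings of subrings by Zorn's lemma
  (\<open>partial_embedding_extends_to_automorphism\<close>).
\<close>

section \<open>Indices of subgroups\<close>

lemma card_image_transfer:
  assumes "f ` A = A'"
    and "\<And>x y. x \<in> A \<Longrightarrow> y \<in> A \<Longrightarrow> F x = F y \<longleftrightarrow> F' (f x) = F' (f y)"
  shows "card (F ` A) = card (F' ` A')"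
proof -
  define h where "h = (\<lambda>c. F' (f (inv_into A F c)))"
  have h: "h (F x) = F' (f x)" if "x \<in> A" for x
    unfolding h_def using assms(2)[OF inv_into_into[of "F x" F A] that] that
    by (simp add: f_inv_into_f)
  have "inj_on h (F ` A)"
    by (rule inj_onI) (use h assms(2) in auto)
  moreover have "h ` F ` A = F' ` A'"
    using h assms(1) by (force simp: image_iff)
  ultimately show ?thesis
    using card_image by metis
qed

context group
begin

definition index :: "'a set \<Rightarrow> 'a set \<Rightarrow> nat"
  where "index A B = card ((\<lambda>x. B #> x) ` A)"

lemma r_coset_eq_iff:
  assumes "subgroup B G" "x \<in> carrier G" "y \<in> carrier G"
  shows "B #> x = B #> y \<longleftrightarrow> x \<otimes> inv y \<in> B"
proof
  assume "B #> x = B #> y"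
  then have "x \<in> B #> y"
    using rcos_self[OF assms(2,1)] by simp
  then show "x \<otimes> inv y \<in> B"
    using subgroup.rcos_module_imp[OF assms(1) is_group assms(3)] by simp
next
  assume "x \<otimes> inv y \<in> B"
  then have "x \<in> B #> y"
    using subgroup.rcos_module_rev[OF assms(1) is_group assms(3,2)] by simp
  then show "B #> x = B #> y"
    using repr_independence[OF _ assms(3,1)] by simp
qed

lemma mult_inv_cancel:
  assumes "x \<in> carrier G" "y \<in> carrier G"
  shows "x \<otimes> (inv x \<otimes> y) = y" "inv x \<otimes> (x \<otimes> y) = y"
  using m_assoc[of x "inv x" y] m_assoc[of "inv x" x y] assms by simp_all

lemma index_rcosets: "card (rcosets B) = index (carrier G) B"
  by (simp add: index_def RCOSETS_def UNION_singleton_eq_range)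

lemma index_eq_1_imp_subset:
  assumes "subgroup A G" "subgroup B G" "index A B = 1"
  shows "A \<subseteq> B"
proof
  fix x assume x: "x \<in> A"
  obtain c where c: "(\<lambda>x. B #> x) ` A = {c}"
    using assms(3) unfolding index_def by (meson card_1_singletonE)
  have "B #> x = B #> \<one>"
    using c x subgroup.one_closed[OF assms(1)] by (metis imageI singletonD)
  then show "x \<in> B"
    using r_coset_eq_iff[OF assms(2), of x \<one>] subgroup.mem_carrier[OF assms(1) x] by simp
qed

text \<open>The product formula holds for infinite indices too, with the convention that an infinite
  set has cardinality \<open>0\<close>: choosing representatives gives a bijection from the product
  of the coset spaces to the coset space of the smaller subgroup.\<close>

lemma index_mult:
  assumes A: "subgroup A G" and B: "subgroup B G" and C: "subgroup C G"
    and "B \<subseteq> A" and "C \<subseteq> B"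
  shows "index A C = index A B * index B C"
proof -
  define AB where "AB = (\<lambda>x. B #> x) ` A"
  define BC where "BC = (\<lambda>x. C #> x) ` B"
  define t where "t = (\<lambda>T. inv_into A (\<lambda>x. B #> x) T)"
  have tA: "t T \<in> A" and tT: "B #> t T = T" if "T \<in> AB" for T
    using that unfolding AB_def t_def
     apply (simp add: inv_into_into)
    using that unfolding AB_def t_def by (simp add: f_inv_into_f)
  have A_in: "x \<in> carrier G" if "x \<in> A" for x
    using that subgroup.mem_carrier[OF A] by simp
  have B_in: "x \<in> carrier G" if "x \<in> B" for x
    using that subgroup.mem_carrier[OF B] by simp
  have C_sub: "C \<subseteq> carrier G"
    using subgroup.subset[OF C] .
  define \<phi> where "\<phi> = (\<lambda>(T, D). D #> t T)"
  have \<phi>: "\<phi> (T, C #> b) = C #> (b \<otimes> t T)" if "T \<in> AB" "b \<in> B" for T b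
    unfolding \<phi>_def using coset_mult_assoc[OF C_sub B_in[OF that(2)] A_in[OF tA[OF that(1)]]] by simp
  have "bij_betw \<phi> (AB \<times> BC) ((\<lambda>x. C #> x) ` A)"
  proof (rule bij_betwI')
    fix p q assume "p \<in> AB \<times> BC" "q \<in> AB \<times> BC"
    then obtain T b S c where p: "p = (T, C #> b)" "T \<in> AB" "b \<in> B"
      and q: "q = (S, C #> c)" "S \<in> AB" "c \<in> B"
      unfolding BC_def by auto
    have in_G: "b \<in> carrier G" "c \<in> carrier G" "t T \<in> carrier G" "t S \<in> carrier G"
      using p q B_in A_in tA by auto
    show "\<phi> p = \<phi> q \<longleftrightarrow> p = q"
    proof
      assume "\<phi> p = \<phi> q"
      then have eq: "C #> (b \<otimes> t T) = C #> (c \<otimes> t S)"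
        using \<phi> p q by simp
      then have "(b \<otimes> t T) \<otimes> inv (c \<otimes> t S) \<in> C"
        using r_coset_eq_iff[OF C] in_G by simp
      then have B1: "b \<otimes> t T \<otimes> inv t S \<otimes> inv c \<in> B"
        using in_G assms(5) by (auto simp: inv_mult_group m_assoc)
      have "inv b \<otimes> (b \<otimes> t T \<otimes> inv t S \<otimes> inv c) \<otimes> c \<in> B"
        using subgroup.m_closed[OF B subgroup.m_closed[OF B subgroup.m_inv_closed[OF B p(3)] B1] q(3)] .
      moreover have "inv b \<otimes> (b \<otimes> t T \<otimes> inv t S \<otimes> inv c) \<otimes> c = t T \<otimes> inv t S"
        using in_G by (simp add: m_assoc mult_inv_cancel)
      ultimately have "T = S"
        using r_coset_eq_iff[OF B in_G(3,4)] tT p(2) q(2) by simp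
      have "(b \<otimes> t T) \<otimes> inv (c \<otimes> t S) = b \<otimes> inv c"
        using in_G \<open>T = S\<close> by (simp add: inv_mult_group m_assoc mult_inv_cancel)
      then have "C #> b = C #> c"
        using eq r_coset_eq_iff[OF C] in_G by simp
      then show "p = q"
        using p(1) q(1) \<open>T = S\<close> by (simp only:)
    qed simp
  next
    fix p assume "p \<in> AB \<times> BC"
    then obtain T b where p: "p = (T, C #> b)" "T \<in> AB" "b \<in> B"
      unfolding BC_def by auto
    have "b \<otimes> t T \<in> A"
      using subgroup.m_closed[OF A _ tA[OF p(2)]] p(3) assms(4) by auto
    then show "\<phi> p \<in> (\<lambda>x. C #> x) ` A"
      using \<phi>[OF p(2,3)] p(1) by auto
  next
    fix D assume "D \<in> (\<lambda>x. C #> x) ` A"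
    then obtain x where x: "x \<in> A" "D = C #> x"
      by auto
    define T where "T = B #> x"
    have T: "T \<in> AB"
      using x unfolding T_def AB_def by auto
    have in_G: "x \<in> carrier G" "t T \<in> carrier G"
      using x A_in tA[OF T] by auto
    have b: "x \<otimes> inv t T \<in> B"
      using r_coset_eq_iff[OF B in_G] tT[OF T] T_def by simp
    have "\<phi> (T, C #> (x \<otimes> inv t T)) = D"
      using \<phi>[OF T b] x in_G by (simp add: m_assoc)
    moreover have "(T, C #> (x \<otimes> inv t T)) \<in> AB \<times> BC"
      using T b unfolding BC_def by auto
    ultimately show "\<exists>p\<in>AB \<times> BC. D = \<phi> p"
      by metis
  qed
  then show ?thesis
    unfolding index_def AB_def BC_def using bij_betw_same_card card_cartesian_product by metis
qed

lemma index_set_mult: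
  assumes P: "subgroup P G" and N: "subgroup N G"
  shows "index (N <#> P) N = index P (N \<inter> P)"
proof -
  have PG: "x \<in> carrier G" if "x \<in> P" for x
    using that subgroup.mem_carrier[OF P] by simp
  have NG: "x \<in> carrier G" if "x \<in> N" for x
    using that subgroup.mem_carrier[OF N] by simp
  have "(\<lambda>x. N #> x) ` (N <#> P) = (\<lambda>x. N #> x) ` P"
  proof -
    have "N #> (n \<otimes> x) = N #> x" if "n \<in> N" "x \<in> P" for n x
      using that coset_mult_assoc[OF subgroup.subset[OF N] NG PG] coset_join2[OF NG N]
      by metis
    then have "(\<lambda>x. N #> x) ` (N <#> P) = (\<Union>n\<in>N. (\<lambda>x. N #> x) ` P)"
      unfolding set_mult_def by (auto simp: image_iff)
    then show ?thesis
      using subgroup.one_closed[OF N] by auto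
  qed
  moreover have "card ((\<lambda>x. (N \<inter> P) #> x) ` P) = card ((\<lambda>x. N #> x) ` P)"
  proof (rule card_image_transfer[where f = id])
    fix x y assume xy: "x \<in> P" "y \<in> P"
    have "x \<otimes> inv y \<in> P"
      using xy subgroup.m_closed[OF P] subgroup.m_inv_closed[OF P] by simp
    then show "(N \<inter> P) #> x = (N \<inter> P) #> y \<longleftrightarrow> N #> id x = N #> id y"
      using r_coset_eq_iff[OF N] r_coset_eq_iff[OF subgroups_Inter_pair[OF N P]] xy PG by simp
  qed simp
  ultimately show ?thesis
    by (simp add: index_def)
qed

lemma conjugate_eq_image:
  "g \<in> carrier G \<Longrightarrow> A \<subseteq> carrier G \<Longrightarrow> (g <#\<^bsub>G\<^esub> A) #> inv g = (\<lambda>a. g \<otimes> a \<otimes> inv g) ` A"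
  unfolding l_coset_def r_coset_def by (auto simp: image_iff)

lemma conjugation_hom:
  assumes "g \<in> carrier G"
  shows "(\<lambda>a. g \<otimes> a \<otimes> inv g) \<in> hom G G"
proof (rule homI)
  fix x y assume "x \<in> carrier G" "y \<in> carrier G"
  then show "g \<otimes> (x \<otimes> y) \<otimes> inv g = g \<otimes> x \<otimes> inv g \<otimes> (g \<otimes> y \<otimes> inv g)"
    using assms by (simp add: m_assoc mult_inv_cancel)
qed (use assms in simp)

lemma conjugation_inj:
  assumes "g \<in> carrier G"
  shows "inj_on (\<lambda>a. g \<otimes> a \<otimes> inv g) (carrier G)"
  using assms by (auto intro!: inj_onI)

lemma subgroup_conjugate:
  assumes "g \<in> carrier G" "subgroup A G"
  shows "subgroup ((\<lambda>a. g \<otimes> a \<otimes> inv g) ` A) G"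
proof -
  interpret group_hom G G "\<lambda>a. g \<otimes> a \<otimes> inv g"
    using conjugation_hom[OF assms(1)] by unfold_locales
  show ?thesis
    using subgroup_img_is_subgroup[OF assms(2)] .
qed

lemma normal_conjugate:
  assumes "g \<in> carrier G" "N \<lhd> G"
  shows "(\<lambda>a. g \<otimes> a \<otimes> inv g) ` N = N"
proof (intro equalityI subsetI)
  fix x assume "x \<in> (\<lambda>a. g \<otimes> a \<otimes> inv g) ` N"
  then show "x \<in> N"
    using normal.inv_op_closed2[OF assms(2) assms(1)] by auto
next
  fix x assume x: "x \<in> N"
  have xG: "x \<in> carrier G"
    using x subgroup.mem_carrier[OF normal_imp_subgroup[OF assms(2)]] by simp
  have "inv g \<otimes> x \<otimes> g \<in> N"
    using normal.inv_op_closed1[OF assms(2,1) x] .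
  moreover have "g \<otimes> (inv g \<otimes> x \<otimes> g) \<otimes> inv g = x"
    using xG assms(1) by (simp add: m_assoc mult_inv_cancel)
  ultimately show "x \<in> (\<lambda>a. g \<otimes> a \<otimes> inv g) ` N"
    by (metis (no_types, lifting) imageI)
qed

lemma index_conjugate:
  assumes g: "g \<in> carrier G" and A: "subgroup A G" and B: "subgroup B G"
  shows "index ((\<lambda>a. g \<otimes> a \<otimes> inv g) ` A) ((\<lambda>a. g \<otimes> a \<otimes> inv g) ` B) = index A B"
proof -
  let ?c = "\<lambda>a. g \<otimes> a \<otimes> inv g"
  interpret c: group_hom G G ?c
    using conjugation_hom[OF g] by unfold_locales
  have "card ((\<lambda>x. B #> x) ` A) = card ((\<lambda>x. (?c ` B) #> x) ` (?c ` A))"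
  proof (rule card_image_transfer[where f = ?c])
    fix x y assume "x \<in> A" "y \<in> A"
    then have xy: "x \<in> carrier G" "y \<in> carrier G"
      using subgroup.mem_carrier[OF A] by auto
    have "?c x \<otimes> inv (?c y) = ?c (x \<otimes> inv y)"
      using xy c.hom_mult c.hom_inv inv_closed by metis
    moreover have "?c (x \<otimes> inv y) \<in> ?c ` B \<longleftrightarrow> x \<otimes> inv y \<in> B"
      by (rule inj_on_image_mem_iff[OF conjugation_inj[OF g]]) (use xy subgroup.subset[OF B] in auto)
    ultimately show "B #> x = B #> y \<longleftrightarrow> (?c ` B) #> ?c x = (?c ` B) #> ?c y"
      using r_coset_eq_iff[OF B xy] r_coset_eq_iff[OF subgroup_conjugate[OF g B], of "?c x" "?c y"] xy g
      by simp
  qed simp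
  then show ?thesis
    by (simp add: index_def)
qed

lemma subgroup_normal_mult:
  assumes "N \<lhd> G" "subgroup P G"
  shows "subgroup (N <#> P) G" "N \<subseteq> N <#> P" "P \<subseteq> N <#> P" "P <#> N = N <#> P"
proof -
  show "P <#> N = N <#> P"
    using commut_normal[OF assms(2,1)] by simp
  show "subgroup (N <#> P) G"
    using mult_norm_subgroup[OF assms] .
  have sub: "N \<subseteq> carrier G" "P \<subseteq> carrier G" "\<one> \<in> N" "\<one> \<in> P"
    using subgroup.subset subgroup.one_closed assms(2) normal_imp_subgroup[OF assms(1)] by blast+
  show "N \<subseteq> N <#> P"
  proof
    fix x assume "x \<in> N"
    then have "x = x \<otimes> \<one>"
      using sub by auto
    then show "x \<in> N <#> P"
      using \<open>x \<in> N\<close> sub(4) unfolding set_mult_def by blast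
  qed
  show "P \<subseteq> N <#> P"
  proof
    fix x assume "x \<in> P"
    then have "x = \<one> \<otimes> x"
      using sub by auto
    then show "x \<in> N <#> P"
      using \<open>x \<in> P\<close> sub(3) unfolding set_mult_def by blast
  qed
qed

end

section \<open>Existence of Sylow subgroups in a complete filtered group\<close>

context group
begin

lemma sylow_over_normal:
  assumes N: "N \<lhd> G" and Q: "subgroup Q G" and "N \<subseteq> Q" and fin: "index Q N \<noteq> 0"
    and p: "Factorial_Ring.prime p"
  obtains S k where "subgroup S G" "N \<subseteq> S" "S \<subseteq> Q" "index S N = p ^ k" "\<not> p dvd index Q S"
proof -
  let ?Q = "G\<lparr>carrier := Q\<rparr>"
  interpret N: normal N ?Q
    using normal_restrict_supergroup[OF Q N assms(3)] .
  have cosets: "carrier (?Q Mod N) = (\<lambda>x. N #> x) ` Q"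
    by (simp add: carrier_FactGroup r_coset_def)
  then have order: "Coset.order (?Q Mod N) = index Q N"
    by (simp add: Coset.order_def index_def)
  obtain m where m: "index Q N = p ^ multiplicity p (index Q N) * m" "\<not> p dvd m"
    using multiplicity_decompose'[OF fin, of p] p not_prime_unit by metis
  have "finite (carrier (?Q Mod N))"
    using fin cosets unfolding index_def by (metis card.infinite)
  then obtain H where H: "subgroup H (?Q Mod N)" "card H = p ^ multiplicity p (index Q N)"
    using sylow_thm[OF p N.factorgroup_is_group] order m(1) by metis
  define S where "S = \<Union>H"
  have S: "subgroup S ?Q"
    unfolding S_def using N.factgroup_subgroup_union_subgroup[OF H(1)] .
  have S_char: "S = {x \<in> Q. N #> x \<in> H}"
    unfolding S_def using N.factgroup_subgroup_union_char[OF H(1)] by (simp add: r_coset_def)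
  have SG: "subgroup S G"
    using incl_subgroup[OF Q S] .
  have NH: "N \<in> H"
    using subgroup.one_closed[OF H(1)] by simp
  have "N \<subseteq> S"
    using NH unfolding S_def by auto
  moreover have "S \<subseteq> Q"
    using S_char by auto
  moreover have card: "index S N = p ^ multiplicity p (index Q N)"
  proof -
    have "(\<lambda>x. N #> x) ` S = H"
      using S_char subgroup.subset[OF H(1)] cosets by auto
    then show ?thesis
      using H(2) by (simp add: index_def)
  qed
  moreover have "index Q S = m"
  proof -
    have "p ^ multiplicity p (index Q N) \<noteq> 0"
      using p by auto
    then show ?thesis
      using index_mult[OF Q SG normal_imp_subgroup[OF N] \<open>S \<subseteq> Q\<close> \<open>N \<subseteq> S\<close>] m(1) card
      by (metis mult.commute mult_right_cancel)
  qed
  ultimately show thesis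
    using that SG m(2) by metis
qed

text \<open>Over the quotients by the members of a descending chain of normal subgroups, Sylow subgroups
  can be chosen compatibly, because a \<open>p\<close>-Sylow subgroup of the preimage of a \<open>p\<close>-group
  surjects onto that \<open>p\<close>-group. The intersection \<open>P\<close> of their preimages \<open>Q n\<close>
  still surjects onto each of them: an element of \<open>Q n\<close> lifts
  step by step, and completeness provides the limit of the lifts.\<close>

lemma exists_sylow_filtration:
  fixes U :: "nat \<Rightarrow> 'a set"
  assumes U: "\<And>n. U n \<lhd> G" and dec: "\<And>n. U (Suc n) \<subseteq> U n"
    and fin: "\<And>n. index (carrier G) (U n) \<noteq> 0"
    and complete: "\<And>g. (\<And>n. g n \<in> carrier G) \<Longrightarrow> (\<And>n. inv (g n) \<otimes> g (Suc n) \<in> U n)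
      \<Longrightarrow> \<exists>x\<in>carrier G. \<forall>n. inv (g n) \<otimes> x \<in> U n"
    and p: "Factorial_Ring.prime p"
  obtains P where "subgroup P G" "P = (\<Inter>n. U n <#> P)"
    "\<And>n. \<exists>k. index P (U n \<inter> P) = p ^ k" "\<And>n. \<not> p dvd index (carrier G) (U n <#> P)"
proof -
  have GG: "subgroup (carrier G) G"
    by (rule subgroup_self)
  have Usub: "subgroup (U n) G" for n
    using normal_imp_subgroup[OF U] .
  have UG: "U n \<subseteq> carrier G" for n
    using subgroup.subset[OF Usub] .
  define good where "good = (\<lambda>n Q. subgroup Q G \<and> U n \<subseteq> Q \<and> (\<exists>k. index Q (U n) = p ^ k)
    \<and> \<not> p dvd index (carrier G) Q)"
  have start: "\<exists>Q. good 0 Q"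
  proof -
    obtain S k where "subgroup S G" "U 0 \<subseteq> S" "S \<subseteq> carrier G" "index S (U 0) = p ^ k"
      "\<not> p dvd index (carrier G) S"
      using sylow_over_normal[OF U GG UG fin p] by metis
    then show ?thesis
      unfolding good_def by blast
  qed
  have step: "\<exists>S. good (Suc n) S \<and> S \<subseteq> Q \<and> Q = U n <#> S" if Q: "good n Q" for n Q
  proof -
    have QG: "subgroup Q G" and UQ: "U n \<subseteq> Q"
      using Q unfolding good_def by auto
    obtain k where k: "index Q (U n) = p ^ k"
      using Q unfolding good_def by auto
    have UQ': "U (Suc n) \<subseteq> Q"
      using UQ dec by blast
    have "index Q (U (Suc n)) \<noteq> 0"
      using fin[of "Suc n"] index_mult[OF GG QG Usub subgroup.subset[OF QG] UQ'] by simp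
    then obtain S j where S: "subgroup S G" "U (Suc n) \<subseteq> S" "S \<subseteq> Q" "index S (U (Suc n)) = p ^ j"
      "\<not> p dvd index Q S"
      using sylow_over_normal[OF U QG UQ' _ p] by metis
    have US: "subgroup (U n <#> S) G" "U n \<subseteq> U n <#> S" "S \<subseteq> U n <#> S"
      using subgroup_normal_mult[OF U S(1)] by auto
    have USQ: "U n <#> S \<subseteq> Q"
      using UQ S(3) subgroup.m_closed[OF QG] unfolding set_mult_def by blast
    have "index Q (U n <#> S) dvd p ^ k"
      using index_mult[OF QG US(1) Usub USQ US(2)] k by (metis dvd_triv_left)
    then obtain i where i: "index Q (U n <#> S) = p ^ i"
      using divides_primepow_nat[OF p] by blast
    have "index Q (U n <#> S) dvd index Q S"
      using index_mult[OF QG US(1) S(1) USQ US(3)] by simp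
    then have "\<not> p dvd p ^ i"
      using S(5) i dvd_trans by metis
    then have "i = 0"
      using dvd_power by (metis neq0_conv)
    then have "Q = U n <#> S"
      using index_eq_1_imp_subset[OF QG US(1)] i USQ by simp
    moreover have "\<not> p dvd index (carrier G) S"
      using index_mult[OF GG QG S(1) subgroup.subset[OF QG] S(3)] S(5) Q
      by (simp add: good_def prime_dvd_mult_iff[OF p])
    ultimately show ?thesis
      unfolding good_def using S by blast
  qed
  obtain Q where Q: "\<And>n. good n (Q n)"
    and Q_step: "\<And>n. Q (Suc n) \<subseteq> Q n \<and> Q n = U n <#> Q (Suc n)"
    using dependent_nat_choice[of good "\<lambda>n Q S. S \<subseteq> Q \<and> Q = U n <#> S"] start step by metis
  have QG: "subgroup (Q n) G" and UQ: "U n \<subseteq> Q n" and Qp: "\<exists>k. index (Q n) (U n) = p ^ k"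
    and Qi: "\<not> p dvd index (carrier G) (Q n)" for n
    using Q[of n] unfolding good_def by auto
  have Q_carrier: "x \<in> carrier G" if "x \<in> Q n" for x n
    using subgroup.mem_carrier[OF QG that] .
  define P where "P = (\<Inter>n. Q n)"
  have PG: "subgroup P G"
    unfolding P_def by (rule subgroups_Inter) (use QG in auto)
  have QP: "Q n = U n <#> P" for n
  proof
    show "U n <#> P \<subseteq> Q n"
    proof
      fix x assume "x \<in> U n <#> P"
      then obtain u y where "u \<in> U n" "y \<in> P" "x = u \<otimes> y"
        unfolding set_mult_def by auto
      then show "x \<in> Q n"
        using subgroup.m_closed[OF QG, of u n y] UQ unfolding P_def by auto
    qed
    show "Q n \<subseteq> U n <#> P"
    proof
      fix x assume x: "x \<in> Q n"
      have lift: "\<exists>z. z \<in> Q (Suc m) \<and> inv y \<otimes> z \<in> U m" if y: "y \<in> Q m" for m y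
      proof -
        have "y \<in> Q (Suc m) <#> U m"
          using y Q_step[of m] commut_normal[OF QG U, of "Suc m" m] by simp
        then obtain z u where zu: "z \<in> Q (Suc m)" "u \<in> U m" "y = z \<otimes> u"
          unfolding set_mult_def by blast
        have "inv y \<otimes> z = inv u"
          using zu Q_carrier[OF zu(1)] subsetD[OF UG zu(2)]
          by (simp add: inv_mult_group m_assoc)
        then show ?thesis
          using zu subgroup.m_inv_closed[OF Usub zu(2)] by auto
      qed
      have "\<exists>h. \<forall>k. (h k \<in> Q (n + k) \<and> (k = 0 \<longrightarrow> h k = x)) \<and>
          inv (h k) \<otimes> h (Suc k) \<in> U (n + k)"
      proof (rule dependent_nat_choice)
        show "\<exists>z. z \<in> Q (n + 0) \<and> (0 = 0 \<longrightarrow> z = x)"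
          using x by auto
        show "\<exists>z. (z \<in> Q (n + Suc k) \<and> (Suc k = 0 \<longrightarrow> z = x)) \<and> inv y \<otimes> z \<in> U (n + k)"
          if "y \<in> Q (n + k) \<and> (k = 0 \<longrightarrow> y = x)" for y k
          using lift[of y "n + k"] that by simp
      qed
      then obtain h where h: "\<And>k. h k \<in> Q (n + k)" "h 0 = x" "\<And>k. inv (h k) \<otimes> h (Suc k) \<in> U (n + k)"
        by auto
      define g where "g = (\<lambda>k. h (k - n))"
      have "\<exists>y\<in>carrier G. \<forall>k. inv (g k) \<otimes> y \<in> U k"
      proof (rule complete)
        show "g k \<in> carrier G" for k
          unfolding g_def using Q_carrier[OF h(1)] .
        show "inv (g k) \<otimes> g (Suc k) \<in> U k" for k
        proof (cases "n \<le> k")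
          case True
          then show ?thesis
            unfolding g_def using h(3)[of "k - n"] by (simp add: Suc_diff_le)
        next
          case False
          then have "g k = x" "g (Suc k) = x"
            unfolding g_def using h(2) by auto
          then show ?thesis
            using subgroup.one_closed[OF Usub] Q_carrier[OF x] by simp
        qed
      qed
      then obtain y where y: "y \<in> carrier G" "\<And>k. inv (g k) \<otimes> y \<in> U k"
        by auto
      have Q_dec: "Q (m + k) \<subseteq> Q m" for m k
      proof (induction k)
        case (Suc k)
        then show ?case
          using Q_step[of "m + k"] by (simp only: add_Suc_right) blast
      qed simp
      have "y \<in> Q m" for m
      proof -
        have hm: "h m \<in> Q (m + n)"
          using h(1)[of m] by (simp add: add.commute)
        have "inv (h m) \<otimes> y \<in> Q (m + n)"
          using y(2)[of "m + n"] UQ[of "m + n"] unfolding g_def by auto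
        then have "h m \<otimes> (inv (h m) \<otimes> y) \<in> Q (m + n)"
          using subgroup.m_closed[OF QG hm] by simp
        then show ?thesis
          using mult_inv_cancel(1)[OF Q_carrier[OF hm] y(1)] Q_dec by auto
      qed
      then have "y \<in> P"
        unfolding P_def by simp
      have "inv x \<otimes> y \<in> U n"
        using y(2)[of n] h(2) unfolding g_def by simp
      then have "inv (inv x \<otimes> y) \<in> U n"
        using subgroup.m_inv_closed[OF Usub] by simp
      moreover have "x = y \<otimes> inv (inv x \<otimes> y)"
        using Q_carrier[OF x] y(1) by (simp add: inv_mult_group mult_inv_cancel)
      ultimately have "x \<in> P <#> U n"
        using \<open>y \<in> P\<close> unfolding set_mult_def by blast
      then show "x \<in> U n <#> P"
        using commut_normal[OF PG U] by simp
    qed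
  qed
  show thesis
  proof (rule that[OF PG])
    show "P = (\<Inter>n. U n <#> P)"
      unfolding QP[symmetric] by (rule P_def)
    show "\<exists>k. index P (U n \<inter> P) = p ^ k" for n
      using Qp[of n] unfolding QP index_set_mult[OF PG Usub] .
    show "\<not> p dvd index (carrier G) (U n <#> P)" for n
      using Qi[of n] unfolding QP .
  qed
qed

end

section \<open>Subgroups of prime index in a finite solvable group\<close>

context group
begin

lemma card_subgroup_dvd:
  assumes "subgroup A G" "subgroup B G" "B \<subseteq> A"
  shows "card B dvd card A"
proof -
  interpret A: group "G\<lparr>carrier := A\<rparr>"
    using subgroup.subgroup_is_group[OF assms(1) is_group] .
  show ?thesis
    using A.lagrange[OF subgroup_incl[OF assms(2,1,3)]] by (simp add: Coset.order_def flip: dvd_def) (metis dvd_triv_right)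
qed

lemma subgroup_of_prime_card:
  assumes "subgroup A G" "subgroup B G" "B \<subseteq> A" "finite A" "Factorial_Ring.prime (card A)"
  shows "B = {\<one>} \<or> B = A"
proof -
  have "card B = 1 \<or> card B = card A"
    using card_subgroup_dvd[OF assms(1-3)] assms(5) by (simp add: prime_nat_iff)
  then show ?thesis
  proof
    assume "card B = 1"
    then show ?thesis
      using subgroup.one_closed[OF assms(2)] by (metis card_1_singletonE singletonD)
  next
    assume "card B = card A"
    then show ?thesis
      using card_subset_eq[OF assms(4,3)] by simp
  qed
qed

lemma card_set_mult_disjoint:
  assumes A: "subgroup A G" and B: "subgroup B G" and "A \<inter> B = {\<one>}"
  shows "card (A <#> B) = card A * card B"
proof -
  have "inj_on (\<lambda>(a, b). a \<otimes> b) (A \<times> B)"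
  proof (rule inj_onI, clarify)
    fix a b c d assume in_AB: "a \<in> A" "b \<in> B" "c \<in> A" "d \<in> B" and eq: "a \<otimes> b = c \<otimes> d"
    have in_G: "a \<in> carrier G" "b \<in> carrier G" "c \<in> carrier G" "d \<in> carrier G"
      using in_AB subgroup.mem_carrier[OF A] subgroup.mem_carrier[OF B] by auto
    have "inv c \<otimes> (a \<otimes> b) \<otimes> inv b = inv c \<otimes> (c \<otimes> d) \<otimes> inv b"
      by (simp only: eq)
    then have ca: "inv c \<otimes> a = d \<otimes> inv b"
      using in_G by (simp add: m_assoc mult_inv_cancel)
    have "inv c \<otimes> a \<in> A" "d \<otimes> inv b \<in> B"
      using in_AB subgroup.m_closed[OF A] subgroup.m_inv_closed[OF A]
        subgroup.m_closed[OF B] subgroup.m_inv_closed[OF B] by auto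
    then have "inv c \<otimes> a = \<one>" "d \<otimes> inv b = \<one>"
      using ca assms(3) by auto
    then show "a = c \<and> b = d"
      using in_G by (metis inv_closed inv_equality inv_inv)
  qed
  moreover have "A <#> B = (\<lambda>(a, b). a \<otimes> b) ` (A \<times> B)"
    unfolding set_mult_def by auto
  ultimately show ?thesis
    by (simp add: card_image card_cartesian_product)
qed

lemma solvable_abelian_normal:
  assumes "solvable G" and "carrier G \<noteq> {\<one>}"
  obtains A where "A \<lhd> G" "A \<noteq> {\<one>}" "\<And>a b. a \<in> A \<Longrightarrow> b \<in> A \<Longrightarrow> a \<otimes> b = b \<otimes> a"
proof -
  define D where "D = (\<lambda>n. (derived G ^^ n) (carrier G))"
  have D_normal: "D n \<lhd> G" for n
  proof (induction n)
    case 0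
    show ?case
      unfolding D_def using normal_self by simp
  next
    case (Suc n)
    then show ?case
      unfolding D_def using derived_is_normal by simp
  qed
  have "\<exists>n. D n = {\<one>}"
    using assms(1) unfolding D_def solvable_iff_trivial_derived_seq .
  then obtain n where n: "D n = {\<one>}" "\<And>m. m < n \<Longrightarrow> D m \<noteq> {\<one>}"
    using exists_least_iff[of "\<lambda>n. D n = {\<one>}"] by auto
  have "n \<noteq> 0"
  proof
    assume "n = 0"
    then show False
      using n(1) assms(2) by (simp add: D_def)
  qed
  then obtain m where m: "n = Suc m"
    using not0_implies_Suc by auto
  have D_carrier: "x \<in> carrier G" if "x \<in> D m" for x
    using subgroup.mem_carrier[OF normal_imp_subgroup[OF D_normal] that] .
  show thesis
  proof (rule that[OF D_normal[of m]])
    show "D m \<noteq> {\<one>}"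
      using n(2) m by simp
    fix a b assume ab: "a \<in> D m" "b \<in> D m"
    have "a \<otimes> b \<otimes> inv a \<otimes> inv b \<in> derived_set G (D m)"
      using ab by auto
    then have "a \<otimes> b \<otimes> inv a \<otimes> inv b \<in> D n"
      unfolding m D_def funpow.simps o_def derived_def by (rule generate.incl)
    then have "a \<otimes> b \<otimes> inv a \<otimes> inv b = \<one>"
      using n(1) by simp
    then have "(a \<otimes> b) \<otimes> inv (b \<otimes> a) = \<one>"
      using ab D_carrier by (simp add: inv_mult_group m_assoc)
    then show "a \<otimes> b = b \<otimes> a"
      using ab D_carrier by (metis inv_closed inv_equality inv_inv m_closed)
  qed
qed


text \<open>Such a group is a group of affine transformations of a line with a prime number of points: an abelian normal
  subgroup \<open>A\<close> serves as the group of translations, and \<open>H\<close>, the stabilizer of a point, is an abelian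
  complement whose nontrivial elements have no fixed point in \<open>A - {\<one>}\<close>. A second subgroup
  \<open>J\<close> of the same order is another abelian complement of \<open>A\<close>. For \<open>h \<noteq> \<one>\<close> in
  \<open>H\<close>, the coset \<open>A h\<close> meets \<open>J\<close>, and it consists of \<open>A\<close>-conjugates
  of \<open>h\<close>; hence a conjugate of \<open>J\<close> contains \<open>h\<close>, commutes with it, and so lies in
  the centralizer of \<open>h\<close>, which is \<open>H\<close>.\<close>

lemma solvable_prime_index_conjugate:
  assumes fin: "finite (carrier G)" and "solvable G"
    and H: "subgroup H G" and J: "subgroup J G"
    and prime: "Factorial_Ring.prime (index (carrier G) H)"
    and core: "\<And>N. N \<lhd> G \<Longrightarrow> N \<subseteq> H \<Longrightarrow> N = {\<one>}"
    and card: "card J = card H"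
  shows "\<exists>g\<in>carrier G. (\<lambda>x. g \<otimes> x \<otimes> inv g) ` J = H"
proof -
  define p where "p = index (carrier G) H"
  have p: "Factorial_Ring.prime p"
    using prime by (simp add: p_def)
  have order: "card (carrier G) = p * card H"
    using lagrange[OF H] by (simp add: index_rcosets p_def Coset.order_def)
  have finH: "finite H" and finJ: "finite J"
    using finite_subset[OF subgroup.subset fin] H J by auto
  have cardH: "card H \<noteq> 0"
    using finH subgroup.one_closed[OF H] by auto
  have HG: "x \<in> carrier G" if "x \<in> H" for x
    using subgroup.mem_carrier[OF H that] .
  have JG: "x \<in> carrier G" if "x \<in> J" for x
    using subgroup.mem_carrier[OF J that] .
  have "carrier G \<noteq> {\<one>}"
  proof
    assume "carrier G = {\<one>}"
    then have "p * card H = 1"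
      using order by simp
    then show False
      using p by auto
  qed
  then obtain A where A: "A \<lhd> G" and A1: "A \<noteq> {\<one>}"
    and comm: "\<And>a b. a \<in> A \<Longrightarrow> b \<in> A \<Longrightarrow> a \<otimes> b = b \<otimes> a"
    using solvable_abelian_normal[OF assms(2)] by blast
  have AS: "subgroup A G"
    using normal_imp_subgroup[OF A] .
  have AG: "x \<in> carrier G" if "x \<in> A" for x
    using subgroup.mem_carrier[OF AS that] .
  have finA: "finite A"
    using finite_subset[OF subgroup.subset[OF AS] fin] .
  have conjA: "g \<otimes> a \<otimes> inv g \<in> A" if "g \<in> carrier G" "a \<in> A" for g a
    using normal.inv_op_closed2[OF A that] .
  have AH: "subgroup (A <#> H) G" "A \<subseteq> A <#> H" "H \<subseteq> A <#> H"
    using subgroup_normal_mult[OF A H] by auto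
  \<comment> \<open>A subgroup of prime index is maximal, and \<open>A\<close> is not contained in \<open>H\<close>.\<close>
  have G_AH: "A <#> H = carrier G"
  proof -
    have "p = index (carrier G) (A <#> H) * index (A <#> H) H"
      unfolding p_def using index_mult[OF subgroup_self AH(1) H subgroup.subset[OF AH(1)] AH(3)] .
    then have "index (carrier G) (A <#> H) = 1 \<or> index (A <#> H) H = 1"
      using p by (metis prime_product)
    moreover have "index (A <#> H) H \<noteq> 1"
      using index_eq_1_imp_subset[OF AH(1) H] AH(2) core[OF A] A1 by auto
    ultimately show ?thesis
      using index_eq_1_imp_subset[OF subgroup_self AH(1)] subgroup.subset[OF AH(1)] by auto
  qed
  have decompose: "\<exists>a\<in>A. \<exists>h\<in>H. g = a \<otimes> h" if "g \<in> carrier G" for g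
    using that unfolding G_AH[symmetric] set_mult_def by auto
  \<comment> \<open>Since \<open>G = A H\<close>, such a \<open>B\<close> is normal in \<open>G\<close>.\<close>
  have trivial: "B = {\<one>}" if B: "subgroup B G" "B \<subseteq> H"
    and BH: "\<And>h b. h \<in> H \<Longrightarrow> b \<in> B \<Longrightarrow> h \<otimes> b \<otimes> inv h \<in> B"
    and BA: "\<And>a b. a \<in> A \<Longrightarrow> b \<in> B \<Longrightarrow> a \<otimes> b = b \<otimes> a" for B
  proof (rule core)
    have "g \<otimes> b \<otimes> inv g \<in> B" if "g \<in> carrier G" "b \<in> B" for g b
    proof -
      obtain a h where ah: "a \<in> A" "h \<in> H" "g = a \<otimes> h"
        using decompose[OF \<open>g \<in> carrier G\<close>] by auto
      define c where "c = h \<otimes> b \<otimes> inv h"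
      have c: "c \<in> B" "c \<in> carrier G"
        using BH[OF ah(2) \<open>b \<in> B\<close>] subgroup.mem_carrier[OF B(1)] by (auto simp: c_def)
      have in_G: "a \<in> carrier G" "h \<in> carrier G" "b \<in> carrier G"
        using AG[OF ah(1)] HG[OF ah(2)] subgroup.mem_carrier[OF B(1) \<open>b \<in> B\<close>] by auto
      have "g \<otimes> b \<otimes> inv g = a \<otimes> c \<otimes> inv a"
        unfolding ah(3) c_def using in_G by (simp add: m_assoc inv_mult_group)
      also have "\<dots> = c"
        using BA[OF ah(1) c(1)] in_G(1) c(2) by (simp add: m_assoc)
      finally show ?thesis
        using c by simp
    qed
    then show "B \<lhd> G"
      unfolding normal_inv_iff using B(1) by auto
  qed (use B in auto)
  have HA_disj: "A \<inter> H = {\<one>}"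
  proof (rule trivial[OF subgroups_Inter_pair[OF AS H]])
    show "h \<otimes> b \<otimes> inv h \<in> A \<inter> H" if "h \<in> H" "b \<in> A \<inter> H" for h b
      using that conjA HG subgroup.m_closed[OF H] subgroup.m_inv_closed[OF H] by auto
  qed (use comm in auto)
  have cardA: "card A = p"
    using card_set_mult_disjoint[OF AS H HA_disj] order cardH unfolding G_AH by simp
  have fixed_free: "a = \<one>" if h: "h \<in> H" "h \<noteq> \<one>" and a: "a \<in> A" "h \<otimes> a = a \<otimes> h" for h a
  proof -
    have centralizer: "subgroup {x \<in> B. \<forall>y\<in>C. x \<otimes> y = y \<otimes> x} G"
      if B: "subgroup B G" "C \<subseteq> carrier G" for B C
    proof (rule subgroupI)
      show "{x \<in> B. \<forall>y\<in>C. x \<otimes> y = y \<otimes> x} \<subseteq> carrier G"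
        using subgroup.subset[OF B(1)] by auto
      have "\<one> \<in> {x \<in> B. \<forall>y\<in>C. x \<otimes> y = y \<otimes> x}"
        using subgroup.one_closed[OF B(1)] subsetD[OF B(2)] by simp
      then show "{x \<in> B. \<forall>y\<in>C. x \<otimes> y = y \<otimes> x} \<noteq> {}"
        by blast
      show "inv x \<in> {x \<in> B. \<forall>y\<in>C. x \<otimes> y = y \<otimes> x}" if x: "x \<in> {x \<in> B. \<forall>y\<in>C. x \<otimes> y = y \<otimes> x}" for x
      proof -
        have "inv x \<otimes> y = y \<otimes> inv x" if "y \<in> C" for y
        proof -
          have "inv x \<otimes> (x \<otimes> y) \<otimes> inv x = inv x \<otimes> (y \<otimes> x) \<otimes> inv x"
            using x that by auto
          then show ?thesis
            using subsetD[OF B(2) that] x subgroup.mem_carrier[OF B(1)]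
            by (simp add: m_assoc mult_inv_cancel)
        qed
        then show ?thesis
          using x subgroup.m_inv_closed[OF B(1)] by simp
      qed
      show "x \<otimes> z \<in> {x \<in> B. \<forall>y\<in>C. x \<otimes> y = y \<otimes> x}"
        if xz: "x \<in> {x \<in> B. \<forall>y\<in>C. x \<otimes> y = y \<otimes> x}" "z \<in> {x \<in> B. \<forall>y\<in>C. x \<otimes> y = y \<otimes> x}" for x z
      proof -
        have "x \<otimes> z \<otimes> y = y \<otimes> (x \<otimes> z)" if y: "y \<in> C" for y
        proof -
          have "x \<in> carrier G" "z \<in> carrier G" "y \<in> carrier G"
            using xz y subgroup.mem_carrier[OF B(1)] B(2) by auto
          moreover have "x \<otimes> y = y \<otimes> x" "z \<otimes> y = y \<otimes> z"
            using xz y by auto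
          ultimately show ?thesis
            using m_assoc by metis
        qed
        then show ?thesis
          using xz subgroup.m_closed[OF B(1)] by simp
      qed
    qed
    define C where "C = {x \<in> A. \<forall>y\<in>{h}. x \<otimes> y = y \<otimes> x}"
    have "subgroup C G"
      unfolding C_def by (rule centralizer[OF AS]) (use HG[OF h(1)] in simp)
    moreover have "C \<subseteq> A"
      unfolding C_def by auto
    ultimately have "C = {\<one>} \<or> C = A"
      using subgroup_of_prime_card[OF AS _ _ finA] cardA p by simp
    moreover have "C \<noteq> A"
    proof
      assume "C = A"
      define Z where "Z = {x \<in> H. \<forall>y\<in>A. x \<otimes> y = y \<otimes> x}"
      have "Z = {\<one>}"
      proof (rule trivial)
        show "subgroup Z G"
          unfolding Z_def by (rule centralizer[OF H subgroup.subset[OF AS]])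
        show "Z \<subseteq> H"
          unfolding Z_def by auto
        show "a \<otimes> b = b \<otimes> a" if "a \<in> A" "b \<in> Z" for a b
          using that unfolding Z_def by auto
        show "k \<otimes> b \<otimes> inv k \<in> Z" if kb: "k \<in> H" "b \<in> Z" for k b
        proof -
          have bH: "b \<in> H"
            using kb unfolding Z_def by auto
          have in_G: "k \<in> carrier G" "b \<in> carrier G"
            using HG kb(1) bH by auto
          have "k \<otimes> b \<otimes> inv k \<otimes> y = y \<otimes> (k \<otimes> b \<otimes> inv k)" if y: "y \<in> A" for y
          proof -
            have yG: "y \<in> carrier G"
              using AG[OF y] .
            have "inv k \<otimes> y \<otimes> k \<in> A"
              using normal.inv_op_closed1[OF A in_G(1) y] .
            then have "b \<otimes> (inv k \<otimes> y \<otimes> k) = (inv k \<otimes> y \<otimes> k) \<otimes> b"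
              using kb(2) unfolding Z_def by auto
            then have "k \<otimes> (b \<otimes> (inv k \<otimes> y \<otimes> k)) \<otimes> inv k = k \<otimes> ((inv k \<otimes> y \<otimes> k) \<otimes> b) \<otimes> inv k"
              by simp
            then show ?thesis
              using in_G yG by (simp add: m_assoc mult_inv_cancel)
          qed
          moreover have "k \<otimes> b \<otimes> inv k \<in> H"
            using kb(1) bH subgroup.m_closed[OF H] subgroup.m_inv_closed[OF H] by simp
          ultimately show ?thesis
            unfolding Z_def by simp
        qed
      qed
      moreover have "h \<in> Z"
      proof -
        have "h \<otimes> y = y \<otimes> h" if "y \<in> A" for y
        proof -
          have "y \<in> C"
            using that \<open>C = A\<close> by simp
          then show ?thesis
            unfolding C_def by simp
        qed
        then show ?thesis
          using h(1) unfolding Z_def by simp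
      qed
      ultimately show False
        using h(2) by simp
    qed
    ultimately have "C = {\<one>}"
      by blast
    moreover have "a \<in> C"
      using a unfolding C_def by simp
    ultimately show ?thesis
      by simp
  qed
  obtain a where a: "a \<in> A" "a \<noteq> \<one>"
    using A1 subgroup.one_closed[OF AS] by blast
  have aG: "a \<in> carrier G"
    using AG[OF a(1)] .
  have conj_inj: "h = k" if h: "h \<in> H" and k: "k \<in> H"
    and eq: "h \<otimes> a \<otimes> inv h = k \<otimes> a \<otimes> inv k" for h k
  proof -
    have in_G: "h \<in> carrier G" "k \<in> carrier G"
      using h k HG by auto
    have "inv k \<otimes> (h \<otimes> a \<otimes> inv h) \<otimes> h = inv k \<otimes> (k \<otimes> a \<otimes> inv k) \<otimes> h"
      by (simp only: eq)
    then have "(inv k \<otimes> h) \<otimes> a = a \<otimes> (inv k \<otimes> h)"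
      using in_G aG by (simp add: m_assoc mult_inv_cancel)
    moreover have "inv k \<otimes> h \<in> H"
      using h k subgroup.m_closed[OF H] subgroup.m_inv_closed[OF H] by simp
    ultimately have "inv k \<otimes> h = \<one>"
      using fixed_free[OF _ _ a(1)] a(2) by blast
    then show ?thesis
      using in_G by (metis inv_closed inv_equality inv_inv)
  qed
  have H_less: "card H < p"
  proof -
    have "(\<lambda>h. h \<otimes> a \<otimes> inv h) ` H \<subseteq> A - {\<one>}"
    proof clarify
      fix h assume h: "h \<in> H"
      have "h \<otimes> a \<otimes> inv h = h \<otimes> \<one> \<otimes> inv h \<Longrightarrow> a = \<one>"
        using inj_onD[OF conjugation_inj[OF HG[OF h]], of a \<one>] aG by simp
      then show "h \<otimes> a \<otimes> inv h \<in> A - {\<one>}"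
        using conjA[OF HG[OF h] a(1)] a(2) HG[OF h] by auto
    qed
    then have "card H \<le> card (A - {\<one>})"
      by (rule card_inj_on_le[rotated]) (use conj_inj finA in \<open>auto intro: inj_onI\<close>)
    then show ?thesis
      using cardA finA subgroup.one_closed[OF AS] card_Diff1_less[OF finA, of \<one>] by simp
  qed
  \<comment> \<open>Conjugations by elements of \<open>H\<close> act on the cyclic group \<open>A\<close> as powers, so they commute.\<close>
  have H_comm: "h \<otimes> k = k \<otimes> h" if h: "h \<in> H" and k: "k \<in> H" for h k
  proof -
    have gen: "A = {a [^] (n::int) | n. n \<in> UNIV}"
    proof -
      have "subgroup (generate G {a}) G" "generate G {a} \<subseteq> A"
        using generate_is_subgroup[of "{a}"] generate_subgroup_incl[of "{a}" A] AS a(1) aG by auto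
      moreover have "a \<in> generate G {a}"
        by (rule generate.incl) simp
      ultimately have "generate G {a} = A"
        using subgroup_of_prime_card[OF AS _ _ finA] cardA p a(2) by auto
      then show ?thesis
        using generate_pow[OF aG] by simp
    qed
    have power: "\<exists>n::int. g \<otimes> a \<otimes> inv g = a [^] n" if "g \<in> carrier G" for g
      using conjA[OF that a(1)] gen by auto
    have hom: "g \<otimes> (a [^] (n::int)) \<otimes> inv g = (g \<otimes> a \<otimes> inv g) [^] n" if "g \<in> carrier G" for g n
      using hom_int_pow[OF conjugation_hom[OF that] aG is_group is_group] .
    have in_G: "h \<in> carrier G" "k \<in> carrier G"
      using h k HG by auto
    obtain i j :: int where ij: "h \<otimes> a \<otimes> inv h = a [^] i" "k \<otimes> a \<otimes> inv k = a [^] j"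
      using power in_G by meson
    have "(h \<otimes> k) \<otimes> a \<otimes> inv (h \<otimes> k) = h \<otimes> (k \<otimes> a \<otimes> inv k) \<otimes> inv h"
      using in_G aG by (simp add: m_assoc inv_mult_group)
    also have "\<dots> = a [^] (i * j)"
      using ij hom[OF in_G(1)] aG by (simp add: int_pow_pow)
    also have "\<dots> = k \<otimes> (h \<otimes> a \<otimes> inv h) \<otimes> inv k"
      using ij hom[OF in_G(2)] aG by (simp add: int_pow_pow mult.commute)
    also have "\<dots> = (k \<otimes> h) \<otimes> a \<otimes> inv (k \<otimes> h)"
      using in_G aG by (simp add: m_assoc inv_mult_group)
    finally show ?thesis
      using conj_inj h k subgroup.m_closed[OF H] by blast
  qed
  have AJ_disj: "A \<inter> J = {\<one>}"
  proof -
    have "A \<inter> J \<noteq> A"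
    proof
      assume "A \<inter> J = A"
      then have "card A \<le> card J"
        using card_mono[OF finJ, of A] by auto
      then show False
        using card cardA H_less by simp
    qed
    then show ?thesis
      using subgroup_of_prime_card[OF AS subgroups_Inter_pair[OF AS J] _ finA] cardA p by auto
  qed
  have G_AJ: "A <#> J = carrier G"
  proof (rule card_subset_eq[OF fin])
    show "A <#> J \<subseteq> carrier G"
      using subgroup.subset[OF subgroup_normal_mult(1)[OF A J]] .
    show "card (A <#> J) = card (carrier G)"
      using card_set_mult_disjoint[OF AS J AJ_disj] order cardA card by simp
  qed
  have J_comm: "j \<otimes> k = k \<otimes> j" if j: "j \<in> J" and k: "k \<in> J" for j k
  proof -
    obtain b h c l where d: "b \<in> A" "h \<in> H" "j = b \<otimes> h" "c \<in> A" "l \<in> H" "k = c \<otimes> l"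
      using decompose JG j k by meson
    have in_G: "b \<in> carrier G" "h \<in> carrier G" "c \<in> carrier G" "l \<in> carrier G"
      "j \<in> carrier G" "k \<in> carrier G"
      using d AG HG JG j k by auto
    have drop: "A #> (x \<otimes> y) = A #> y" if "x \<in> A" "y \<in> carrier G" for x y
      using coset_mult_assoc[OF subgroup.subset[OF AS] AG[OF that(1)] that(2)]
        coset_join2[OF AG[OF that(1)] AS that(1)] by simp
    have "A #> (j \<otimes> k) = (A #> h) <#> (A #> l)"
      using normal.rcos_sum[OF A in_G(5,6)] drop d in_G by simp
    also have "\<dots> = (A #> l) <#> (A #> h)"
      using normal.rcos_sum[OF A] in_G H_comm[OF d(2,5)] by simp
    also have "\<dots> = A #> (k \<otimes> j)"
      using normal.rcos_sum[OF A in_G(6,5)] drop d in_G by simp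
    finally have "(j \<otimes> k) \<otimes> inv (k \<otimes> j) \<in> A"
      using r_coset_eq_iff[OF AS] in_G by simp
    moreover have "(j \<otimes> k) \<otimes> inv (k \<otimes> j) \<in> J"
      using j k subgroup.m_closed[OF J] subgroup.m_inv_closed[OF J] by simp
    ultimately have "(j \<otimes> k) \<otimes> inv (k \<otimes> j) = \<one>"
      using AJ_disj by auto
    then show ?thesis
      using in_G by (metis inv_closed inv_equality inv_inv m_closed)
  qed
  show ?thesis
  proof (cases "H = {\<one>}")
    case True
    then have "J = {\<one>}"
      using card subgroup.one_closed[OF J] by (metis card_1_singletonE One_nat_def card.empty card_insert_if empty_iff finite.emptyI singletonD)
    then show ?thesis
      using True by (intro bexI[of _ \<one>]) auto
  next
    case False
    then obtain h where h: "h \<in> H" "h \<noteq> \<one>"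
      using subgroup.one_closed[OF H] by blast
    have hG: "h \<in> carrier G"
      using HG[OF h(1)] .
    obtain b j where bj: "b \<in> A" "j \<in> J" "h = b \<otimes> j"
      using hG unfolding G_AJ[symmetric] set_mult_def by auto
    have in_G: "b \<in> carrier G" "j \<in> carrier G"
      using bj AG JG by auto
    have "j = inv b \<otimes> h"
      using bj in_G by (simp add: mult_inv_cancel)
    \<comment> \<open>As \<open>h\<close> commutes with no nontrivial element of \<open>A\<close>, its commutators with the elements of \<open>A\<close>
      are distinct and fill \<open>A\<close>. The one equal to \<open>inv b\<close> exhibits \<open>j\<close> as a conjugate of \<open>h\<close>.\<close>
    define f where "f = (\<lambda>c. c \<otimes> h \<otimes> inv c \<otimes> inv h)"
    have f_in: "f c \<in> A" if "c \<in> A" for c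
    proof -
      have "f c = c \<otimes> (h \<otimes> inv c \<otimes> inv h)"
        unfolding f_def using AG[OF that] hG by (simp add: m_assoc)
      then show ?thesis
        using conjA[OF hG subgroup.m_inv_closed[OF AS that]] subgroup.m_closed[OF AS that] by simp
    qed
    have "inj_on f A"
    proof (rule inj_onI)
      fix c d assume cd: "c \<in> A" "d \<in> A" "f c = f d"
      have cdG: "c \<in> carrier G" "d \<in> carrier G"
        using cd AG by auto
      have "inv d \<otimes> (f c) \<otimes> h \<otimes> c = inv d \<otimes> (f d) \<otimes> h \<otimes> c"
        by (simp only: cd(3))
      then have "h \<otimes> (inv d \<otimes> c) = (inv d \<otimes> c) \<otimes> h"
        unfolding f_def using cdG hG by (simp add: m_assoc mult_inv_cancel)
      moreover have "inv d \<otimes> c \<in> A"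
        using cd subgroup.m_closed[OF AS] subgroup.m_inv_closed[OF AS] by simp
      ultimately have "inv d \<otimes> c = \<one>"
        using fixed_free[OF h] by blast
      then show "c = d"
        using cdG by (metis inv_closed inv_equality inv_inv)
    qed
    then have "f ` A = A"
      using endo_inj_surj[OF finA] f_in by auto
    moreover have "inv b \<in> A"
      using subgroup.m_inv_closed[OF AS bj(1)] .
    ultimately obtain c where c: "c \<in> A" "f c = inv b"
      by (metis imageE)
    have cG: "c \<in> carrier G"
      using AG[OF c(1)] .
    have j: "j = c \<otimes> h \<otimes> inv c"
    proof -
      have "j = f c \<otimes> h"
        using \<open>j = inv b \<otimes> h\<close> c(2) by simp
      then show ?thesis
        unfolding f_def using cG hG by (simp add: m_assoc)
    qed
    let ?J = "(\<lambda>x. inv c \<otimes> x \<otimes> inv (inv c)) ` J"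
    have cJ: "inv c \<otimes> j \<otimes> inv (inv c) = h"
      unfolding j using cG hG by (simp add: m_assoc mult_inv_cancel)
    have "?J \<subseteq> H"
    proof clarify
      fix k assume k: "k \<in> J"
      define k' where "k' = inv c \<otimes> k \<otimes> inv (inv c)"
      have k'G: "k' \<in> carrier G"
        unfolding k'_def using cG JG[OF k] by simp
      have k'h: "k' \<otimes> h = h \<otimes> k'"
      proof -
        interpret c: group_hom G G "\<lambda>x. inv c \<otimes> x \<otimes> inv (inv c)"
          using conjugation_hom[OF inv_closed[OF cG]] by unfold_locales
        show ?thesis
          unfolding k'_def cJ[symmetric] using c.hom_mult[OF JG[OF k] in_G(2)] c.hom_mult[OF in_G(2) JG[OF k]]
            J_comm[OF k bj(2)] by simp
      qed
      obtain d l where dl: "d \<in> A" "l \<in> H" "k' = d \<otimes> l"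
        using decompose[OF k'G] by auto
      have dlG: "d \<in> carrier G" "l \<in> carrier G"
        using AG[OF dl(1)] HG[OF dl(2)] by auto
      have "h \<otimes> d \<otimes> l = d \<otimes> h \<otimes> l"
        using k'h H_comm[OF dl(2) h(1)] dlG hG unfolding dl(3) by (simp add: m_assoc)
      then have "h \<otimes> d = d \<otimes> h"
        using dlG hG by (simp add: r_cancel)
      then have "d = \<one>"
        using fixed_free[OF h dl(1)] by simp
      then show "inv c \<otimes> k \<otimes> inv (inv c) \<in> H"
        using dl dlG by (simp add: k'_def)
    qed
    moreover have "card ?J = card H"
    proof -
      have "inj_on (\<lambda>x. inv c \<otimes> x \<otimes> inv (inv c)) J"
        using inj_on_subset[OF conjugation_inj[OF inv_closed[OF cG]] subgroup.subset[OF J]] .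
      then show ?thesis
        using card by (simp add: card_image)
    qed
    ultimately have "?J = H"
      using card_subset_eq[OF finH] by simp
    then show ?thesis
      using inv_closed[OF cG] by blast
  qed
qed

end

section \<open>Subgroups with conjugate Sylow subgroups\<close>

context group
begin

lemma image_set_mult:
  assumes "h \<in> hom G G" "A \<subseteq> carrier G" "B \<subseteq> carrier G"
  shows "h ` (A <#> B) = h ` A <#> h ` B"
proof -
  have "h (a \<otimes> b) = h a \<otimes> h b" if "a \<in> A" "b \<in> B" for a b
    using hom_mult[OF assms(1)] assms(2,3) that by auto
  then show ?thesis
    unfolding set_mult_def by (auto simp: image_iff) blast+
qed

lemma conjugate_normal_mult:
  assumes "g \<in> carrier G" "N \<lhd> G" "P \<subseteq> carrier G"
  shows "(\<lambda>x. g \<otimes> x \<otimes> inv g) ` (N <#> P) = N <#> (\<lambda>x. g \<otimes> x \<otimes> inv g) ` P"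
  using image_set_mult[OF conjugation_hom[OF assms(1)] subgroup.subset[OF normal_imp_subgroup[OF assms(2)]] assms(3)]
    normal_conjugate[OF assms(1,2)] by simp

text \<open>The index of a Sylow \<open>p\<close>-subgroup of \<open>V\<close> in \<open>G\<close> has the same \<open>p\<close>-part as the
  index of \<open>V\<close> itself, so this \<open>p\<close>-part can be read off from a conjugate.\<close>

lemma sylow_conjugate_index_eq:
  assumes N: "N \<lhd> G" "index (carrier G) N \<noteq> 0"
    and V: "subgroup V G" "N \<subseteq> V" and W: "subgroup W G" "N \<subseteq> W"
    and syl: "\<And>p. Factorial_Ring.prime p \<Longrightarrow> \<exists>P g. subgroup P G \<and> P \<subseteq> V \<and> g \<in> carrier G \<and>
        (\<lambda>x. g \<otimes> x \<otimes> inv g) ` P \<subseteq> W \<and> \<not> p dvd index V (N <#> P) \<and>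
        \<not> p dvd index W (N <#> (\<lambda>x. g \<otimes> x \<otimes> inv g) ` P)"
  shows "index (carrier G) V = index (carrier G) W"
proof (rule multiplicity_eq_nat)
  have NS: "subgroup N G"
    using normal_imp_subgroup[OF N(1)] .
  show pos: "index (carrier G) V > 0" "index (carrier G) W > 0"
    using N(2) index_mult[OF subgroup_self V(1) NS subgroup.subset[OF V(1)] V(2)]
      index_mult[OF subgroup_self W(1) NS subgroup.subset[OF W(1)] W(2)] by (metis mult_0 neq0_conv)+
  fix p :: nat assume p: "Factorial_Ring.prime p"
  obtain P g where P: "subgroup P G" "P \<subseteq> V" "g \<in> carrier G"
    "(\<lambda>x. g \<otimes> x \<otimes> inv g) ` P \<subseteq> W" "\<not> p dvd index V (N <#> P)"
    "\<not> p dvd index W (N <#> (\<lambda>x. g \<otimes> x \<otimes> inv g) ` P)"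
    using syl[OF p] by metis
  let ?P' = "(\<lambda>x. g \<otimes> x \<otimes> inv g) ` P"
  have P': "subgroup ?P' G"
    using subgroup_conjugate[OF P(3,1)] .
  have mult: "multiplicity p (index (carrier G) (N <#> Q)) = multiplicity p (index (carrier G) A)"
    if A: "subgroup A G" "N \<subseteq> A" "index (carrier G) A > 0"
      and Q: "subgroup Q G" "Q \<subseteq> A" "\<not> p dvd index A (N <#> Q)" for A Q
  proof -
    have sub: "N <#> Q \<subseteq> A"
      using subgroup.m_closed[OF A(1)] A(2) Q(2) unfolding set_mult_def by blast
    have "index (carrier G) (N <#> Q) = index (carrier G) A * index A (N <#> Q)"
      using index_mult[OF subgroup_self A(1) subgroup_normal_mult(1)[OF N(1) Q(1)] subgroup.subset[OF A(1)] sub] .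
    moreover have "index A (N <#> Q) \<noteq> 0"
      using Q(3) by (metis dvd_0_right)
    ultimately show ?thesis
      using p A(3) prime_elem_multiplicity_mult_distrib[of p] not_dvd_imp_multiplicity_0[OF Q(3)]
      by (simp add: prime_imp_prime_elem)
  qed
  have "index (carrier G) (N <#> ?P') = index (carrier G) (N <#> P)"
    using index_conjugate[OF P(3) subgroup_self subgroup_normal_mult(1)[OF N(1) P(1)]]
      normal_conjugate[OF P(3) normal_self] conjugate_normal_mult[OF P(3) N(1) subgroup.subset[OF P(1)]]
    by simp
  then show "multiplicity p (index (carrier G) V) = multiplicity p (index (carrier G) W)"
    using mult[OF V pos(1) P(1,2,5)] mult[OF W pos(2) P' P(4,6)] by simp
qed

text \<open>A normal subgroup \<open>M\<close> of \<open>G\<close> inside \<open>V\<close> meets each Sylow subgroup of \<open>V\<close> in a Sylow subgroup of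
  \<open>M\<close>; by normality, \<open>W\<close> contains a conjugate of that one. So no prime divides the
  index of \<open>M \<inter> W\<close> in \<open>M\<close>.\<close>

lemma sylow_conjugate_normal_subset:
  assumes N: "N \<lhd> G" "index (carrier G) N \<noteq> 0"
    and V: "subgroup V G" "N \<subseteq> V" and W: "subgroup W G" "N \<subseteq> W"
    and syl: "\<And>p. Factorial_Ring.prime p \<Longrightarrow> \<exists>P g. subgroup P G \<and> P \<subseteq> V \<and> g \<in> carrier G \<and>
        (\<lambda>x. g \<otimes> x \<otimes> inv g) ` P \<subseteq> W \<and> \<not> p dvd index V (N <#> P)"
    and M: "M \<lhd> G" "M \<subseteq> V"
  shows "M \<subseteq> W"
proof -
  have MS: "subgroup M G"
    using normal_imp_subgroup[OF M(1)] .
  have no_prime: "\<not> p dvd index M (W \<inter> M)" if p: "Factorial_Ring.prime p" for p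
  proof -
    obtain P g where P: "subgroup P G" "P \<subseteq> V" "g \<in> carrier G"
      "(\<lambda>x. g \<otimes> x \<otimes> inv g) ` P \<subseteq> W" "\<not> p dvd index V (N <#> P)"
      using syl[OF p] by metis
    let ?c = "\<lambda>x. g \<otimes> x \<otimes> inv g"
    define S where "S = N <#> P"
    have S: "subgroup S G"
      unfolding S_def using subgroup_normal_mult(1)[OF N(1) P(1)] .
    have cS: "?c ` S = N <#> ?c ` P"
      unfolding S_def using conjugate_normal_mult[OF P(3) N(1) subgroup.subset[OF P(1)]] .
    have S': "subgroup (?c ` S) G"
      using subgroup_conjugate[OF P(3) S] .
    have SW: "?c ` S \<subseteq> W"
      unfolding cS using subgroup.m_closed[OF W(1)] W(2) P(4) unfolding set_mult_def by blast
    have SV: "S \<subseteq> V"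
      unfolding S_def using subgroup.m_closed[OF V(1)] V(2) P(2) unfolding set_mult_def by blast
    have SM: "subgroup (M <#> S) G" "S \<subseteq> M <#> S" "S <#> M = M <#> S"
      using subgroup_normal_mult[OF M(1) S] by auto
    have SMV: "M <#> S \<subseteq> V"
      using subgroup.m_closed[OF V(1)] M(2) SV unfolding set_mult_def by blast
    have "index M (W \<inter> M) dvd index M (?c ` S \<inter> M)"
      using index_mult[OF MS subgroups_Inter_pair[OF W(1) MS] subgroups_Inter_pair[OF S' MS]] SW
      by (metis Int_lower2 Int_mono dvd_triv_left order_refl)
    also have "index M (?c ` S \<inter> M) = index (?c ` S <#> M) (?c ` S)"
      using index_set_mult[OF MS S'] by simp
    also have "?c ` S <#> M = ?c ` (M <#> S)"
      using conjugate_normal_mult[OF P(3) M(1) subgroup.subset[OF S]] subgroup_normal_mult(4)[OF M(1) S'] by simp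
    also have "index (?c ` (M <#> S)) (?c ` S) = index (M <#> S) S"
      using index_conjugate[OF P(3) SM(1) S] .
    also have "\<dots> dvd index V S"
      using index_mult[OF V(1) SM(1) S SMV SM(2)] by simp
    finally show ?thesis
      using P(5) dvd_trans unfolding S_def by blast
  qed
  have "index M (W \<inter> M) = 1"
    using no_prime prime_factor_nat by blast
  then show ?thesis
    using index_eq_1_imp_subset[OF MS subgroups_Inter_pair[OF W(1) MS]] by auto
qed

text \<open>By the two preceding lemmas, \<open>V\<close> and \<open>W\<close> have equal index, and \<open>W\<close> contains the
  normal core of \<open>V\<close>. In the quotient by this core, their images are
  conjugate because \<open>V\<close> has prime index and the quotient is solvable.\<close>

theorem sylow_conjugate_prime_index_conjugate:
  assumes N: "N \<lhd> G" "index (carrier G) N \<noteq> 0"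
    and V: "subgroup V G" "N \<subseteq> V" and W: "subgroup W G" "N \<subseteq> W"
    and syl: "\<And>p. Factorial_Ring.prime p \<Longrightarrow> \<exists>P g. subgroup P G \<and> P \<subseteq> V \<and> g \<in> carrier G \<and>
        (\<lambda>x. g \<otimes> x \<otimes> inv g) ` P \<subseteq> W \<and> \<not> p dvd index V (N <#> P) \<and>
        \<not> p dvd index W (N <#> (\<lambda>x. g \<otimes> x \<otimes> inv g) ` P)"
    and prime: "Factorial_Ring.prime (index (carrier G) V)"
    and solv: "(derived G ^^ n) (carrier G) \<subseteq> V"
  shows "\<exists>g\<in>carrier G. (\<lambda>x. g \<otimes> x \<otimes> inv g) ` W = V"
proof -
  \<comment> \<open>the normal core of \<open>V\<close>\<close>
  define M where "M = {x \<in> carrier G. \<forall>g\<in>carrier G. g \<otimes> x \<otimes> inv g \<in> V}"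
  have M_max: "B \<subseteq> M" if "B \<lhd> G" "B \<subseteq> V" for B
    using that normal.inv_op_closed2[OF that(1)] subgroup.subset[OF normal_imp_subgroup[OF that(1)]]
    unfolding M_def by blast
  have MV: "M \<subseteq> V"
  proof
    fix x assume "x \<in> M"
    then have "\<one> \<otimes> x \<otimes> inv \<one> \<in> V" "x \<in> carrier G"
      unfolding M_def by blast+
    then show "x \<in> V"
      by simp
  qed
  have MS: "subgroup M G"
  proof (rule subgroupI)
    show "M \<subseteq> carrier G"
      unfolding M_def by auto
    show "M \<noteq> {}"
      using M_max[OF N(1) V(2)] subgroup.one_closed[OF normal_imp_subgroup[OF N(1)]] by blast
    show "inv x \<in> M" if x: "x \<in> M" for x
    proof -
      have xG: "x \<in> carrier G"
        using x unfolding M_def by auto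
      have "g \<otimes> inv x \<otimes> inv g \<in> V" if g: "g \<in> carrier G" for g
      proof -
        have "inv (g \<otimes> x \<otimes> inv g) \<in> V"
          using x g subgroup.m_inv_closed[OF V(1)] unfolding M_def by blast
        then show ?thesis
          using xG g by (simp add: inv_mult_group m_assoc)
      qed
      then show ?thesis
        unfolding M_def using xG by simp
    qed
    show "x \<otimes> y \<in> M" if x: "x \<in> M" and y: "y \<in> M" for x y
    proof -
      have xyG: "x \<in> carrier G" "y \<in> carrier G"
        using x y unfolding M_def by auto
      have "g \<otimes> (x \<otimes> y) \<otimes> inv g \<in> V" if g: "g \<in> carrier G" for g
      proof -
        have "(g \<otimes> x \<otimes> inv g) \<otimes> (g \<otimes> y \<otimes> inv g) \<in> V"
          using x y g subgroup.m_closed[OF V(1)] unfolding M_def by blast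
        then show ?thesis
          using xyG g by (simp add: m_assoc mult_inv_cancel)
      qed
      then show ?thesis
        unfolding M_def using xyG by simp
    qed
  qed
  have M: "M \<lhd> G"
    unfolding normal_inv_iff
  proof (intro conjI ballI MS)
    fix a x assume a: "a \<in> carrier G" and x: "x \<in> M"
    have xG: "x \<in> carrier G"
      using x unfolding M_def by auto
    have "g \<otimes> (a \<otimes> x \<otimes> inv a) \<otimes> inv g \<in> V" if g: "g \<in> carrier G" for g
    proof -
      have "(g \<otimes> a) \<otimes> x \<otimes> inv (g \<otimes> a) \<in> V"
        using x a g unfolding M_def by blast
      then show ?thesis
        using a xG g by (simp add: inv_mult_group m_assoc)
    qed
    then show "a \<otimes> x \<otimes> inv a \<in> M"
      unfolding M_def using a xG by simp
  qed
  have MW: "M \<subseteq> W"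
    by (rule sylow_conjugate_normal_subset[OF N V W _ M MV]) (use syl in meson)
  have D: "(derived G ^^ n) (carrier G) \<subseteq> M"
  proof (rule M_max[OF _ solv])
    show "(derived G ^^ n) (carrier G) \<lhd> G"
      by (induction n) (simp_all add: normal_self derived_is_normal)
  qed
  define \<pi> where "\<pi> = (\<lambda>x. M #> x)"
  interpret M: normal M G
    by (rule M)
  interpret Q: group "G Mod M"
    by (rule M.factorgroup_is_group)
  interpret \<pi>: group_hom G "G Mod M" \<pi>
    unfolding \<pi>_def using M.r_coset_hom_Mod by unfold_locales
  have carrier: "carrier (G Mod M) = \<pi> ` carrier G"
    unfolding \<pi>_def by (rule carrier_FactGroup)
  have \<pi>_eq: "\<pi> x = \<pi> y \<longleftrightarrow> x \<otimes> inv y \<in> M" if "x \<in> carrier G" "y \<in> carrier G" for x y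
    unfolding \<pi>_def using r_coset_eq_iff[OF MS that] .
  have \<pi>_mem: "\<pi> x \<in> \<pi> ` B \<longleftrightarrow> x \<in> B" if B: "subgroup B G" "M \<subseteq> B" and x: "x \<in> carrier G" for B x
  proof
    assume "\<pi> x \<in> \<pi> ` B"
    then obtain b where b: "b \<in> B" "\<pi> x = \<pi> b"
      by auto
    have bG: "b \<in> carrier G"
      using subgroup.mem_carrier[OF B(1) b(1)] .
    have "x \<otimes> inv b \<in> B"
      using \<pi>_eq[OF x bG] b(2) B(2) by auto
    then have "(x \<otimes> inv b) \<otimes> b \<in> B"
      using subgroup.m_closed[OF B(1) _ b(1)] by simp
    then show "x \<in> B"
      using x bG by (simp add: m_assoc)
  qed simp
  have subgroup_img: "subgroup (\<pi> ` B) (G Mod M)" if "subgroup B G" for B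
    using \<pi>.subgroup_img_is_subgroup[OF that] .
  have index_img: "Q.index (carrier (G Mod M)) (\<pi> ` B) = index (carrier G) B"
    if B: "subgroup B G" "M \<subseteq> B" for B
    unfolding Q.index_def index_def
  proof (rule card_image_transfer[symmetric])
    show "\<pi> ` carrier G = carrier (G Mod M)"
      using carrier by simp
    fix x y assume xy: "x \<in> carrier G" "y \<in> carrier G"
    have "\<pi> x \<otimes>\<^bsub>G Mod M\<^esub> inv\<^bsub>G Mod M\<^esub> \<pi> y = \<pi> (x \<otimes> inv y)"
      using xy by simp
    then show "B #> x = B #> y \<longleftrightarrow> \<pi> ` B #>\<^bsub>G Mod M\<^esub> \<pi> x = \<pi> ` B #>\<^bsub>G Mod M\<^esub> \<pi> y"
      using Q.r_coset_eq_iff[OF subgroup_img[OF B(1)]] r_coset_eq_iff[OF B(1) xy]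
        \<pi>_mem[OF B, of "x \<otimes> inv y"] xy \<pi>.hom_closed by (metis inv_closed m_closed)
  qed
  have NM: "N \<subseteq> M"
    using M_max[OF N(1) V(2)] .
  have "index (carrier G) M \<noteq> 0"
    using N(2) index_mult[OF subgroup_self MS normal_imp_subgroup[OF N(1)] subgroup.subset[OF MS] NM] by auto
  then have fin: "finite (carrier (G Mod M))"
    unfolding carrier \<pi>_def index_def by (metis card.infinite)
  have VW: "index (carrier G) V = index (carrier G) W"
    using sylow_conjugate_index_eq[OF N V W syl] .
  have card_img: "index (carrier G) B * card (\<pi> ` B) = card (carrier (G Mod M))"
    if B: "subgroup B G" "M \<subseteq> B" for B
    using Q.lagrange[OF subgroup_img[OF B(1)]] index_img[OF B]
    by (simp add: Q.index_rcosets Coset.order_def)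
  have "\<exists>q\<in>carrier (G Mod M). (\<lambda>x. q \<otimes>\<^bsub>G Mod M\<^esub> x \<otimes>\<^bsub>G Mod M\<^esub> inv\<^bsub>G Mod M\<^esub> q) ` (\<pi> ` W) = \<pi> ` V"
  proof (rule Q.solvable_prime_index_conjugate[OF fin _ subgroup_img[OF V(1)] subgroup_img[OF W(1)]])
    have "(derived (G Mod M) ^^ n) (carrier (G Mod M)) = \<pi> ` ((derived G ^^ n) (carrier G))"
      unfolding carrier using \<pi>.exp_of_derived_img[of "carrier G" n] by simp
    also have "\<dots> \<subseteq> \<pi> ` M"
      using D by auto
    also have "\<dots> \<subseteq> {M}"
    proof (rule image_subsetI)
      fix x assume "x \<in> M"
      then show "\<pi> x \<in> {M}"
        unfolding \<pi>_def using coset_join2[OF subgroup.mem_carrier[OF MS] MS] by simp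
    qed
    finally have "(derived (G Mod M) ^^ n) (carrier (G Mod M)) = {\<one>\<^bsub>G Mod M\<^esub>}"
      using subgroup.one_closed[OF Q.exp_of_derived_is_subgroup[OF Q.subgroup_self, of n]] by auto
    then show "solvable (G Mod M)"
      unfolding Q.solvable_iff_trivial_derived_seq by blast
    show "Factorial_Ring.prime (Q.index (carrier (G Mod M)) (\<pi> ` V))"
      using prime index_img[OF V(1) MV] by simp
    have "index (carrier G) V \<noteq> 0"
      using prime by auto
    then show "card (\<pi> ` W) = card (\<pi> ` V)"
      using card_img[OF V(1) MV] card_img[OF W(1) MW] VW by (metis mult_left_cancel)
    fix B assume B: "B \<lhd> G Mod M" "B \<subseteq> \<pi> ` V"
    define C where "C = {x \<in> carrier G. \<pi> x \<in> B}"
    have BS: "subgroup B (G Mod M)"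
      using normal_imp_subgroup[OF B(1)] .
    have "C \<lhd> G"
      unfolding normal_inv_iff
    proof (intro conjI ballI subgroupI)
      show "C \<subseteq> carrier G"
        unfolding C_def by auto
      have "\<one> \<in> C"
        unfolding C_def using subgroup.one_closed[OF BS] \<pi>.hom_one by simp
      then show "C \<noteq> {}"
        by auto
    next
      fix x assume "x \<in> C"
      then show "inv x \<in> C"
        unfolding C_def using subgroup.m_inv_closed[OF BS] \<pi>.hom_inv by auto
    next
      fix x y assume "x \<in> C" "y \<in> C"
      then show "x \<otimes> y \<in> C"
        unfolding C_def using subgroup.m_closed[OF BS] \<pi>.hom_mult by auto
    next
      fix g x assume "g \<in> carrier G" "x \<in> C"
      then show "g \<otimes> x \<otimes> inv g \<in> C"
        unfolding C_def using normal.inv_op_closed2[OF B(1), of "\<pi> g" "\<pi> x"] \<pi>.hom_mult \<pi>.hom_inv \<pi>.hom_closed by auto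
    qed
    moreover have "C \<subseteq> V"
      using B(2) \<pi>_mem[OF V(1) MV] unfolding C_def by auto
    ultimately have "C \<subseteq> M"
      using M_max by simp
    have "b = \<one>\<^bsub>G Mod M\<^esub>" if b: "b \<in> B" for b
    proof -
      obtain x where x: "x \<in> carrier G" "b = \<pi> x"
        using subgroup.mem_carrier[OF BS b] carrier by auto
      then have "x \<in> M"
        using b \<open>C \<subseteq> M\<close> unfolding C_def by auto
      then have "\<pi> x = \<pi> \<one>"
        using \<pi>_eq[OF x(1) one_closed] x(1) by simp
      then show ?thesis
        using x(2) \<pi>.hom_one by simp
    qed
    then show "B = {\<one>\<^bsub>G Mod M\<^esub>}"
      using subgroup.one_closed[OF BS] by blast
  qed
  then obtain g where g: "g \<in> carrier G"
    and conj: "(\<lambda>x. \<pi> g \<otimes>\<^bsub>G Mod M\<^esub> x \<otimes>\<^bsub>G Mod M\<^esub> inv\<^bsub>G Mod M\<^esub> \<pi> g) ` (\<pi> ` W) = \<pi> ` V"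
    unfolding carrier by auto
  let ?c = "\<lambda>x. g \<otimes> x \<otimes> inv g"
  have \<pi>c: "\<pi> g \<otimes>\<^bsub>G Mod M\<^esub> \<pi> x \<otimes>\<^bsub>G Mod M\<^esub> inv\<^bsub>G Mod M\<^esub> \<pi> g = \<pi> (?c x)" if "x \<in> carrier G" for x
    using g that by simp
  have "(\<lambda>x. \<pi> g \<otimes>\<^bsub>G Mod M\<^esub> x \<otimes>\<^bsub>G Mod M\<^esub> inv\<^bsub>G Mod M\<^esub> \<pi> g) ` (\<pi> ` W) = \<pi> ` (?c ` W)"
    unfolding image_image by (rule image_cong[OF refl \<pi>c[OF subgroup.mem_carrier[OF W(1)]]])
  then have eq: "\<pi> ` (?c ` W) = \<pi> ` V"
    using conj by simp
  have cW: "subgroup (?c ` W) G" "M \<subseteq> ?c ` W"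
    using subgroup_conjugate[OF g W(1)] normal_conjugate[OF g M] MW by (auto simp: image_mono)
  have "x \<in> ?c ` W \<longleftrightarrow> x \<in> V" if "x \<in> carrier G" for x
    using \<pi>_mem[OF cW that] \<pi>_mem[OF V(1) MV that] eq by simp
  then have "?c ` W = V"
    using subgroup.subset[OF cW(1)] subgroup.subset[OF V(1)] by blast
  then show ?thesis
    using g by blast
qed

end

section \<open>Extending embeddings of subfields\<close>

text \<open>A ring homomorphism between subrings is represented by its graph, a subring of the product
  ring. A polynomial over the graph is a pair of polynomials with related coefficients.\<close>

definition pair_subring :: "('a::field \<times> 'a) set \<Rightarrow> bool"
  where "pair_subring R \<longleftrightarrow> (0, 0) \<in> R \<and> (1, 1) \<in> R \<and>
    (\<forall>a b c d. (a, b) \<in> R \<longrightarrow> (c, d) \<in> R \<longrightarrow>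
      (a + c, b + d) \<in> R \<and> (a - c, b - d) \<in> R \<and> (a * c, b * d) \<in> R)"

definition pair_poly :: "('a::field \<times> 'a) set \<Rightarrow> 'a poly \<Rightarrow> 'a poly \<Rightarrow> bool"
  where "pair_poly R p q \<longleftrightarrow> (\<forall>i. (coeff p i, coeff q i) \<in> R)"

lemma pair_subringD:
  assumes "pair_subring R"
  shows "(0, 0) \<in> R" "(1, 1) \<in> R"
    and "(a, b) \<in> R \<Longrightarrow> (c, d) \<in> R \<Longrightarrow> (a + c, b + d) \<in> R"
    and "(a, b) \<in> R \<Longrightarrow> (c, d) \<in> R \<Longrightarrow> (a - c, b - d) \<in> R"
    and "(a, b) \<in> R \<Longrightarrow> (c, d) \<in> R \<Longrightarrow> (a * c, b * d) \<in> R"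
  using assms unfolding pair_subring_def by blast+

lemma pair_subring_sum:
  assumes "pair_subring R" "\<And>i. i \<in> I \<Longrightarrow> (f i, g i) \<in> R"
  shows "(sum f I, sum g I) \<in> R"
  using assms(2)
  by (induction I rule: infinite_finite_induct) (simp_all add: pair_subringD[OF assms(1)])

lemma pair_subring_power:
  "pair_subring R \<Longrightarrow> (a, b) \<in> R \<Longrightarrow> (a ^ n, b ^ n) \<in> R"
  by (induction n) (simp_all add: pair_subringD)

lemma pair_poly_diff:
  "pair_subring R \<Longrightarrow> pair_poly R p q \<Longrightarrow> pair_poly R p' q' \<Longrightarrow> pair_poly R (p - p') (q - q')"
  unfolding pair_poly_def by (simp add: pair_subringD)

lemma pair_poly_add:
  "pair_subring R \<Longrightarrow> pair_poly R p q \<Longrightarrow> pair_poly R p' q' \<Longrightarrow> pair_poly R (p + p') (q + q')"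
  unfolding pair_poly_def by (simp add: pair_subringD)

lemma pair_poly_mult:
  "pair_subring R \<Longrightarrow> pair_poly R p q \<Longrightarrow> pair_poly R p' q' \<Longrightarrow> pair_poly R (p * p') (q * q')"
  unfolding pair_poly_def coeff_mult by (auto intro!: pair_subring_sum pair_subringD)

lemma pair_poly_pCons:
  "pair_subring R \<Longrightarrow> (a, b) \<in> R \<Longrightarrow> pair_poly R p q \<Longrightarrow> pair_poly R (pCons a p) (pCons b q)"
  unfolding pair_poly_def by (simp add: coeff_pCons split: nat.split)

lemma pair_poly_0: "pair_subring R \<Longrightarrow> pair_poly R 0 0"
  unfolding pair_poly_def by (simp add: pair_subringD)

lemma pair_poly_const: "pair_subring R \<Longrightarrow> (a, b) \<in> R \<Longrightarrow> pair_poly R [:a:] [:b:]"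
  by (simp add: pair_poly_pCons pair_poly_0)

lemma pair_poly_1: "pair_subring R \<Longrightarrow> pair_poly R 1 1"
  using pair_poly_const[of R 1 1] by (simp add: pair_subringD one_pCons)

lemma pair_poly_monom: "pair_subring R \<Longrightarrow> (a, b) \<in> R \<Longrightarrow> pair_poly R (monom a n) (monom b n)"
  unfolding pair_poly_def by (simp add: pair_subringD)

lemma pair_poly_eval:
  fixes R :: "('a::field \<times> 'a) set"
  assumes R: "pair_subring R" and "pair_poly R p q" and xy: "(x, y) \<in> R"
  shows "(poly p x, poly q y) \<in> R"
proof -
  have eval: "poly r z = (\<Sum>i\<le>n. coeff r i * z ^ i)" if "degree r \<le> n" for r :: "'a poly" and z n
    unfolding poly_altdef using that by (intro sum.mono_neutral_left) (auto simp: coeff_eq_0)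
  show ?thesis
    using assms(2) unfolding pair_poly_def
      eval[of p "max (degree p) (degree q)", OF max.cobounded1]
      eval[of q "max (degree p) (degree q)", OF max.cobounded2]
    by (auto intro!: pair_subring_sum[OF R] pair_subringD(5)[OF R] pair_subring_power[OF R xy])
qed

lemma pair_poly_prod_roots:
  assumes "pair_subring R" and "\<And>a. a \<in> A \<Longrightarrow> (a, f a) \<in> R"
  shows "pair_poly R (\<Prod>a\<in>A. [:- a, 1:]) (\<Prod>a\<in>A. [:- f a, 1:])"
  using assms(2)
proof (induction A rule: infinite_finite_induct)
  case (insert a A)
  have "(0 - a, 0 - f a) \<in> R"
    using insert.prems by (intro pair_subringD(4)[OF assms(1)] pair_subringD(1)[OF assms(1)]) simp
  then have "pair_poly R [:- a, 1:] [:- f a, 1:]"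
    using assms(1) by (intro pair_poly_pCons pair_poly_const pair_subringD(2)) simp_all
  then show ?case
    using pair_poly_mult[OF assms(1), of "[:- a, 1:]" "[:- f a, 1:]"] insert
    by (simp only: prod.insert[OF insert.hyps]) blast
qed (simp_all add: pair_poly_1 assms(1))

lemma algebraic_rat_poly:
  fixes x :: "'a::field_char_0"
  assumes "algebraic x" "x \<noteq> 0"
  obtains c where "\<And>i. coeff c i \<in> \<rat>" "coeff c 0 \<noteq> 0" "poly c x = 0"
proof -
  have "\<exists>c. (\<forall>i. coeff c i \<in> \<rat>) \<and> coeff c 0 \<noteq> 0 \<and> poly c x = 0"
    if "\<And>i. coeff p i \<in> \<rat>" "p \<noteq> 0" "poly p x = 0" for p
    using that
  proof (induction p)
    case (pCons a p)
    show ?case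
    proof (cases "a = 0")
      case False
      then show ?thesis
        using pCons.prems by (intro exI[of _ "pCons a p"]) simp
    next
      case True
      have "coeff p i \<in> \<rat>" for i
        using pCons.prems(1)[of "Suc i"] by simp
      then show ?thesis
        using pCons True assms(2) by auto
    qed
  qed simp
  then show thesis
    using that assms(1) Ints_subset_Rats unfolding algebraic_def by (metis subsetD)
qed

text \<open>By subtraction, single-valuedness of a subring of the product ring reduces to the fibre over \<open>0\<close>.\<close>

definition partial_embedding :: "('a::field_char_0 \<times> 'a) set \<Rightarrow> bool"
  where "partial_embedding R \<longleftrightarrow> pair_subring R \<and> Id_on \<rat> \<subseteq> R \<and> (\<forall>b. (0, b) \<in> R \<longrightarrow> b = 0)"

text \<open>An algebraic number other than \<open>0\<close> is a root of a rational polynomial with nonzero constant term, and a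
  partial embedding maps it to a root of the same polynomial.\<close>

lemma partial_embedding_nonzero:
  assumes "partial_embedding R" and "algebraic a" and "(a, b) \<in> R" and "a \<noteq> 0"
  shows "b \<noteq> 0"
proof -
  obtain c where c: "\<And>i. coeff c i \<in> \<rat>" "coeff c 0 \<noteq> 0" "poly c a = 0"
    using algebraic_rat_poly[OF assms(2,4)] by blast
  have "pair_poly R c c"
    using assms(1) c(1) unfolding pair_poly_def partial_embedding_def by (auto simp: subset_iff)
  then have "(0, poly c b) \<in> R"
    using pair_poly_eval[of R c c a b] assms(1,3) c(3) unfolding partial_embedding_def by simp
  then have "poly c b = 0"
    using assms(1) unfolding partial_embedding_def by blast
  then show ?thesis
    using c(2) by (auto simp: poly_0_coeff_0)
qed

text \<open>The element \<open>x\<close> can be mapped to any root \<open>y\<close> of the image \<open>q\<close> of a polynomial \<open>p\<close> of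
  minimal degree with root \<open>x\<close>: by pseudo-division, a polynomial vanishing at \<open>x\<close> is,
  up to a nonzero factor from the domain, a multiple of \<open>p\<close>.\<close>

lemma partial_embedding_extend_root:
  fixes R :: "('a::field_char_0 \<times> 'a) set"
  assumes alg: "\<And>x::'a. algebraic x" and R: "partial_embedding R"
    and pq: "pair_poly R p q" "p \<noteq> 0" "poly p x = 0" "poly q y = 0"
    and min: "\<And>f g. pair_poly R f g \<Longrightarrow> f \<noteq> 0 \<Longrightarrow> poly f x = 0 \<Longrightarrow> degree p \<le> degree f"
  obtains R' where "partial_embedding R'" "R \<subseteq> R'" "(x, y) \<in> R'"
proof -
  have ring: "pair_subring R"
    using R unfolding partial_embedding_def by simp
  define R' where "R' = {(poly f x, poly g y) | f g. pair_poly R f g}"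
  have R'I: "pair_poly R f g \<Longrightarrow> (poly f x, poly g y) \<in> R'" for f g
    unfolding R'_def by auto
  have sub: "R \<subseteq> R'"
  proof clarify
    fix a b assume "(a, b) \<in> R"
    then show "(a, b) \<in> R'"
      using R'I[OF pair_poly_const[OF ring]] by fastforce
  qed
  have "poly g y = 0" if "pair_poly R f g" "poly f x = 0" for f g
    using that
  proof (induction "degree f" arbitrary: f g rule: less_induct)
    case less
    show ?case
    proof (cases "f = 0")
      case True
      then have "coeff g i = 0" for i
        using less.prems(1) R unfolding pair_poly_def partial_embedding_def by auto
      then have "g = 0"
        by (simp add: poly_eq_iff)
      then show ?thesis
        by simp
    next
      case False
      define c where "c = coeff f (degree f)"
      define d where "d = coeff g (degree f)"
      define l where "l = coeff p (degree p)"
      define m where "m = coeff q (degree p)"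
      have cd: "(c, d) \<in> R" and lm: "(l, m) \<in> R"
        using less.prems(1) pq(1) unfolding c_def d_def l_def m_def pair_poly_def by auto
      have "l \<noteq> 0"
        using pq(2) unfolding l_def by simp
      then have "m \<noteq> 0"
        using partial_embedding_nonzero[OF R alg lm] by simp
      define k where "k = degree f - degree p"
      have k: "degree f = k + degree p"
        using min[OF less.prems(1) False less.prems(2)] unfolding k_def by simp
      define f' where "f' = [:l:] * f - monom c k * p"
      define g' where "g' = [:m:] * g - monom d k * q"
      have f'g': "pair_poly R f' g'"
        unfolding f'_def g'_def
        using less.prems(1) pq(1) cd lm
        by (intro pair_poly_diff[OF ring] pair_poly_mult[OF ring] pair_poly_const[OF ring] pair_poly_monom[OF ring])
      have f'x: "poly f' x = 0"
        unfolding f'_def using less.prems(2) pq(3) by simp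
      have "poly g' y = 0"
      proof (cases "degree f = 0")
        case True
        \<comment> \<open>A nonzero constant has no root.\<close>
        then show ?thesis
          using less.prems(2) False by (metis degree_eq_zeroE poly_const_conv pCons_0_0)
      next
        case f0: False
        have le: "degree f' \<le> degree f"
          unfolding f'_def k
          by (intro degree_diff_le) (use degree_mult_le[of "monom c k" p] degree_monom_le[of c k] k in auto)
        have "coeff f' (degree f) = 0"
          unfolding f'_def k by (simp add: coeff_monom_mult c_def[unfolded k] l_def)
        then have "degree f' < degree f"
          using le f0 by (metis leading_coeff_0_iff degree_0 le_neq_implies_less not_gr_zero)
        then show ?thesis
          using less.hyps f'g' f'x by simp
      qed
      then show ?thesis
        unfolding g'_def using pq(4) \<open>m \<noteq> 0\<close> by simp
    qed
  qed
  then have functional: "b = 0" if "(0, b) \<in> R'" for b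
    using that unfolding R'_def by auto
  have "pair_subring R'"
    unfolding pair_subring_def
  proof (intro conjI allI impI)
    show "(0, 0) \<in> R'" "(1, 1) \<in> R'"
      using sub pair_subringD(1,2)[OF ring] by auto
    fix a b c d assume "(a, b) \<in> R'" "(c, d) \<in> R'"
    then obtain f g f' g' where fg: "pair_poly R f g" "pair_poly R f' g'"
      and abcd: "a = poly f x" "b = poly g y" "c = poly f' x" "d = poly g' y"
      unfolding R'_def by auto
    show "(a + c, b + d) \<in> R'" "(a - c, b - d) \<in> R'" "(a * c, b * d) \<in> R'"
      using R'I[OF pair_poly_add[OF ring fg]] R'I[OF pair_poly_diff[OF ring fg]]
        R'I[OF pair_poly_mult[OF ring fg]] abcd by simp_all
  qed
  then have "partial_embedding R'"
    using functional sub R unfolding partial_embedding_def by blast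
  moreover have "(x, y) \<in> R'"
    using R'I[OF pair_poly_pCons[OF ring pair_subringD(1)[OF ring] pair_poly_1[OF ring]]] by simp
  ultimately show thesis
    using that sub by blast
qed

lemma exists_minimal_polynomial:
  fixes R :: "('a::field_char_0 \<times> 'a) set"
  assumes R: "partial_embedding R" and "algebraic x"
  obtains p q where "pair_poly R p q" "p \<noteq> 0" "poly p x = 0"
    "\<And>f g. pair_poly R f g \<Longrightarrow> f \<noteq> 0 \<Longrightarrow> poly f x = 0 \<Longrightarrow> degree p \<le> degree f"
proof -
  define P where "P = (\<lambda>p. p \<noteq> 0 \<and> poly p x = 0 \<and> (\<exists>q. pair_poly R p q))"
  obtain c where c: "\<And>i. coeff c i \<in> \<int>" "c \<noteq> 0" "poly c x = 0"
    using algebraicE[OF assms(2)] by blast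
  have "(coeff c i, coeff c i) \<in> R" for i
    using R c(1)[of i] Ints_subset_Rats unfolding partial_embedding_def by (auto simp: subset_iff)
  then have "P c"
    using c unfolding P_def pair_poly_def by blast
  then obtain p where "P p" and min: "\<And>f. P f \<Longrightarrow> degree p \<le> degree f"
    using ex_has_least_nat[of P c degree] by blast
  then show thesis
    using that[of p] unfolding P_def by blast
qed

lemma partial_embedding_extend:
  fixes R :: "('a::{alg_closed_field, field_char_0} \<times> 'a) set"
  assumes alg: "\<And>x::'a. algebraic x" and R: "partial_embedding R"
  obtains R' y where "partial_embedding R'" "R \<subseteq> R'" "(x, y) \<in> R'"
proof -
  obtain p q where pq: "pair_poly R p q" "p \<noteq> 0" "poly p x = 0"
    and min: "\<And>f g. pair_poly R f g \<Longrightarrow> f \<noteq> 0 \<Longrightarrow> poly f x = 0 \<Longrightarrow> degree p \<le> degree f"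
    using exists_minimal_polynomial[OF R alg[of x]] by blast
  have "(coeff p (degree p), coeff q (degree p)) \<in> R"
    using pq(1) unfolding pair_poly_def by simp
  then have "coeff q (degree p) \<noteq> 0"
    using partial_embedding_nonzero[OF R alg] pq(2) by simp
  then have "degree q \<ge> degree p"
    by (rule le_degree)
  moreover have "degree p > 0"
    using pq(2,3) by (metis degree_eq_zeroE poly_const_conv pCons_0_0 gr_zeroI)
  ultimately obtain y where y: "poly q y = 0"
    using alg_closed_imp_poly_has_root[of q] by auto
  show thesis
    by (rule partial_embedding_extend_root[OF alg R pq y]) (use min that in blast)+
qed

section \<open>Automorphisms of an algebraic closure of the rationals\<close>

definition field_automorphism :: "('a::field \<Rightarrow> 'a) \<Rightarrow> bool"
  where "field_automorphism \<sigma> \<longleftrightarrow>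
    bij \<sigma> \<and> \<sigma> 1 = 1 \<and> (\<forall>x y. \<sigma> (x + y) = \<sigma> x + \<sigma> y) \<and> (\<forall>x y. \<sigma> (x * y) = \<sigma> x * \<sigma> y)"

lemma field_automorphismD:
  assumes "field_automorphism \<sigma>"
  shows "bij \<sigma>" "\<sigma> 1 = 1" "\<sigma> (x + y) = \<sigma> x + \<sigma> y" "\<sigma> (x * y) = \<sigma> x * \<sigma> y"
    "\<sigma> 0 = 0" "\<sigma> (- x) = - \<sigma> x" "\<sigma> (x - y) = \<sigma> x - \<sigma> y"
proof -
  show "bij \<sigma>" "\<sigma> 1 = 1" "\<sigma> (x * y) = \<sigma> x * \<sigma> y" and add: "\<sigma> (x + y) = \<sigma> x + \<sigma> y" for x y
    using assms unfolding field_automorphism_def by auto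
  show zero: "\<sigma> 0 = 0"
    using add[of 0 0] by (metis add.right_neutral add_left_cancel)
  show minus: "\<sigma> (- x) = - \<sigma> x" for x
    using add[of x "- x"] zero by (simp add: add_eq_0_iff)
  show "\<sigma> (x - y) = \<sigma> x - \<sigma> y"
    using add[of x "- y"] minus[of y] by simp
qed

lemma pair_subring_graph:
  assumes "field_automorphism \<sigma>"
  shows "pair_subring {(x, \<sigma> x) | x. True}"
  unfolding pair_subring_def using field_automorphismD[OF assms] by auto

lemma ring_hom_Ints:
  fixes \<sigma> :: "'a::field_char_0 \<Rightarrow> 'a"
  assumes one: "\<sigma> 1 = 1" and add: "\<And>x y. \<sigma> (x + y) = \<sigma> x + \<sigma> y" and x: "x \<in> \<int>"
  shows "\<sigma> x = x"
proof -
  have zero: "\<sigma> 0 = 0"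
    using add[of 0 0] by (metis add.right_neutral add_left_cancel)
  have minus: "\<sigma> (- x) = - \<sigma> x" for x
    using add[of x "- x"] zero by (simp add: add_eq_0_iff)
  have nat: "\<sigma> (of_nat n) = of_nat n" for n
    by (induction n) (simp_all add: zero one add)
  obtain k where k: "x = of_int k"
    using x by (auto elim: Ints_cases)
  show ?thesis
    unfolding k by (cases k rule: int_cases2) (simp_all add: nat minus)
qed

lemma ring_hom_Rats:
  fixes \<sigma> :: "'a::field_char_0 \<Rightarrow> 'a"
  assumes one: "\<sigma> 1 = 1" and add: "\<And>x y. \<sigma> (x + y) = \<sigma> x + \<sigma> y"
    and mult: "\<And>x y. \<sigma> (x * y) = \<sigma> x * \<sigma> y" and x: "x \<in> \<rat>"
  shows "\<sigma> x = x"
proof -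
  obtain a b :: int where ab: "b > 0" "x = of_int a / of_int b"
    using x by (auto elim: Rats_cases')
  have "\<sigma> x * \<sigma> (of_int b) = \<sigma> (of_int a)"
    unfolding mult[symmetric] using ab by simp
  then have "\<sigma> x * of_int b = of_int a"
    using ring_hom_Ints[of \<sigma>, OF one add] by simp
  moreover have "of_int b \<noteq> (0::'a)"
    using ab(1) by simp
  ultimately show ?thesis
    using ab(2) by (metis nonzero_eq_divide_eq)
qed

lemma field_automorphism_Rats:
  fixes \<sigma> :: "'a::field_char_0 \<Rightarrow> 'a"
  assumes "field_automorphism \<sigma>" "x \<in> \<rat>"
  shows "\<sigma> x = x"
  using ring_hom_Rats[OF field_automorphismD(2-4)[OF assms(1)] assms(2)] .

lemma algebraic_rational_polynomial:
  assumes "algebraic x"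
  obtains c where "\<And>i. coeff c i \<in> \<rat>" "c \<noteq> 0" "poly c x = 0"
proof -
  obtain c where c: "\<And>i. coeff c i \<in> \<int>" "c \<noteq> 0" "poly c x = 0"
    using algebraicE[OF assms] by blast
  then show thesis
    using that[of c] Ints_subset_Rats by auto
qed

text \<open>A maximal partial embedding is defined everywhere. It is onto because it permutes the finite set of
  roots of every rational polynomial.\<close>

theorem partial_embedding_extends_to_automorphism:
  fixes R :: "('a::{alg_closed_field, field_char_0} \<times> 'a) set"
  assumes alg: "\<And>x::'a. algebraic x" and R: "partial_embedding R"
  obtains \<sigma> where "field_automorphism \<sigma>" "\<And>a b. (a, b) \<in> R \<Longrightarrow> \<sigma> a = b"
proof -
  define A where "A = {S. partial_embedding S \<and> R \<subseteq> S}"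
  have "\<exists>M\<in>A. \<forall>S\<in>A. M \<subseteq> S \<longrightarrow> S = M"
  proof (rule subset_Zorn_nonempty)
    show "A \<noteq> {}"
      using R unfolding A_def by auto
    fix C assume C: "C \<noteq> {}" "subset.chain A C"
    have CA: "S \<in> C \<Longrightarrow> partial_embedding S \<and> R \<subseteq> S" for S
      using C(2) unfolding A_def subset_chain_def by auto
    have common: "\<exists>S\<in>C. p \<in> S \<and> q \<in> S" if "p \<in> \<Union>C" "q \<in> \<Union>C" for p q
      using that C(2) unfolding subset_chain_def by blast
    have "pair_subring (\<Union>C)"
      unfolding pair_subring_def
    proof (intro conjI allI impI)
      show "(0, 0) \<in> \<Union>C" "(1, 1) \<in> \<Union>C"
        using C(1) CA unfolding partial_embedding_def pair_subring_def by blast+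
      fix a b c d assume "(a, b) \<in> \<Union>C" "(c, d) \<in> \<Union>C"
      then obtain S where S: "S \<in> C" "(a, b) \<in> S" "(c, d) \<in> S"
        using common by blast
      then have "pair_subring S"
        using CA unfolding partial_embedding_def by blast
      then show "(a + c, b + d) \<in> \<Union>C" "(a - c, b - d) \<in> \<Union>C" "(a * c, b * d) \<in> \<Union>C"
        using pair_subringD(3-5)[of S a b c d] S by blast+
    qed
    then have "partial_embedding (\<Union>C)"
      using C(1) CA unfolding partial_embedding_def by blast
    then show "\<Union>C \<in> A"
      using C(1) CA unfolding A_def by blast
  qed
  then obtain M where "M \<in> A" and M_max: "\<forall>S\<in>A. M \<subseteq> S \<longrightarrow> S = M"
    by (elim bexE)
  then have M: "partial_embedding M" "R \<subseteq> M"
    unfolding A_def by auto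
  have max: "S = M" if "partial_embedding S" "R \<subseteq> S" "M \<subseteq> S" for S
    using M_max that unfolding A_def by simp
  have ring: "pair_subring M"
    using M(1) unfolding partial_embedding_def by simp
  have total: "\<exists>y. (x, y) \<in> M" for x
  proof -
    obtain S y where "partial_embedding S" "M \<subseteq> S" "(x, y) \<in> S"
      using partial_embedding_extend[OF alg M(1)] by blast
    then show ?thesis
      using max M(2) by blast
  qed
  define \<sigma> where "\<sigma> = (\<lambda>x. SOME y. (x, y) \<in> M)"
  have \<sigma>: "(x, \<sigma> x) \<in> M" for x
    unfolding \<sigma>_def by (rule someI_ex[OF total])
  have unique: "b = \<sigma> a" if "(a, b) \<in> M" for a b
  proof -
    have "(0, b - \<sigma> a) \<in> M"
      using pair_subringD(4)[OF ring that \<sigma>[of a]] by simp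
    then have "b - \<sigma> a = 0"
      using M(1) unfolding partial_embedding_def by blast
    then show ?thesis
      by simp
  qed
  have one: "\<sigma> 1 = 1"
    using unique[OF pair_subringD(2)[OF ring]] by simp
  have add: "\<sigma> (x + y) = \<sigma> x + \<sigma> y" and mult: "\<sigma> (x * y) = \<sigma> x * \<sigma> y"
    and diff: "\<sigma> (x - y) = \<sigma> x - \<sigma> y" for x y
    using unique[OF pair_subringD(3)[OF ring \<sigma> \<sigma>]] unique[OF pair_subringD(4)[OF ring \<sigma> \<sigma>]]
      unique[OF pair_subringD(5)[OF ring \<sigma> \<sigma>]] by simp_all
  have "inj \<sigma>"
  proof (rule injI)
    fix x y assume "\<sigma> x = \<sigma> y"
    then show "x = y"
      using partial_embedding_nonzero[OF M(1) alg \<sigma>, of "x - y"] diff by auto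
  qed
  moreover have "surj \<sigma>"
  proof -
    have "y \<in> range \<sigma>" for y
    proof -
      obtain c where c: "\<And>i. coeff c i \<in> \<rat>" "c \<noteq> 0" "poly c y = 0"
        using algebraic_rational_polynomial[OF alg] by blast
      have "pair_poly M c c"
        using c(1) M(1) unfolding pair_poly_def partial_embedding_def by (auto simp: subset_iff)
      then have "poly c (\<sigma> x) = \<sigma> (poly c x)" for x
        using unique[OF pair_poly_eval[OF ring _ \<sigma>]] by simp
      moreover have "\<sigma> 0 = 0"
        using diff[of 0 0] by simp
      ultimately have "\<sigma> ` {x. poly c x = 0} \<subseteq> {x. poly c x = 0}"
        by auto
      then have "\<sigma> ` {x. poly c x = 0} = {x. poly c x = 0}"
        using endo_inj_surj[OF poly_roots_finite[OF c(2)]] inj_on_subset[OF \<open>inj \<sigma>\<close>] by blast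
      then show ?thesis
        using c(3) by blast
    qed
    then show ?thesis
      by auto
  qed
  ultimately have "field_automorphism \<sigma>"
    unfolding field_automorphism_def bij_def using one add mult by blast
  then show thesis
    using that unique M(2) by blast
qed

text \<open>In characteristic \<open>0\<close>, \<open>x\<close> is a simple root of its minimal polynomial over \<open>K\<close>. Outside of \<open>K\<close>, this
  polynomial has degree at least \<open>2\<close>, hence another root, to which \<open>x\<close> can be mapped.\<close>

theorem automorphism_moving:
  fixes K :: "'a::{alg_closed_field, field_char_0} set"
  assumes alg: "\<And>x::'a. algebraic x" and Rats: "\<rat> \<subseteq> K"
    and closed: "\<And>x y. x \<in> K \<Longrightarrow> y \<in> K \<Longrightarrow> x + y \<in> K \<and> x - y \<in> K \<and> x * y \<in> K"
    and inverse: "\<And>x. x \<in> K \<Longrightarrow> inverse x \<in> K"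
    and "x \<notin> K"
  obtains \<sigma> where "field_automorphism \<sigma>" "\<And>a. a \<in> K \<Longrightarrow> \<sigma> a = a" "\<sigma> x \<noteq> x"
proof -
  have R: "partial_embedding (Id_on K)"
    unfolding partial_embedding_def pair_subring_def using Rats closed by auto
  have same: "q = p" if "pair_poly (Id_on K) p q" for p q
    using that unfolding pair_poly_def by (auto simp: poly_eq_iff)
  obtain p where p: "pair_poly (Id_on K) p p" "p \<noteq> 0" "poly p x = 0"
    and min: "\<And>f g. pair_poly (Id_on K) f g \<Longrightarrow> f \<noteq> 0 \<Longrightarrow> poly f x = 0 \<Longrightarrow> degree p \<le> degree f"
    using exists_minimal_polynomial[OF R alg[of x]] same by metis
  have coeff: "coeff p i \<in> K" for i
    using p(1) unfolding pair_poly_def by auto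
  have deg0: "degree p \<noteq> 0"
    using p(2,3) by (metis degree_eq_zeroE poly_const_conv pCons_0_0)
  have deg1: "degree p \<noteq> 1"
  proof
    assume deg: "degree p = 1"
    then obtain a b where ab: "p = [:a, b:]" "b \<noteq> 0"
      using degree1_coeffs by metis
    have "a \<in> K" "b \<in> K"
      using coeff[of 0] coeff[of 1] ab(1) by auto
    moreover have "x = (0 - a) * Fields.inverse b"
      using p(3) ab by (simp add: field_simps eq_neg_iff_add_eq_0)
    ultimately show False
      using closed inverse Rats \<open>x \<notin> K\<close> Rats_0 by (metis subsetD)
  qed
  obtain r where r: "p = [:- x, 1:] * r"
    using p(3) unfolding poly_eq_0_iff_dvd by (auto elim: dvdE)
  have "r \<noteq> 0"
    using p(2) r by auto
  have "poly r x \<noteq> 0"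
  proof
    assume "poly r x = 0"
    then have "poly (pderiv p) x = 0"
      unfolding r pderiv_mult by (simp add: pderiv_pCons)
    moreover have "pair_poly (Id_on K) (pderiv p) (pderiv p)"
    proof -
      have "of_nat (Suc n) * coeff p (Suc n) \<in> K" for n
        using closed coeff Rats Rats_of_nat by (metis subsetD)
      then show ?thesis
        unfolding pair_poly_def by (auto simp: coeff_pderiv)
    qed
    moreover have "pderiv p \<noteq> 0"
      using deg0 by (simp add: pderiv_eq_0_iff)
    ultimately have "degree p \<le> degree (pderiv p)"
      using min by blast
    then show False
      using deg0 by (simp add: degree_pderiv)
  qed
  have "degree p = Suc (degree r)"
    unfolding r using \<open>r \<noteq> 0\<close> by (subst degree_mult_eq) auto
  then have "degree r > 0"
    using deg1 by simp
  then obtain y where y: "poly r y = 0"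
    using alg_closed_imp_poly_has_root by blast
  have "y \<noteq> x"
    using y \<open>poly r x \<noteq> 0\<close> by auto
  have "poly p y = 0"
    unfolding r using y by simp
  then obtain R' where R': "partial_embedding R'" "Id_on K \<subseteq> R'" "(x, y) \<in> R'"
    by (rule partial_embedding_extend_root[OF alg R p]) (use min in blast)+
  obtain \<sigma> where \<sigma>: "field_automorphism \<sigma>" "\<And>a b. (a, b) \<in> R' \<Longrightarrow> \<sigma> a = b"
    using partial_embedding_extends_to_automorphism[OF alg R'(1)] by blast
  show thesis
    by (rule that[OF \<sigma>(1)]) (use \<sigma>(2) R' \<open>y \<noteq> x\<close> in auto)
qed

section \<open>Galois groups\<close>

lemma Qbar_simps [simp]:
  "carrier Qbar = UNIV" "x \<otimes>\<^bsub>Qbar\<^esub> y = x * y" "\<one>\<^bsub>Qbar\<^esub> = 1" "\<zero>\<^bsub>Qbar\<^esub> = 0" "x \<oplus>\<^bsub>Qbar\<^esub> y = x + y"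
  for x y :: "'a::field"
  by (simp_all add: ring_of_type_algebra_def)

interpretation Qbar: domain "Qbar :: 'a::field ring"
  by (rule field.axioms(1)[OF field_from_type_algebra])

lemma Qbar_a_inv: "\<ominus>\<^bsub>Qbar\<^esub> x = - x" for x :: "'a::field"
  by (rule Qbar.minus_equality) auto

lemma Qbar_inv: "x \<noteq> 0 \<Longrightarrow> inv\<^bsub>Qbar\<^esub> x = inverse x" for x :: "'a::field"
  by (rule Qbar.comm_inv_char) auto

lemma subfield_closed:
  fixes K :: "'a::field_char_0 set"
  assumes "subfield K Qbar"
  shows "1 \<in> K" "x \<in> K \<Longrightarrow> y \<in> K \<Longrightarrow> x + y \<in> K \<and> x - y \<in> K \<and> x * y \<in> K"
    "x \<in> K \<Longrightarrow> inverse x \<in> K" "\<rat> \<subseteq> K"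
proof -
  note sub = subfieldE(1)[OF assms]
  show one: "1 \<in> K"
    using subringE(3)[OF sub] by simp
  show closed: "x + y \<in> K \<and> x - y \<in> K \<and> x * y \<in> K" if "x \<in> K" "y \<in> K" for x y
    using subringE(5-7)[OF sub] that by (auto simp: Qbar_a_inv simp flip: add_uminus_conv_diff)
  show inverse: "inverse x \<in> K" if "x \<in> K" for x
    using Qbar.subfield_m_inv(1)[OF assms, of x] that by (cases "x = 0") (auto simp: Qbar_inv)
  show "\<rat> \<subseteq> K"
  proof
    fix x :: 'a assume "x \<in> \<rat>"
    then obtain a b :: int where ab: "x = of_int a * inverse (of_int b)"
      by (auto elim!: Rats_cases' simp: divide_inverse)
    have zero: "0 \<in> K"
      using closed[OF one one] by simp
    have nat: "of_nat n \<in> K" for n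
      by (induction n) (use zero one closed in auto)
    have "of_int a \<in> K" for a
      using nat closed[OF zero nat] by (cases a rule: int_cases2) auto
    then show "x \<in> K"
      using ab inverse closed by simp
  qed
qed

lemma mem_gal:
  "\<sigma> \<in> carrier (gal E F) \<longleftrightarrow> \<sigma> \<in> extensional E \<and> bij_betw \<sigma> E E \<and> \<sigma> 1 = 1 \<and>
    (\<forall>x\<in>E. \<forall>y\<in>E. \<sigma> (x + y) = \<sigma> x + \<sigma> y \<and> \<sigma> (x * y) = \<sigma> x * \<sigma> y) \<and> (\<forall>x\<in>F. \<sigma> x = x)"
  unfolding gal_def by (auto simp: ring_iso_def ring_hom_def dest: bij_betw_apply)

lemma mem_abs_gal: "\<sigma> \<in> carrier (abs_gal K) \<longleftrightarrow> field_automorphism \<sigma> \<and> (\<forall>x\<in>K. \<sigma> x = x)"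
  unfolding mem_gal field_automorphism_def by (auto simp: extensional_def)

lemma group_gal:
  fixes E F :: "'a::field set"
  assumes E: "1 \<in> E" "\<And>x y. x \<in> E \<Longrightarrow> y \<in> E \<Longrightarrow> x + y \<in> E \<and> x * y \<in> E" and "F \<subseteq> E"
  shows "group (gal E F)"
proof -
  interpret B: group "BijGroup E"
    by (rule group_BijGroup)
  have car: "carrier (BijGroup E) = Bij E"
    by (simp add: BijGroup_def)
  have "subgroup (carrier (gal E F)) (BijGroup E)"
  proof (rule B.subgroupI)
    show sub: "carrier (gal E F) \<subseteq> carrier (BijGroup E)"
      unfolding car Bij_def by (auto simp: mem_gal)
    have "restrict id E \<in> carrier (gal E F)"
      unfolding mem_gal using E \<open>F \<subseteq> E\<close> by (auto intro: bij_betw_byWitness[where f' = id])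
    then show "carrier (gal E F) \<noteq> {}"
      by blast
  next
    fix \<sigma> assume \<sigma>: "\<sigma> \<in> carrier (gal E F)"
    have Bij: "\<sigma> \<in> Bij E" and bij: "bij_betw \<sigma> E E"
      using \<sigma> unfolding Bij_def mem_gal by auto
    let ?\<tau> = "inv_into E \<sigma>"
    have right: "\<sigma> (?\<tau> x) = x" and left: "?\<tau> (\<sigma> x) = x" and mem: "?\<tau> x \<in> E" if "x \<in> E" for x
      using that bij bij_betw_inv_into_right bij_betw_inv_into_left bij_betw_apply[OF bij_betw_inv_into[OF bij]]
      by metis+
    have "?\<tau> (x + y) = ?\<tau> x + ?\<tau> y \<and> ?\<tau> (x * y) = ?\<tau> x * ?\<tau> y" if xy: "x \<in> E" "y \<in> E" for x y
    proof -
      have "\<sigma> (?\<tau> x + ?\<tau> y) = x + y" "\<sigma> (?\<tau> x * ?\<tau> y) = x * y"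
        using \<sigma> mem right xy unfolding mem_gal by auto
      moreover have "?\<tau> x + ?\<tau> y \<in> E" "?\<tau> x * ?\<tau> y \<in> E"
        using E(2)[OF mem[OF xy(1)] mem[OF xy(2)]] by auto
      ultimately show ?thesis
        using left by metis
    qed
    moreover have "?\<tau> x = x" if "x \<in> F" for x
      using left[of x] that \<sigma> \<open>F \<subseteq> E\<close> unfolding mem_gal by auto
    moreover have "?\<tau> 1 = 1"
      using left[of 1] E(1) \<sigma> unfolding mem_gal by simp
    ultimately have "restrict ?\<tau> E \<in> carrier (gal E F)"
      unfolding mem_gal using E bij_betw_inv_into[OF bij] \<open>F \<subseteq> E\<close>
      by (auto simp: subset_iff)
    then show "inv\<^bsub>BijGroup E\<^esub> \<sigma> \<in> carrier (gal E F)"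
      using inv_BijGroup[OF Bij] by simp
  next
    fix \<sigma> \<tau> assume \<sigma>: "\<sigma> \<in> carrier (gal E F)" and \<tau>: "\<tau> \<in> carrier (gal E F)"
    have Bij: "\<sigma> \<in> Bij E" "\<tau> \<in> Bij E"
      using \<sigma> \<tau> unfolding Bij_def mem_gal by auto
    have mem: "\<tau> x \<in> E" if "x \<in> E" for x
      using \<tau> that unfolding mem_gal by (auto dest: bij_betw_apply)
    have "compose E \<sigma> \<tau> \<in> carrier (gal E F)"
      unfolding mem_gal
    proof (intro conjI ballI)
      show "bij_betw (compose E \<sigma> \<tau>) E E"
        using \<sigma> \<tau> bij_betw_compose unfolding mem_gal by blast
      show "compose E \<sigma> \<tau> 1 = 1"
        using \<sigma> \<tau> E(1) unfolding mem_gal by (simp add: compose_eq)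
      show "compose E \<sigma> \<tau> x = x" if "x \<in> F" for x
        using \<sigma> \<tau> that \<open>F \<subseteq> E\<close> unfolding mem_gal by (auto simp: compose_def)
      show "compose E \<sigma> \<tau> (x + y) = compose E \<sigma> \<tau> x + compose E \<sigma> \<tau> y"
        "compose E \<sigma> \<tau> (x * y) = compose E \<sigma> \<tau> x * compose E \<sigma> \<tau> y" if "x \<in> E" "y \<in> E" for x y
        using \<sigma> \<tau> that E(2)[OF that] mem unfolding mem_gal by (auto simp: compose_eq)
    qed simp
    then show "\<sigma> \<otimes>\<^bsub>BijGroup E\<^esub> \<tau> \<in> carrier (gal E F)"
      using Bij by (simp add: BijGroup_def)
  qed
  then have "group ((BijGroup E)\<lparr>carrier := carrier (gal E F)\<rparr>)"
    using subgroup.subgroup_is_group B.is_group by blast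
  then show ?thesis
    by (simp add: gal_def)
qed

lemma group_abs_gal: "group (abs_gal K)"
  by (rule group_gal) auto

lemma gal_mult:
  assumes "\<sigma> \<in> carrier (gal E F)" "\<tau> \<in> carrier (gal E F)"
  shows "\<sigma> \<otimes>\<^bsub>gal E F\<^esub> \<tau> = compose E \<sigma> \<tau>"
proof -
  have "\<sigma> \<in> Bij E" "\<tau> \<in> Bij E"
    using assms unfolding Bij_def mem_gal by auto
  then show ?thesis
    by (simp add: gal_def BijGroup_def)
qed

lemma gal_one: "\<one>\<^bsub>gal E F\<^esub> = (\<lambda>x\<in>E. x)"
  by (simp add: gal_def BijGroup_def)

lemma abs_gal_mult_apply:
  assumes "\<sigma> \<in> carrier (abs_gal K)" "\<tau> \<in> carrier (abs_gal K)"
  shows "(\<sigma> \<otimes>\<^bsub>abs_gal K\<^esub> \<tau>) x = \<sigma> (\<tau> x)"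
  using gal_mult[OF assms] by (simp add: compose_def)

lemma abs_gal_one_apply: "\<one>\<^bsub>abs_gal K\<^esub> x = x"
  by (simp add: gal_one)

lemma abs_gal_inv_apply:
  assumes "\<sigma> \<in> carrier (abs_gal K)"
  shows "(inv\<^bsub>abs_gal K\<^esub> \<sigma>) (\<sigma> x) = x" "\<sigma> ((inv\<^bsub>abs_gal K\<^esub> \<sigma>) x) = x"
proof -
  interpret group "abs_gal K"
    by (rule group_abs_gal)
  show "(inv\<^bsub>abs_gal K\<^esub> \<sigma>) (\<sigma> x) = x" "\<sigma> ((inv\<^bsub>abs_gal K\<^esub> \<sigma>) x) = x"
    using abs_gal_mult_apply[of _ K _ x] abs_gal_one_apply[of K x] l_inv[OF assms] r_inv[OF assms] assms inv_closed
    by metis+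
qed

lemma abs_gal_carrier_update:
  "abs_gal K = (abs_gal F)\<lparr>carrier := carrier (abs_gal K)\<rparr>"
  by (simp add: gal_def)

lemma abs_gal_antimono: "F \<subseteq> K \<Longrightarrow> carrier (abs_gal K) \<subseteq> carrier (abs_gal F)"
  unfolding mem_abs_gal subset_iff by blast

lemma subgroup_abs_gal:
  assumes "F \<subseteq> K"
  shows "subgroup (carrier (abs_gal K)) (abs_gal F)"
  by (rule group.group_incl_imp_subgroup[OF group_abs_gal abs_gal_antimono[OF assms]])
    (simp add: abs_gal_carrier_update[of K F, symmetric] group_abs_gal)

lemma abs_gal_le_Rats: "carrier (abs_gal K) \<subseteq> carrier (abs_gal \<rat>)" for K :: "'a::field_char_0 set"
  by (auto simp: mem_abs_gal field_automorphism_Rats)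

lemma subgroup_abs_gal_Rats: "subgroup (carrier (abs_gal K)) (abs_gal \<rat>)" for K :: "'a::field_char_0 set"
  by (rule group.group_incl_imp_subgroup[OF group_abs_gal abs_gal_le_Rats])
    (simp add: abs_gal_carrier_update[of K \<rat>, symmetric] group_abs_gal)

lemma fixed_by_abs_gal:
  fixes K :: "'a::{alg_closed_field, field_char_0} set"
  assumes alg: "\<And>x::'a. algebraic x" and K: "subfield K Qbar"
    and fixed: "\<And>\<sigma>. \<sigma> \<in> carrier (abs_gal K) \<Longrightarrow> \<sigma> x = x"
  shows "x \<in> K"
proof (rule ccontr)
  assume "x \<notin> K"
  show False
    by (rule automorphism_moving[OF alg subfield_closed(4)[OF K] subfield_closed(2)[OF K] subfield_closed(3)[OF K] \<open>x \<notin> K\<close>])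
      (use fixed in \<open>auto simp: mem_abs_gal\<close>)
qed

lemma subfield_Rats: "subfield \<rat> (Qbar :: 'a::field_char_0 ring)"
proof (rule field.subfieldI'[OF field_from_type_algebra Qbar.subringI])
  show "inv\<^bsub>Qbar\<^esub> k \<in> \<rat>" if "k \<in> \<rat> - {\<zero>\<^bsub>Qbar\<^esub>}" for k :: 'a
    using that by (simp add: Qbar_inv)
qed (auto simp: Qbar_a_inv)

lemma poly_automorphism:
  fixes \<sigma> :: "'a::field_char_0 \<Rightarrow> 'a"
  assumes "field_automorphism \<sigma>" "\<And>i. coeff c i \<in> \<rat>"
  shows "poly c (\<sigma> x) = \<sigma> (poly c x)"
proof -
  have "pair_poly {(x, \<sigma> x) | x. True} c c"
    unfolding pair_poly_def using field_automorphism_Rats[OF assms(1,2)] by auto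
  from pair_poly_eval[OF pair_subring_graph[OF assms(1)] this, of x "\<sigma> x"] show ?thesis
    by auto
qed

definition conjugates :: "'a::field_char_0 \<Rightarrow> 'a set"
  where "conjugates x = (\<lambda>\<sigma>. \<sigma> x) ` carrier (abs_gal \<rat>)"

lemma finite_conjugates:
  fixes x :: "'a::field_char_0"
  assumes "algebraic x"
  shows "finite (conjugates x)"
proof -
  obtain c where c: "\<And>i. coeff c i \<in> \<rat>" "c \<noteq> 0" "poly c x = 0"
    using algebraic_rational_polynomial[OF assms] by blast
  have "conjugates x \<subseteq> {y. poly c y = 0}"
    using poly_automorphism[OF _ c(1)] c(3) field_automorphismD(5) by (auto simp: conjugates_def mem_abs_gal)
  then show ?thesis
    using finite_subset poly_roots_finite[OF c(2)] by blast
qed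

lemma conjugates_self: "x \<in> conjugates x"
proof -
  have "\<one>\<^bsub>abs_gal \<rat>\<^esub> \<in> carrier (abs_gal \<rat>)" "\<one>\<^bsub>abs_gal \<rat>\<^esub> x = x"
    using monoid.one_closed[OF group.is_monoid[OF group_abs_gal]] abs_gal_one_apply by auto
  then show ?thesis
    unfolding conjugates_def by (metis rev_image_eqI)
qed

lemma conjugates_invariant:
  assumes "\<sigma> \<in> carrier (abs_gal \<rat>)" "y \<in> conjugates x"
  shows "\<sigma> y \<in> conjugates x"
proof -
  obtain \<tau> where \<tau>: "\<tau> \<in> carrier (abs_gal \<rat>)" "y = \<tau> x"
    using assms(2) unfolding conjugates_def by auto
  have "\<sigma> \<otimes>\<^bsub>abs_gal \<rat>\<^esub> \<tau> \<in> carrier (abs_gal \<rat>)" "(\<sigma> \<otimes>\<^bsub>abs_gal \<rat>\<^esub> \<tau>) x = \<sigma> y"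
    using monoid.m_closed[OF group.is_monoid[OF group_abs_gal] assms(1) \<tau>(1)]
      abs_gal_mult_apply[OF assms(1) \<tau>(1)] \<tau>(2) by auto
  then show ?thesis
    unfolding conjugates_def by (metis rev_image_eqI)
qed

section \<open>Galois extensions and restriction of automorphisms\<close>

lemma pair_subring_gal_graph:
  fixes E F :: "'a::field set"
  assumes "1 \<in> E" "\<And>x y. x \<in> E \<Longrightarrow> y \<in> E \<Longrightarrow> x + y \<in> E \<and> x - y \<in> E \<and> x * y \<in> E"
    and \<sigma>: "\<sigma> \<in> carrier (gal E F)"
  shows "pair_subring {(x, \<sigma> x) | x. x \<in> E}"
proof -
  have hom: "\<sigma> 1 = 1" "\<And>x y. x \<in> E \<Longrightarrow> y \<in> E \<Longrightarrow> \<sigma> (x + y) = \<sigma> x + \<sigma> y \<and> \<sigma> (x * y) = \<sigma> x * \<sigma> y"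
    using \<sigma> unfolding mem_gal by auto
  have diff: "\<sigma> (x - y) = \<sigma> x - \<sigma> y" if "x \<in> E" "y \<in> E" for x y
    using hom(2)[of "x - y" y] assms(2)[OF that] that by simp
  have "0 \<in> E"
    using assms(2)[OF assms(1,1)] by simp
  moreover have "\<sigma> 0 = 0"
    using diff[OF assms(1,1)] by simp
  ultimately show ?thesis
    unfolding pair_subring_def using hom diff assms(1,2) by auto
qed

text \<open>The coefficients are symmetric functions of \<open>A\<close>, so they are fixed by all automorphisms of \<open>E\<close>.\<close>

lemma prod_roots_coeff_Rats:
  assumes E: "galois_over_rat E" and A: "finite A" "A \<subseteq> E"
    and inv: "\<And>\<sigma>. \<sigma> \<in> carrier (gal E \<rat>) \<Longrightarrow> \<sigma> ` A \<subseteq> A"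
  shows "coeff (\<Prod>a\<in>A. [:- a, 1:]) i \<in> \<rat>"
proof -
  note E_closed = subfield_closed(1,2)[of E]
  have sub: "subfield E Qbar"
    using E unfolding galois_over_rat_def by simp
  define c where "c = coeff (\<Prod>a\<in>A. [:- a, 1:]) i"
  have "pair_subring (Id_on E)"
    using E_closed[OF sub] unfolding pair_subring_def by fastforce
  from pair_poly_prod_roots[OF this, of A id] A(2) have "c \<in> E"
    unfolding pair_poly_def c_def by auto
  moreover have "\<sigma> c = c" if \<sigma>: "\<sigma> \<in> carrier (gal E \<rat>)" for \<sigma>
  proof -
    have "pair_poly {(x, \<sigma> x) | x. x \<in> E} (\<Prod>a\<in>A. [:- a, 1:]) (\<Prod>a\<in>A. [:- \<sigma> a, 1:])"
      by (rule pair_poly_prod_roots[OF pair_subring_gal_graph[OF E_closed[OF sub] \<sigma>]]) (use A(2) in auto)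
    then have "\<sigma> c = coeff (\<Prod>a\<in>A. [:- \<sigma> a, 1:]) i"
      unfolding pair_poly_def c_def by auto
    also have "(\<Prod>a\<in>A. [:- \<sigma> a, 1:]) = (\<Prod>a\<in>\<sigma> ` A. [:- a, 1:])"
    proof (rule prod.reindex_cong[symmetric, OF _ refl refl])
      show "inj_on \<sigma> A"
        using \<sigma> A(2) unfolding mem_gal bij_betw_def by (blast intro: inj_on_subset)
    qed
    also have "\<sigma> ` A = A"
    proof (rule endo_inj_surj[OF A(1) inv[OF \<sigma>]])
      show "inj_on \<sigma> A"
        using \<sigma> A(2) unfolding mem_gal bij_betw_def by (blast intro: inj_on_subset)
    qed
    finally show ?thesis
      unfolding c_def .
  qed
  ultimately have "c \<in> {x \<in> E. \<forall>\<sigma>\<in>carrier (gal E \<rat>). \<sigma> x = x}"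
    by simp
  then show ?thesis
    using E unfolding galois_over_rat_def c_def by simp
qed

lemma poly_prod_roots_eq_0_iff:
  fixes A :: "'a::idom set"
  assumes "finite A"
  shows "poly (\<Prod>a\<in>A. [:- a, 1:]) x = 0 \<longleftrightarrow> x \<in> A"
  using assms by (simp add: poly_prod)

lemma gal_poly_root:
  assumes "subfield E Qbar" "\<sigma> \<in> carrier (gal E \<rat>)" "x \<in> E" "\<And>i. coeff c i \<in> \<rat>" "poly c x = 0"
  shows "poly c (\<sigma> x) = 0"
proof -
  have ring: "pair_subring {(x, \<sigma> x) | x. x \<in> E}"
    by (rule pair_subring_gal_graph[OF subfield_closed(1,2)[OF assms(1)] assms(2)])
  have "pair_poly {(x, \<sigma> x) | x. x \<in> E} c c"
    unfolding pair_poly_def using assms(2,4) subfield_closed(4)[OF assms(1)] unfolding mem_gal by fastforce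
  from pair_poly_eval[OF ring this, of x "\<sigma> x"] assms(3,5)
  have "poly c (\<sigma> x) = \<sigma> 0"
    by auto
  moreover have "\<sigma> 0 = 0"
    using assms(2) Rats_0 unfolding mem_gal by blast
  ultimately show ?thesis
    by simp
qed

text \<open>The conjugates of \<open>x\<close> under the automorphisms of a Galois extension \<open>E\<close> are the roots of a
  rational polynomial, so every automorphism of the algebraic closure permutes them.\<close>

lemma galois_invariant:
  fixes E :: "'a::field_char_0 set"
  assumes E: "galois_over_rat E" and "algebraic x" "x \<in> E" and \<tau>: "field_automorphism \<tau>"
  shows "\<tau> x \<in> E"
proof -
  have sub: "subfield E Qbar"
    using E unfolding galois_over_rat_def by simp
  interpret group "gal E \<rat>"
    using group_gal[of E \<rat>] subfield_closed[OF sub] by blast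
  obtain c where c: "\<And>i. coeff c i \<in> \<rat>" "c \<noteq> 0" "poly c x = 0"
    using algebraic_rational_polynomial[OF assms(2)] by blast
  define A where "A = (\<lambda>\<sigma>. \<sigma> x) ` carrier (gal E \<rat>)"
  have AE: "A \<subseteq> E"
    unfolding A_def using \<open>x \<in> E\<close> by (auto simp: mem_gal dest: bij_betw_apply)
  have "A \<subseteq> {y. poly c y = 0}"
    unfolding A_def using gal_poly_root[OF sub _ \<open>x \<in> E\<close> c(1,3)] by auto
  then have fin: "finite A"
    using finite_subset poly_roots_finite[OF c(2)] by blast
  have "\<sigma> ` A \<subseteq> A" if \<sigma>: "\<sigma> \<in> carrier (gal E \<rat>)" for \<sigma>
  proof clarify
    fix y assume "y \<in> A"
    then obtain \<rho> where \<rho>: "\<rho> \<in> carrier (gal E \<rat>)" "y = \<rho> x"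
      unfolding A_def by auto
    then have "\<sigma> y = (\<sigma> \<otimes>\<^bsub>gal E \<rat>\<^esub> \<rho>) x"
      using gal_mult[OF \<sigma> \<rho>(1)] \<open>x \<in> E\<close> by (simp add: compose_def)
    then show "\<sigma> y \<in> A"
      unfolding A_def using m_closed[OF \<sigma> \<rho>(1)] by auto
  qed
  then have rat: "coeff (\<Prod>a\<in>A. [:- a, 1:]) i \<in> \<rat>" for i
    using prod_roots_coeff_Rats[OF E fin AE] by blast
  have "x = \<one>\<^bsub>gal E \<rat>\<^esub> x"
    using \<open>x \<in> E\<close> by (simp add: gal_one)
  then have "x \<in> A"
    unfolding A_def using one_closed by blast
  then have "poly (\<Prod>a\<in>A. [:- a, 1:]) (\<tau> x) = 0"
    using poly_automorphism[OF \<tau> rat] poly_prod_roots_eq_0_iff[OF fin] field_automorphismD(5)[OF \<tau>] by metis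
  then show ?thesis
    using poly_prod_roots_eq_0_iff[OF fin] AE by blast
qed

lemma galois_over_rat_UNIV:
  assumes alg: "\<And>x::'a::{alg_closed_field, field_char_0}. algebraic x"
  shows "galois_over_rat (UNIV :: 'a set)"
proof -
  have "subfield UNIV (Qbar :: 'a ring)"
    using field.carrier_is_subfield[OF field_from_type_algebra[where 'a = 'a]] by simp
  moreover have "\<sigma> x = x" if "x \<in> \<rat>" "\<sigma> \<in> carrier (abs_gal \<rat>)" for \<sigma> and x :: 'a
    using that by (simp add: mem_abs_gal)
  ultimately show ?thesis
    unfolding galois_over_rat_def using fixed_by_abs_gal[OF alg subfield_Rats] by blast
qed

text \<open>Restriction to the Galois closure is a homomorphism, so solvability of the Galois group of the
  closure bounds the derived series of the absolute Galois group.\<close>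

lemma derived_series_fixes:
  fixes K :: "'a::{alg_closed_field, field_char_0} set"
  assumes alg: "\<And>x::'a. algebraic x" and solv: "solvable (gal (galois_closure K) \<rat>)"
  obtains n where "(derived (abs_gal \<rat>) ^^ n) (carrier (abs_gal \<rat>)) \<subseteq> carrier (abs_gal K)"
proof -
  define M where "M = galois_closure K"
  have KM: "K \<subseteq> M"
    unfolding M_def galois_closure_def by blast
  have inv: "\<sigma> x \<in> M" if "field_automorphism \<sigma>" "x \<in> M" for \<sigma> x
    using that galois_invariant[OF _ alg _ that(1)] unfolding M_def galois_closure_def by blast
  have M_closed: "1 \<in> M" "\<rat> \<subseteq> M" "\<And>x y. x \<in> M \<Longrightarrow> y \<in> M \<Longrightarrow> x + y \<in> M \<and> x * y \<in> M"
    using subfield_closed unfolding M_def galois_closure_def galois_over_rat_def by blast+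
  interpret \<Gamma>: group "abs_gal (\<rat> :: 'a set)"
    by (rule group_abs_gal)
  interpret M: group "gal M \<rat>"
    by (rule group_gal[OF M_closed(1,3,2)])
  define \<rho> where "\<rho> = (\<lambda>\<sigma>::'a \<Rightarrow> 'a. restrict \<sigma> M)"
  have \<rho>_mem: "\<rho> \<sigma> \<in> carrier (gal M \<rat>)" if \<sigma>: "\<sigma> \<in> carrier (abs_gal \<rat>)" for \<sigma>
  proof -
    have aut: "field_automorphism \<sigma>"
      using \<sigma> by (simp add: mem_abs_gal)
    have "field_automorphism (inv\<^bsub>abs_gal \<rat>\<^esub> \<sigma>)"
      using \<Gamma>.inv_closed[OF \<sigma>] by (simp add: mem_abs_gal)
    then have "x \<in> \<sigma> ` M" if "x \<in> M" for x
      using inv that abs_gal_inv_apply(2)[OF \<sigma>, of x] by (metis imageI)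
    then have "\<sigma> ` M = M"
      using inv[OF aut] by blast
    moreover have "inj_on \<sigma> M"
      using bij_is_inj[OF field_automorphismD(1)[OF aut]] inj_on_subset by blast
    ultimately have "bij_betw (\<rho> \<sigma>) M M"
      unfolding \<rho>_def bij_betw_def by simp
    then show ?thesis
      unfolding mem_gal \<rho>_def using M_closed field_automorphismD[OF aut] field_automorphism_Rats[OF aut]
      by (auto simp: subset_iff)
  qed
  interpret \<rho>: group_hom "abs_gal \<rat>" "gal M \<rat>" \<rho>
  proof
    show "\<rho> \<in> hom (abs_gal \<rat>) (gal M \<rat>)"
    proof (rule homI)
      fix \<sigma> \<tau> :: "'a \<Rightarrow> 'a" assume \<sigma>\<tau>: "\<sigma> \<in> carrier (abs_gal \<rat>)" "\<tau> \<in> carrier (abs_gal \<rat>)"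
      have "\<tau> x \<in> M" if "x \<in> M" for x
        using inv[OF _ that] \<sigma>\<tau>(2) by (simp add: mem_abs_gal)
      then show "\<rho> (\<sigma> \<otimes>\<^bsub>abs_gal \<rat>\<^esub> \<tau>) = \<rho> \<sigma> \<otimes>\<^bsub>gal M \<rat>\<^esub> \<rho> \<tau>"
        unfolding gal_mult[OF \<rho>_mem[OF \<sigma>\<tau>(1)] \<rho>_mem[OF \<sigma>\<tau>(2)]]
        by (auto simp: \<rho>_def compose_def abs_gal_mult_apply[OF \<sigma>\<tau>] restrict_def fun_eq_iff)
    qed (rule \<rho>_mem)
  qed
  obtain n where n: "(derived (gal M \<rat>) ^^ n) (carrier (gal M \<rat>)) = {\<one>\<^bsub>gal M \<rat>\<^esub>}"
    using solv unfolding M_def[symmetric] M.solvable_iff_trivial_derived_seq by blast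
  have "\<rho> ` ((derived (abs_gal \<rat>) ^^ n) (carrier (abs_gal \<rat>))) \<subseteq> {\<one>\<^bsub>gal M \<rat>\<^esub>}"
  proof -
    have "\<rho> ` carrier (abs_gal \<rat>) \<subseteq> carrier (gal M \<rat>)"
      using \<rho>_mem by blast
    from M.mono_exp_of_derived[OF this, of n] show ?thesis
      unfolding \<rho>.exp_of_derived_img[OF subset_refl] n .
  qed
  moreover have "\<sigma> \<in> carrier (abs_gal K)" if "\<sigma> \<in> carrier (abs_gal \<rat>)" "\<rho> \<sigma> = \<one>\<^bsub>gal M \<rat>\<^esub>" for \<sigma>
  proof -
    have "\<sigma> x = x" if "x \<in> K" for x
      using fun_cong[OF \<open>\<rho> \<sigma> = \<one>\<^bsub>gal M \<rat>\<^esub>\<close>, of x] that KM by (auto simp: gal_one \<rho>_def)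
    then show ?thesis
      using that(1) by (simp add: mem_abs_gal)
  qed
  moreover have "(derived (abs_gal \<rat>) ^^ n) (carrier (abs_gal \<rat>)) \<subseteq> carrier (abs_gal (\<rat> :: 'a set))"
    using \<Gamma>.exp_of_derived_in_carrier by blast
  ultimately show thesis
    by (intro that[of n]) blast
qed

section \<open>Degree and index\<close>

lemma eval_rev:
  fixes x :: "'a::field"
  shows "Qbar.eval (rev cs) x = poly (Poly cs) x"
proof (induction cs)
  case (Cons c cs)
  then show ?case
    using Qbar.eval_append_aux[of "rev cs" c x] by (simp add: mult.commute add.commute)
qed simp

lemma univ_poly_carrier_rev_coeffs:
  fixes p :: "'a::field poly"
  assumes "\<And>i. coeff p i \<in> K"
  shows "rev (coeffs p) \<in> carrier (K[X]\<^bsub>Qbar\<^esub>)"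
proof -
  have "polynomial\<^bsub>Qbar\<^esub> K (rev (coeffs p))"
  proof (cases "p = 0")
    case False
    have "set (rev (coeffs p)) \<subseteq> K"
      unfolding coeffs_def using assms by auto
    moreover have "hd (rev (coeffs p)) \<noteq> 0"
      using False by (simp add: hd_rev last_coeffs_eq_coeff_degree)
    ultimately show ?thesis
      unfolding polynomial_def by simp
  qed (simp add: polynomial_def)
  then show ?thesis
    unfolding univ_poly_carrier .
qed

lemma Qbar_algebraic:
  fixes x :: "'a::field_char_0"
  assumes "algebraic x" "subfield K Qbar"
  shows "Qbar.algebraic K x"
proof -
  obtain c where c: "\<And>i. coeff c i \<in> \<rat>" "c \<noteq> 0" "poly c x = 0"
    using algebraic_rational_polynomial[OF assms(1)] by blast
  have "rev (coeffs c) \<in> carrier (K[X]\<^bsub>Qbar\<^esub>)"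
    using univ_poly_carrier_rev_coeffs c(1) subfield_closed(4)[OF assms(2)] by blast
  then show ?thesis
    using Qbar.algebraicI[of "rev (coeffs c)" K x] c(2,3) unfolding over_def by (simp add: eval_rev)
qed

lemma dimension_one_eq:
  fixes K E :: "'a::field set"
  assumes "subfield K Qbar" "Qbar.dimension 1 K E" "K \<subseteq> E"
  shows "E = K"
proof -
  have Us: "Qbar.independent K [1]" "set [1] \<subseteq> E" "set [1] \<subseteq> K"
    using Qbar.independent.li_Cons[of 1 K "[]"] subringE(3)[OF subfieldE(1)[OF assms(1)]] assms(3) by auto
  have "Qbar.Span K [1] = E"
    by (rule iffD1[OF Qbar.independent_length_eq_dimension[OF assms(1,2) Us(1,2)]]) simp
  moreover have "Qbar.Span K [1] \<subseteq> K"
    using Qbar.subalgebra_Span_incl[OF assms(1) _ Us(3)]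
      Qbar.finite_dimension_imp_subalgebra[OF assms(1) Qbar.finite_dimensionI[OF Qbar.dimension_one[OF assms(1)]]]
    by blast
  ultimately show ?thesis
    using assms(3) by blast
qed

text \<open>Degrees are multiplicative, so an extension of prime degree has no proper intermediate field.\<close>

lemma prime_degree_primitive:
  fixes K :: "'a::field_char_0 set"
  assumes alg: "\<And>x::'a. algebraic x" and K: "number_field K"
    and prime: "Factorial_Ring.prime (Qbar.dim \<rat> K)"
  obtains x where "x \<in> K" "Qbar.simple_extension \<rat> x = K"
proof -
  have sub: "subfield K Qbar" and fin: "Qbar.finite_dimension \<rat> K"
    using K unfolding number_field_def by auto
  have "Qbar.dimension 1 \<rat> (\<rat> :: 'a set)"
    using Qbar.dimension_one[OF subfield_Rats] .
  then have "K \<noteq> \<rat>"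
    using Qbar.dimI[OF subfield_Rats] prime unfolding over_def by (metis not_prime_1)
  then obtain x where x: "x \<in> K" "x \<notin> \<rat>"
    using subfield_closed(4)[OF sub] by blast
  define F where "F = Qbar.simple_extension \<rat> x"
  have algx: "Qbar.algebraic \<rat> x"
    using Qbar_algebraic[OF alg subfield_Rats] .
  have F: "subfield F Qbar" "\<rat> \<subseteq> F" "x \<in> F" "F \<subseteq> K"
    unfolding F_def
    using Qbar.simple_extension_is_subfield[OF subfield_Rats] Qbar.simple_extension_incl
      Qbar.simple_extension_mem[OF subfieldE(1)[OF subfield_Rats]]
      Qbar.simple_extension_subring_incl[OF subfieldE(1)[OF sub] subfield_closed(4)[OF sub] x(1)] algx
    by (auto simp: over_def)
  have finF: "Qbar.finite_dimension \<rat> F"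
    unfolding F_def using Qbar.finite_dimension_simple_extension[OF subfield_Rats, of x] algx
    by (simp add: over_def)
  have subalgebra_mono: "subalgebra A E Qbar" if "subalgebra B E Qbar" "A \<subseteq> B" for A B E :: "'a set"
    using that unfolding subalgebra_def subalgebra_axioms_def by blast
  have KK: "subalgebra F K Qbar"
    by (rule subalgebra_mono[OF _ F(4)])
      (rule Qbar.finite_dimension_imp_subalgebra[OF sub Qbar.finite_dimensionI[OF Qbar.dimension_one[OF sub]]])
  obtain n where n: "Qbar.dimension n \<rat> K"
    using fin by auto
  obtain Us where Us: "Qbar.Span \<rat> Us = K"
    using Qbar.exists_base[OF subfield_Rats n] by blast
  have UsU: "set Us \<subseteq> carrier Qbar"
    by simp
  have UsK: "set Us \<subseteq> K"
    using Qbar.Span_base_incl[OF subfield_Rats UsU] unfolding Us .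
  have "K \<subseteq> Qbar.Span F Us"
    using Qbar.subalgebra_Span_incl[OF subfield_Rats
        subalgebra_mono[OF Qbar.Span_is_subalgebra[OF F(1) UsU] F(2)] Qbar.Span_base_incl[OF F(1) UsU]]
    unfolding Us .
  then have "Qbar.Span F Us = K"
    using Qbar.subalgebra_Span_incl[OF F(1) KK UsK] by blast
  then have finK: "Qbar.finite_dimension F K"
    using Qbar.Span_finite_dimension[OF F(1) UsU] by simp
  have "Qbar.dim \<rat> K = Qbar.dim \<rat> F * Qbar.dim F K"
    using Qbar.telescopic_base_dim(2)[OF subfield_Rats F(1) finF finK] by (simp add: over_def)
  then have "Qbar.dim \<rat> F = 1 \<or> Qbar.dim F K = 1"
    using prime prime_product by metis
  moreover have "Qbar.dim \<rat> F \<noteq> 1"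
    using dimension_one_eq[OF subfield_Rats _ F(2)] Qbar.finite_dimensionE[OF subfield_Rats finF] F(3) x(2)
    by (auto simp: over_def)
  ultimately have "Qbar.dimension 1 F K"
    using Qbar.finite_dimensionE[OF F(1) finK] by (simp add: over_def)
  then have "K = F"
    using dimension_one_eq[OF F(1) _ F(4)] by simp
  then show thesis
    using that x(1) unfolding F_def by blast
qed

lemma (in group) image_inv_carrier: "(\<lambda>x. inv x) ` carrier G = carrier G"
proof (intro equalityI subsetI)
  fix x assume "x \<in> carrier G"
  then have "x = inv (inv x)" "inv x \<in> carrier G"
    by auto
  then show "x \<in> (\<lambda>x. inv x) ` carrier G"
    by (rule image_eqI)
qed auto

text \<open>For \<open>K = \<rat>(x)\<close>, both the degree and the index count the conjugates of \<open>x\<close>: the minimal polynomial has all of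
  them as roots, and the polynomial with exactly these roots is rational.\<close>

lemma index_abs_gal:
  fixes K :: "'a::{alg_closed_field, field_char_0} set"
  assumes alg: "\<And>x::'a. algebraic x" and K: "Qbar.simple_extension \<rat> x = K"
  shows "group.index (abs_gal \<rat>) (carrier (abs_gal \<rat>)) (carrier (abs_gal K)) = Qbar.dim \<rat> K"
proof -
  interpret group "abs_gal (\<rat> :: 'a set)"
    by (rule group_abs_gal)
  have algx: "(Qbar.algebraic over \<rat>) x"
    using Qbar_algebraic[OF alg subfield_Rats] by (simp add: over_def)
  have xU: "x \<in> carrier Qbar"
    by simp
  have x_K: "x \<in> K" and Rats_K: "\<rat> \<subseteq> K"
    unfolding K[symmetric]
    using Qbar.simple_extension_mem[OF subfieldE(1)[OF subfield_Rats]] Qbar.simple_extension_incl by auto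
  have fix_K: "\<sigma> y = y" if \<sigma>: "field_automorphism \<sigma>" "\<sigma> x = x" and "y \<in> K" for \<sigma> y
  proof -
    have "subring {y. \<sigma> y = y} Qbar"
      by (rule Qbar.subringI) (use \<sigma> in \<open>auto simp: field_automorphismD Qbar_a_inv\<close>)
    then have "K \<subseteq> {y. \<sigma> y = y}"
      unfolding K[symmetric] using \<sigma> field_automorphism_Rats
      by (intro Qbar.simple_extension_subring_incl) auto
    then show ?thesis
      using \<open>y \<in> K\<close> by auto
  qed
  let ?A = "conjugates x"
  have fin: "finite ?A"
    by (rule finite_conjugates[OF alg])
  define c where "c = (\<Prod>a\<in>?A. [:- a, 1:])"
  have deg_c: "degree c = card ?A" and c0: "c \<noteq> 0"
    unfolding c_def by (simp_all add: degree_prod_eq_sum_degree fin)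
  have rat: "coeff c i \<in> \<rat>" for i
    unfolding c_def by (rule prod_roots_coeff_Rats[OF galois_over_rat_UNIV[OF alg] fin])
      (use conjugates_invariant in auto)
  define n where "n = length (Qbar.Irr \<rat> x) - 1"
  note Irr = Qbar.IrrE[OF subfield_Rats xU algx]
  have "n \<le> card ?A"
  proof -
    have mem: "rev (coeffs c) \<in> carrier (\<rat>[X]\<^bsub>Qbar\<^esub>)"
      by (rule univ_poly_carrier_rev_coeffs) (rule rat)
    moreover have "Qbar.eval (rev (coeffs c)) x = \<zero>\<^bsub>Qbar\<^esub>"
      using poly_prod_roots_eq_0_iff[OF fin] conjugates_self by (simp add: eval_rev c_def)
    ultimately have "n \<le> length (rev (coeffs c)) - 1"
      unfolding n_def using c0
      by (intro Qbar.pdivides_imp_degree_le[OF subfieldE(1)[OF subfield_Rats] Irr(1) mem]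
          Qbar.Irr_minimal[OF subfield_Rats xU algx]) simp_all
    then show ?thesis
      using deg_c c0 by (simp add: length_coeffs_degree)
  qed
  moreover have "card ?A \<le> n"
  proof -
    define q where "q = Poly (rev (Qbar.Irr \<rat> x))"
    have pol: "polynomial\<^bsub>Qbar\<^esub> \<rat> (Qbar.Irr \<rat> x)"
      using Irr(1) unfolding univ_poly_carrier .
    have ne: "Qbar.Irr \<rat> x \<noteq> []"
      using Irr(2) unfolding ring_irreducible_def by (auto simp: univ_poly_zero)
    have "set (rev (Qbar.Irr \<rat> x)) \<subseteq> \<rat>"
      using pol unfolding polynomial_def by auto
    then have q_rat: "coeff q i \<in> \<rat>" for i
      unfolding q_def using nth_mem[of i "rev (Qbar.Irr \<rat> x)"] by (auto simp del: set_rev simp: nth_default_def)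
    have "poly q x = 0"
      using Irr(4) eval_rev[of "rev (Qbar.Irr \<rat> x)" x] by (simp add: q_def)
    then have roots: "?A \<subseteq> {y. poly q y = 0}"
      using poly_automorphism[OF _ q_rat] field_automorphismD(5) by (auto simp: conjugates_def mem_abs_gal)
    have "dropWhile ((=) 0) (Qbar.Irr \<rat> x) = Qbar.Irr \<rat> x"
      using Irr(3) by (cases "Qbar.Irr \<rat> x") auto
    then have "coeffs q = rev (Qbar.Irr \<rat> x)"
      unfolding q_def by simp
    then have "length (Qbar.Irr \<rat> x) = length (coeffs q)" "q \<noteq> 0"
      using ne by auto
    then have "degree q = n" "q \<noteq> 0"
      unfolding n_def by (simp_all add: length_coeffs_degree)
    then show ?thesis
      using card_mono[OF poly_roots_finite roots] card_poly_roots_bound[of q] by linarith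
  qed
  ultimately have "card ?A = Qbar.dim \<rat> K"
    using Qbar.simple_extension_dim[OF subfield_Rats xU algx] unfolding K n_def over_def by simp
  moreover have "index (carrier (abs_gal \<rat>)) (carrier (abs_gal K)) = card ?A"
  proof -
    let ?F = "\<lambda>\<sigma>. carrier (abs_gal K) #>\<^bsub>abs_gal \<rat>\<^esub> \<sigma>"
    have "card (?F ` carrier (abs_gal \<rat>)) = card ((\<lambda>\<sigma>. \<sigma> x) ` carrier (abs_gal \<rat>))"
    proof (rule card_image_transfer)
      show "(\<lambda>\<sigma>. inv\<^bsub>abs_gal \<rat>\<^esub> \<sigma>) ` carrier (abs_gal \<rat>) = carrier (abs_gal (\<rat> :: 'a set))"
        by (rule image_inv_carrier)
    next
      fix \<sigma> \<tau> :: "'a \<Rightarrow> 'a" assume \<sigma>\<tau>: "\<sigma> \<in> carrier (abs_gal \<rat>)" "\<tau> \<in> carrier (abs_gal \<rat>)"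
      let ?\<rho> = "\<sigma> \<otimes>\<^bsub>abs_gal \<rat>\<^esub> inv\<^bsub>abs_gal \<rat>\<^esub> \<tau>"
      have \<rho>: "?\<rho> \<in> carrier (abs_gal \<rat>)"
        using \<sigma>\<tau> by simp
      have "?F \<sigma> = ?F \<tau> \<longleftrightarrow> ?\<rho> \<in> carrier (abs_gal K)"
        by (rule r_coset_eq_iff[OF subgroup_abs_gal_Rats \<sigma>\<tau>])
      also have "\<dots> \<longleftrightarrow> ?\<rho> x = x"
        using \<rho> fix_K[of ?\<rho>] x_K by (auto simp: mem_abs_gal)
      also have "\<dots> \<longleftrightarrow> \<sigma> ((inv\<^bsub>abs_gal \<rat>\<^esub> \<tau>) x) = x"
        using abs_gal_mult_apply[OF \<sigma>\<tau>(1) inv_closed[OF \<sigma>\<tau>(2)]] by simp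
      also have "\<dots> \<longleftrightarrow> (inv\<^bsub>abs_gal \<rat>\<^esub> \<sigma>) x = (inv\<^bsub>abs_gal \<rat>\<^esub> \<tau>) x"
        using abs_gal_inv_apply[OF \<sigma>\<tau>(1)] by metis
      finally show "?F \<sigma> = ?F \<tau> \<longleftrightarrow> (inv\<^bsub>abs_gal \<rat>\<^esub> \<sigma>) x = (inv\<^bsub>abs_gal \<rat>\<^esub> \<tau>) x" .
    qed
    then show ?thesis
      unfolding index_def conjugates_def .
  qed
  ultimately show ?thesis
    by simp
qed

section \<open>The Krull topology and its filtration\<close>

lemma countable_algebraic:
  assumes alg: "\<And>x::'a::field_char_0. algebraic x"
  shows "countable (UNIV :: 'a set)"
proof -
  define Z where "Z = (\<lambda>cs::int list. {x::'a. poly (Poly (map of_int cs)) x = 0})"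
  have "x \<in> (\<Union>cs \<in> {cs. Poly (map of_int cs) \<noteq> (0 :: 'a poly)}. Z cs)" for x :: 'a
  proof -
    obtain p where p: "p \<noteq> 0" "poly (map_poly of_int p) x = 0"
      using algebraicE'[OF alg[of x]] by blast
    have "Poly (map of_int (coeffs p)) = (map_poly of_int p :: 'a poly)"
      by (simp add: map_poly_def)
    moreover have "map_poly of_int p \<noteq> (0 :: 'a poly)"
      using p(1) by (simp add: map_poly_eq_0_iff)
    ultimately show ?thesis
      using p(2) unfolding Z_def by (intro UN_I[of "coeffs p"]) auto
  qed
  then have "UNIV = (\<Union>cs \<in> {cs. Poly (map of_int cs) \<noteq> (0 :: 'a poly)}. Z cs)"
    by blast
  moreover have "countable (\<Union>cs \<in> {cs. Poly (map of_int cs) \<noteq> (0 :: 'a poly)}. Z cs)"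
    unfolding Z_def by (rule countable_UN[OF countableI_type countable_finite[OF poly_roots_finite]]) simp
  ultimately show ?thesis
    by simp
qed

text \<open>Countability makes it possible to replace the finite subextensions by an increasing sequence of finite sets.
  Closing these sets under conjugation makes their pointwise stabilizers normal.\<close>

definition conjugates_upto :: "nat \<Rightarrow> 'a::field_char_0 set"
  where "conjugates_upto n = (\<Union>i<n. conjugates (from_nat_into UNIV i))"

lemma conjugates_upto_finite:
  assumes alg: "\<And>x::'a::field_char_0. algebraic x"
  shows "finite (conjugates_upto n :: 'a set)"
  unfolding conjugates_upto_def using finite_conjugates[OF alg] by blast

lemma conjugates_upto_mono: "m \<le> n \<Longrightarrow> conjugates_upto m \<subseteq> conjugates_upto n"
  unfolding conjugates_upto_def by (intro UN_mono) auto

lemma conjugates_upto_invariant: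
  "\<sigma> \<in> carrier (abs_gal \<rat>) \<Longrightarrow> x \<in> conjugates_upto n \<Longrightarrow> \<sigma> x \<in> conjugates_upto n"
  unfolding conjugates_upto_def using conjugates_invariant by blast

lemma conjugates_upto_exhaust:
  assumes alg: "\<And>x::'a::field_char_0. algebraic x" and "finite A"
  obtains n where "A \<subseteq> (conjugates_upto n :: 'a set)"
proof -
  have "\<exists>n. x \<in> conjugates_upto n" for x :: 'a
  proof -
    obtain i where "x = from_nat_into UNIV i"
      using from_nat_into_surj[OF countable_algebraic[OF alg], of x] by auto
    then have "x \<in> conjugates_upto (Suc i)"
      unfolding conjugates_upto_def using conjugates_self by auto
    then show ?thesis ..
  qed
  then obtain f where f: "\<And>x::'a. x \<in> conjugates_upto (f x)"
    by metis
  have "A \<subseteq> conjugates_upto (Max (f ` A))"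
  proof
    fix x assume "x \<in> A"
    then have "f x \<le> Max (f ` A)"
      using \<open>finite A\<close> by simp
    then show "x \<in> conjugates_upto (Max (f ` A))"
      using f[of x] conjugates_upto_mono by blast
  qed
  then show thesis
    using that by blast
qed

text \<open>These subgroups form a neighbourhood base of \<open>1\<close> for the Krull topology on \<open>Gal(K)\<close>.\<close>

definition gal_nhd :: "'a::field_char_0 set \<Rightarrow> nat \<Rightarrow> ('a \<Rightarrow> 'a) set"
  where "gal_nhd K n = carrier (abs_gal (K \<union> conjugates_upto n))"

lemma mem_gal_nhd: "\<sigma> \<in> gal_nhd K n \<longleftrightarrow> \<sigma> \<in> carrier (abs_gal K) \<and> (\<forall>x\<in>conjugates_upto n. \<sigma> x = x)"
  unfolding gal_nhd_def mem_abs_gal by blast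

lemma gal_nhd_Rats: "gal_nhd K n = carrier (abs_gal K) \<inter> gal_nhd \<rat> n"
  using abs_gal_le_Rats[of K] unfolding set_eq_iff Int_iff mem_gal_nhd by blast

lemma gal_nhd_decreasing: "m \<le> n \<Longrightarrow> gal_nhd K n \<subseteq> gal_nhd K m"
  using conjugates_upto_mono[of m n] unfolding mem_gal_nhd subset_iff by blast

lemma gal_nhd_normal: "gal_nhd K n \<lhd> abs_gal K"
proof -
  interpret group "abs_gal K"
    by (rule group_abs_gal)
  show ?thesis
    unfolding normal_inv_iff
  proof (intro conjI ballI)
    show "subgroup (gal_nhd K n) (abs_gal K)"
      unfolding gal_nhd_def by (rule subgroup_abs_gal) simp
    fix \<sigma> \<tau> assume \<sigma>: "\<sigma> \<in> carrier (abs_gal K)" and \<tau>: "\<tau> \<in> gal_nhd K n"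
    have \<tau>K: "\<tau> \<in> carrier (abs_gal K)"
      using \<tau> by (simp add: mem_gal_nhd)
    have "(\<sigma> \<otimes>\<^bsub>abs_gal K\<^esub> \<tau> \<otimes>\<^bsub>abs_gal K\<^esub> inv\<^bsub>abs_gal K\<^esub> \<sigma>) x = x" if x: "x \<in> conjugates_upto n" for x
    proof -
      have "(inv\<^bsub>abs_gal K\<^esub> \<sigma>) x \<in> conjugates_upto n"
        using conjugates_upto_invariant[OF _ x] inv_closed[OF \<sigma>] abs_gal_le_Rats by blast
      then have "\<tau> ((inv\<^bsub>abs_gal K\<^esub> \<sigma>) x) = (inv\<^bsub>abs_gal K\<^esub> \<sigma>) x"
        using \<tau> by (simp add: mem_gal_nhd)
      then show ?thesis
        using abs_gal_mult_apply[of _ K] \<sigma> \<tau>K abs_gal_inv_apply(2)[OF \<sigma>] by simp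
    qed
    then show "\<sigma> \<otimes>\<^bsub>abs_gal K\<^esub> \<tau> \<otimes>\<^bsub>abs_gal K\<^esub> inv\<^bsub>abs_gal K\<^esub> \<sigma> \<in> gal_nhd K n"
      using \<sigma> \<tau>K by (simp add: mem_gal_nhd)
  qed
qed

lemma gal_nhd_finite_index:
  fixes K :: "'a::field_char_0 set"
  assumes alg: "\<And>x::'a. algebraic x"
  shows "group.index (abs_gal K) (carrier (abs_gal K)) (gal_nhd K n) \<noteq> 0"
proof -
  interpret group "abs_gal K"
    by (rule group_abs_gal)
  let ?C = "conjugates_upto n :: 'a set"
  let ?F = "\<lambda>\<sigma>. gal_nhd K n #>\<^bsub>abs_gal K\<^esub> \<sigma>"
  have "index (carrier (abs_gal K)) (gal_nhd K n) = card ((\<lambda>\<sigma>. restrict \<sigma> ?C) ` carrier (abs_gal K))"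
    unfolding index_def
  proof (rule card_image_transfer)
    show "(\<lambda>\<sigma>. inv\<^bsub>abs_gal K\<^esub> \<sigma>) ` carrier (abs_gal K) = carrier (abs_gal K)"
      by (rule image_inv_carrier)
    fix \<sigma> \<tau> assume \<sigma>\<tau>: "\<sigma> \<in> carrier (abs_gal K)" "\<tau> \<in> carrier (abs_gal K)"
    let ?\<rho> = "\<sigma> \<otimes>\<^bsub>abs_gal K\<^esub> inv\<^bsub>abs_gal K\<^esub> \<tau>"
    have "?F \<sigma> = ?F \<tau> \<longleftrightarrow> ?\<rho> \<in> gal_nhd K n"
      by (rule r_coset_eq_iff[OF normal_imp_subgroup[OF gal_nhd_normal] \<sigma>\<tau>])
    also have "\<dots> \<longleftrightarrow> (\<forall>x\<in>?C. \<sigma> ((inv\<^bsub>abs_gal K\<^esub> \<tau>) x) = x)"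
      using \<sigma>\<tau> abs_gal_mult_apply[OF \<sigma>\<tau>(1) inv_closed[OF \<sigma>\<tau>(2)]] by (simp add: mem_gal_nhd)
    also have "\<dots> \<longleftrightarrow> (\<forall>x\<in>?C. (inv\<^bsub>abs_gal K\<^esub> \<sigma>) x = (inv\<^bsub>abs_gal K\<^esub> \<tau>) x)"
      using abs_gal_inv_apply[OF \<sigma>\<tau>(1)] by metis
    finally show "?F \<sigma> = ?F \<tau> \<longleftrightarrow> restrict (inv\<^bsub>abs_gal K\<^esub> \<sigma>) ?C = restrict (inv\<^bsub>abs_gal K\<^esub> \<tau>) ?C"
      by (auto simp: restrict_def fun_eq_iff)
  qed
  moreover have "finite ((\<lambda>\<sigma>. restrict \<sigma> ?C) ` carrier (abs_gal K))"
  proof (rule finite_subset)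
    show "(\<lambda>\<sigma>. restrict \<sigma> ?C) ` carrier (abs_gal K) \<subseteq> ?C \<rightarrow>\<^sub>E ?C"
      using conjugates_upto_invariant abs_gal_le_Rats by fastforce
    show "finite (?C \<rightarrow>\<^sub>E ?C)"
      using conjugates_upto_finite[OF alg] by (intro finite_PiE)
  qed
  ultimately show ?thesis
    using one_closed by (auto simp: card_eq_0_iff)
qed

text \<open>A coherent sequence of automorphisms is eventually constant at every element. Its pointwise limit is onto
  because on each finite invariant set it agrees with a member of the sequence.\<close>

lemma gal_nhd_complete:
  fixes g :: "nat \<Rightarrow> 'a::field_char_0 \<Rightarrow> 'a"
  assumes alg: "\<And>x::'a. algebraic x"
    and g: "\<And>n. g n \<in> carrier (abs_gal K)"
    and coherent: "\<And>n. inv\<^bsub>abs_gal K\<^esub> (g n) \<otimes>\<^bsub>abs_gal K\<^esub> g (Suc n) \<in> gal_nhd K n"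
  shows "\<exists>\<sigma>\<in>carrier (abs_gal K). \<forall>n. inv\<^bsub>abs_gal K\<^esub> (g n) \<otimes>\<^bsub>abs_gal K\<^esub> \<sigma> \<in> gal_nhd K n"
proof -
  interpret group "abs_gal K"
    by (rule group_abs_gal)
  let ?C = "conjugates_upto :: nat \<Rightarrow> 'a set"
  have aut: "field_automorphism (g n)" for n
    using g[of n] by (simp add: mem_abs_gal)
  have step: "g (Suc n) x = g n x" if "x \<in> ?C n" for n x
  proof -
    have "(inv\<^bsub>abs_gal K\<^esub> (g n)) (g (Suc n) x) = x"
      using coherent[of n] that abs_gal_mult_apply[OF inv_closed[OF g] g] by (simp add: mem_gal_nhd)
    then show ?thesis
      using abs_gal_inv_apply(2)[OF g[of n], of "g (Suc n) x"] by simp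
  qed
  have const: "g n x = g m x" if "x \<in> ?C m" "m \<le> n" for m n x
    using that(2)
  proof (induction n rule: dec_induct)
    case (step n)
    then show ?case
      using \<open>\<And>n x. x \<in> ?C n \<Longrightarrow> g (Suc n) x = g n x\<close>[of x n] conjugates_upto_mono[of m n] that(1) by auto
  qed simp
  define N where "N = (\<lambda>x. SOME n. x \<in> ?C n)"
  have N: "x \<in> ?C (N x)" for x
    unfolding N_def
  proof (rule someI_ex)
    show "\<exists>n. x \<in> ?C n"
      by (rule conjugates_upto_exhaust[OF alg, of "{x}"]) auto
  qed
  define \<sigma> where "\<sigma> = (\<lambda>x. g (N x) x)"
  have \<sigma>: "\<sigma> x = g n x" if "x \<in> ?C n" for x n
    unfolding \<sigma>_def using const[OF N, of x "max n (N x)"] const[OF that, of "max n (N x)"] by simp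
  have common: "\<exists>n. {x, y, z} \<subseteq> ?C n" for x y z
    by (rule conjugates_upto_exhaust[OF alg, of "{x, y, z}"]) auto
  have "field_automorphism \<sigma>"
    unfolding field_automorphism_def bij_def
  proof (intro conjI allI)
    show "inj \<sigma>"
    proof (rule injI)
      fix x y assume eq: "\<sigma> x = \<sigma> y"
      obtain n where "{x, y, y} \<subseteq> ?C n"
        using common by blast
      then show "x = y"
        using eq \<sigma> injD[OF bij_is_inj[OF field_automorphismD(1)[OF aut[of n]]]] by auto
    qed
    have "y \<in> range \<sigma>" for y
    proof -
      have "g (N y) ` ?C (N y) = ?C (N y)"
      proof (rule endo_inj_surj[OF conjugates_upto_finite[OF alg]])
        show "g (N y) ` ?C (N y) \<subseteq> ?C (N y)"
          using conjugates_upto_invariant g abs_gal_le_Rats by blast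
        show "inj_on (g (N y)) (?C (N y))"
          using bij_is_inj[OF field_automorphismD(1)[OF aut]] inj_on_subset by blast
      qed
      then obtain x where "x \<in> ?C (N y)" "y = g (N y) x"
        using N[of y] by blast
      then show ?thesis
        using \<sigma> by (metis rangeI)
    qed
    then show "surj \<sigma>"
      by blast
    show "\<sigma> 1 = 1"
      unfolding \<sigma>_def using field_automorphismD(2)[OF aut] by simp
    fix x y
    obtain n where "{x, y, x + y} \<subseteq> ?C n"
      using common by blast
    then show "\<sigma> (x + y) = \<sigma> x + \<sigma> y"
      using \<sigma>[of x n] \<sigma>[of y n] \<sigma>[of "x + y" n] field_automorphismD(3)[OF aut] by simp
    obtain n where "{x, y, x * y} \<subseteq> ?C n"
      using common by blast
    then show "\<sigma> (x * y) = \<sigma> x * \<sigma> y"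
      using \<sigma>[of x n] \<sigma>[of y n] \<sigma>[of "x * y" n] field_automorphismD(4)[OF aut] by simp
  qed
  then have \<sigma>K: "\<sigma> \<in> carrier (abs_gal K)"
    using g unfolding mem_abs_gal \<sigma>_def by simp
  have "inv\<^bsub>abs_gal K\<^esub> (g n) \<otimes>\<^bsub>abs_gal K\<^esub> \<sigma> \<in> gal_nhd K n" for n
    unfolding mem_gal_nhd
    using m_closed[OF inv_closed[OF g] \<sigma>K] abs_gal_mult_apply[OF inv_closed[OF g] \<sigma>K] abs_gal_inv_apply(1)[OF g] \<sigma>
    by simp
  then show ?thesis
    using \<sigma>K by blast
qed

lemma conjugates_upto_finite_extension:
  fixes K :: "'a::field_char_0 set"
  assumes alg: "\<And>x::'a. algebraic x" and K: "subfield K Qbar"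
  obtains F where "subfield F Qbar" "K \<subseteq> F" "Qbar.finite_dimension K F" "carrier (abs_gal F) \<subseteq> gal_nhd K n"
proof -
  obtain xs where xs: "set xs = (conjugates_upto n :: 'a set)"
    using finite_list[OF conjugates_upto_finite[OF alg]] by blast
  have xsU: "set xs \<subseteq> carrier Qbar"
    by simp
  have algK: "(Qbar.algebraic over K) x" for x
    using Qbar_algebraic[OF alg K] by (simp add: over_def)
  define F where "F = Qbar.finite_extension K xs"
  have "subfield F Qbar"
    unfolding F_def by (rule Qbar.finite_extension_is_subfield[OF K xsU algK])
  moreover have KF: "K \<subseteq> F"
    unfolding F_def by (rule Qbar.finite_extension_incl[OF _ xsU]) simp
  moreover have "Qbar.finite_dimension K F"
    unfolding F_def by (rule Qbar.finite_extension_finite_dimension(1)[OF K xsU algK])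
  moreover have "conjugates_upto n \<subseteq> F"
    unfolding F_def xs[symmetric] by (rule Qbar.finite_extension_mem[OF subfieldE(1)[OF K] xsU])
  ultimately show thesis
    using that[of F] abs_gal_antimono[of "K \<union> conjugates_upto n" F] unfolding gal_nhd_def by simp
qed

lemma finite_extension_gal_nhd:
  fixes K F :: "'a::field_char_0 set"
  assumes alg: "\<And>x::'a. algebraic x" and K: "subfield K Qbar" and "Qbar.finite_dimension K F"
  obtains n where "gal_nhd K n \<subseteq> carrier (abs_gal F)"
proof -
  obtain d where "Qbar.dimension d K F"
    using assms(3) by auto
  then obtain Us where Us: "Qbar.Span K Us = F"
    using Qbar.exists_base[OF K] by blast
  obtain n where n: "set Us \<subseteq> conjugates_upto n"
    using conjugates_upto_exhaust[OF alg, of "set Us"] by blast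
  have "\<sigma> \<in> carrier (abs_gal F)" if \<sigma>: "\<sigma> \<in> gal_nhd K n" for \<sigma>
  proof -
    have aut: "field_automorphism \<sigma>" and fixK: "\<And>x. x \<in> K \<Longrightarrow> \<sigma> x = x"
      using \<sigma> unfolding mem_gal_nhd mem_abs_gal by auto
    have "subring {x. \<sigma> x = x} Qbar"
      by (rule Qbar.subringI) (use aut in \<open>auto simp: field_automorphismD Qbar_a_inv\<close>)
    then have "subalgebra K {x. \<sigma> x = x} Qbar"
      using fixK field_automorphismD(4)[OF aut]
      unfolding subalgebra_def subalgebra_axioms_def subring_def by auto
    then have "F \<subseteq> {x. \<sigma> x = x}"
      unfolding Us[symmetric]
      by (rule Qbar.subalgebra_Span_incl[OF K]) (use n \<sigma> in \<open>auto simp: mem_gal_nhd\<close>)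
    then show ?thesis
      using aut by (auto simp: mem_abs_gal)
  qed
  then show thesis
    using that by blast
qed

lemma topspace_krull_topology:
  fixes K :: "'a::field_char_0 set"
  assumes K: "subfield K Qbar"
  shows "topspace (krull_topology K) = carrier (abs_gal K)"
proof -
  interpret group "abs_gal K"
    by (rule group_abs_gal)
  have "\<sigma> <#\<^bsub>abs_gal K\<^esub> carrier (abs_gal F) \<subseteq> carrier (abs_gal K)"
    if "\<sigma> \<in> carrier (abs_gal K)" "K \<subseteq> F" for \<sigma> F
    using l_coset_subset_G[OF abs_gal_antimono[OF that(2)] that(1)] .
  moreover have "\<sigma> \<in> \<sigma> <#\<^bsub>abs_gal K\<^esub> carrier (abs_gal K)" if "\<sigma> \<in> carrier (abs_gal K)" for \<sigma>
    using that unfolding l_coset_def by force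
  moreover have "Qbar.finite_dimension K K"
    using Qbar.finite_dimensionI[OF Qbar.dimension_one[OF K]] .
  ultimately show ?thesis
    unfolding krull_topology_def topology_generated_by_topspace using K by blast
qed

lemma openin_krull_topologyI:
  fixes K :: "'a::field_char_0 set"
  assumes alg: "\<And>x::'a. algebraic x" and K: "subfield K Qbar" and "A \<subseteq> carrier (abs_gal K)"
    and nhd: "\<And>\<sigma>. \<sigma> \<in> A \<Longrightarrow> \<exists>n. \<sigma> <#\<^bsub>abs_gal K\<^esub> gal_nhd K n \<subseteq> A"
  shows "openin (krull_topology K) A"
proof (subst openin_subopen, intro ballI)
  interpret group "abs_gal K"
    by (rule group_abs_gal)
  fix \<sigma> assume \<sigma>: "\<sigma> \<in> A"
  then obtain n where n: "\<sigma> <#\<^bsub>abs_gal K\<^esub> gal_nhd K n \<subseteq> A"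
    using nhd by blast
  obtain F where F: "subfield F Qbar" "K \<subseteq> F" "Qbar.finite_dimension K F" "carrier (abs_gal F) \<subseteq> gal_nhd K n"
    using conjugates_upto_finite_extension[OF alg K] by blast
  let ?T = "\<sigma> <#\<^bsub>abs_gal K\<^esub> carrier (abs_gal F)"
  have \<sigma>K: "\<sigma> \<in> carrier (abs_gal K)"
    using \<sigma> assms(3) by blast
  have "openin (krull_topology K) ?T"
    unfolding krull_topology_def by (rule topology_generated_by_Basis) (use \<sigma>K F in blast)
  moreover have "\<one>\<^bsub>abs_gal K\<^esub> \<in> carrier (abs_gal F)"
    using subgroup.one_closed[OF subgroup_abs_gal[OF F(2)]] .
  then have "\<sigma> \<in> ?T"
    using r_one[OF \<sigma>K] unfolding l_coset_def by force
  moreover have "?T \<subseteq> A"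
    using n F(4) unfolding l_coset_def by blast
  ultimately show "\<exists>T. openin (krull_topology K) T \<and> \<sigma> \<in> T \<and> T \<subseteq> A"
    by blast
qed

lemma openin_krull_topologyD:
  fixes K :: "'a::field_char_0 set"
  assumes alg: "\<And>x::'a. algebraic x" and K: "subfield K Qbar"
    and "openin (krull_topology K) A" and "\<one>\<^bsub>abs_gal K\<^esub> \<in> A"
  shows "\<exists>n. gal_nhd K n \<subseteq> A"
proof -
  interpret group "abs_gal K"
    by (rule group_abs_gal)
  let ?B = "{\<sigma> <#\<^bsub>abs_gal K\<^esub> carrier (abs_gal F) | \<sigma> F.
       \<sigma> \<in> carrier (abs_gal K) \<and> subfield F Qbar \<and> K \<subseteq> F \<and> Qbar.finite_dimension K F}"
  have "generate_topology_on ?B A"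
    using openin_topology_generated_by assms(3) unfolding krull_topology_def by blast
  then show ?thesis
    using assms(4)
  proof (induction rule: generate_topology_on.induct)
    case (Int A B)
    then obtain m n where "gal_nhd K m \<subseteq> A" "gal_nhd K n \<subseteq> B"
      by blast
    then have "gal_nhd K (max m n) \<subseteq> A \<inter> B"
      using gal_nhd_decreasing[of m "max m n" K] gal_nhd_decreasing[of n "max m n" K] by auto
    then show ?case
      by blast
  next
    case (UN \<A>)
    then show ?case
      by (meson Union_iff Union_upper subset_trans)
  next
    case (Basis A)
    then obtain \<sigma> F where F: "A = \<sigma> <#\<^bsub>abs_gal K\<^esub> carrier (abs_gal F)" "\<sigma> \<in> carrier (abs_gal K)"
      "K \<subseteq> F" "Qbar.finite_dimension K F"
      by blast
    note sub = subgroup_abs_gal[OF F(3)]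
    obtain \<tau> where \<tau>: "\<tau> \<in> carrier (abs_gal F)" "\<one>\<^bsub>abs_gal K\<^esub> = \<sigma> \<otimes>\<^bsub>abs_gal K\<^esub> \<tau>"
      using Basis.prems unfolding F(1) l_coset_def by blast
    then have "\<sigma> = inv\<^bsub>abs_gal K\<^esub> \<tau>"
      using inv_equality[of \<sigma> \<tau>] F(2) subgroup.mem_carrier[OF sub] by simp
    then have "\<sigma> \<in> carrier (abs_gal F)"
      using subgroup.m_inv_closed[OF sub \<tau>(1)] by simp
    then have "A = carrier (abs_gal F)"
      unfolding F(1) using coset_join3[OF F(2) sub] by blast
    then show ?case
      by (metis finite_extension_gal_nhd[OF alg K F(4)])
  qed auto
qed

text \<open>A Sylow subgroup of the filtered group is one for the Krull topology: it is an intersection of unions of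
  cosets of open subgroups, hence closed, and every open normal subgroup contains a member of the filtration.\<close>

theorem exists_sylow_subgroup_abs_gal:
  fixes K :: "'a::field_char_0 set"
  assumes alg: "\<And>x::'a. algebraic x" and K: "subfield K Qbar" and p: "Factorial_Ring.prime p"
  obtains P where "sylow_subgroup p (abs_gal K) (krull_topology K) P"
proof -
  interpret group "abs_gal K"
    by (rule group_abs_gal)
  let ?U = "gal_nhd K"
  let ?V = "carrier (abs_gal K)"
  obtain P where P: "subgroup P (abs_gal K)" "P = (\<Inter>n. ?U n <#>\<^bsub>abs_gal K\<^esub> P)"
    and Pp: "\<And>n. \<exists>k. index P (?U n \<inter> P) = p ^ k"
    and Pi: "\<And>n. \<not> p dvd index ?V (?U n <#>\<^bsub>abs_gal K\<^esub> P)"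
    by (rule exists_sylow_filtration[of ?U p, OF gal_nhd_normal gal_nhd_decreasing[OF le_SucI[OF order_refl]]
          gal_nhd_finite_index[OF alg] gal_nhd_complete[OF alg] p]) blast+
  have U: "subgroup (?U n) (abs_gal K)" for n
    using normal_imp_subgroup[OF gal_nhd_normal] .
  have PV: "P \<subseteq> ?V"
    using subgroup.subset[OF P(1)] .
  have closed: "closedin (krull_topology K) P"
    unfolding closedin_def topspace_krull_topology[OF K]
  proof (intro conjI PV openin_krull_topologyI[OF alg K])
    fix \<sigma> assume \<sigma>: "\<sigma> \<in> ?V - P"
    then obtain n where n: "\<sigma> \<notin> ?U n <#>\<^bsub>abs_gal K\<^esub> P"
      using P(2) by blast
    have "\<sigma> \<otimes>\<^bsub>abs_gal K\<^esub> \<tau> \<in> ?V - P" if \<tau>: "\<tau> \<in> ?U n" for \<tau>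
    proof -
      have \<tau>V: "\<tau> \<in> ?V"
        using subgroup.mem_carrier[OF U \<tau>] .
      have "\<sigma> \<otimes>\<^bsub>abs_gal K\<^esub> \<tau> \<notin> P"
      proof
        assume in_P: "\<sigma> \<otimes>\<^bsub>abs_gal K\<^esub> \<tau> \<in> P"
        have "\<sigma> = \<sigma> \<otimes>\<^bsub>abs_gal K\<^esub> \<tau> \<otimes>\<^bsub>abs_gal K\<^esub> inv\<^bsub>abs_gal K\<^esub> \<tau>"
          using \<sigma> \<tau>V by (simp add: m_assoc)
        then have "\<sigma> \<in> P <#>\<^bsub>abs_gal K\<^esub> ?U n"
          using in_P subgroup.m_inv_closed[OF U \<tau>] unfolding set_mult_def by blast
        then show False
          using n commut_normal[OF P(1) gal_nhd_normal] by simp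
      qed
      then show ?thesis
        using \<sigma> \<tau>V by simp
    qed
    then show "\<exists>n. \<sigma> <#\<^bsub>abs_gal K\<^esub> ?U n \<subseteq> ?V - P"
      unfolding l_coset_def by blast
  qed auto
  have "pro_p_group p (abs_gal K\<lparr>carrier := P\<rparr>) (subtopology (krull_topology K) P)"
    unfolding pro_p_group_def
  proof (intro allI impI, elim conjE)
    fix N assume N: "N \<lhd> abs_gal K\<lparr>carrier := P\<rparr>" and "openin (subtopology (krull_topology K) P) N"
    then obtain A where A: "openin (krull_topology K) A" "N = A \<inter> P"
      unfolding openin_subtopology by blast
    have NS: "subgroup N (abs_gal K)"
      using incl_subgroup[OF P(1) normal_imp_subgroup[OF N]] .
    obtain n where "?U n \<subseteq> A"
      using openin_krull_topologyD[OF alg K A(1)] subgroup.one_closed[OF NS] A(2) by blast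
    then have sub: "?U n \<inter> P \<subseteq> N"
      using A(2) by blast
    have "Coset.order (abs_gal K\<lparr>carrier := P\<rparr> Mod N) = index P N"
      unfolding Coset.order_def carrier_FactGroup index_def by (simp add: r_coset_def)
    also have "index P N dvd index P (?U n \<inter> P)"
      using index_mult[OF P(1) NS subgroups_Inter_pair[OF U P(1)] _ sub] A(2) by simp
    finally show "\<exists>k. Coset.order (abs_gal K\<lparr>carrier := P\<rparr> Mod N) = p ^ k"
      using Pp[of n] divides_primepow_nat[OF p] by metis
  qed
  moreover have "\<not> p dvd card (rcosets\<^bsub>abs_gal K\<^esub> (P <#>\<^bsub>abs_gal K\<^esub> N))"
    if N: "N \<lhd> abs_gal K" "openin (krull_topology K) N" for N
  proof -
    obtain n where n: "?U n \<subseteq> N"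
      using openin_krull_topologyD[OF alg K N(2)] subgroup.one_closed[OF normal_imp_subgroup[OF N(1)]] by blast
    have "?U n <#>\<^bsub>abs_gal K\<^esub> P \<subseteq> N <#>\<^bsub>abs_gal K\<^esub> P"
      using mono_set_mult[OF n subset_refl] .
    then have "index ?V (N <#>\<^bsub>abs_gal K\<^esub> P) dvd index ?V (?U n <#>\<^bsub>abs_gal K\<^esub> P)"
      using index_mult[OF subgroup_self subgroup_normal_mult(1)[OF N(1) P(1)] subgroup_normal_mult(1)[OF gal_nhd_normal P(1)]]
        subgroup.subset[OF subgroup_normal_mult(1)[OF N(1) P(1)]] by simp
    then show ?thesis
      using Pi[of n] dvd_trans unfolding index_rcosets subgroup_normal_mult(4)[OF N(1) P(1)] by blast
  qed
  ultimately show thesis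
    using that P(1) closed unfolding sylow_subgroup_def by blast
qed

section \<open>Sylow-conjugate fields of prime degree\<close>

lemma gal_nhd_eq_Rats:
  assumes "gal_nhd \<rat> n \<subseteq> carrier (abs_gal K)"
  shows "gal_nhd K n = gal_nhd \<rat> n"
  using assms gal_nhd_Rats[of K n] by blast

text \<open>A member of the filtration of \<open>Gal(\<rat>)\<close> that lies in \<open>Gal(K)\<close> is an open normal subgroup of \<open>Gal(K)\<close>, so
  the definition of a Sylow subgroup applies to it.\<close>

lemma sylow_subgroup_index:
  fixes K :: "'a::field_char_0 set"
  assumes alg: "\<And>x::'a. algebraic x" and K: "subfield K Qbar"
    and n: "gal_nhd \<rat> n \<subseteq> carrier (abs_gal K)"
    and P: "sylow_subgroup p (abs_gal K) (krull_topology K) P"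
  shows "subgroup P (abs_gal \<rat>)" "P \<subseteq> carrier (abs_gal K)"
    and "\<not> p dvd group.index (abs_gal \<rat>) (carrier (abs_gal K)) (gal_nhd \<rat> n <#>\<^bsub>abs_gal \<rat>\<^esub> P)"
proof -
  interpret \<Gamma>: group "abs_gal (\<rat> :: 'a set)"
    by (rule group_abs_gal)
  interpret V: group "abs_gal K"
    by (rule group_abs_gal)
  have upd: "abs_gal K = (abs_gal \<rat>)\<lparr>carrier := carrier (abs_gal K)\<rparr>"
    by (rule abs_gal_carrier_update)
  have PV: "subgroup P (abs_gal K)"
    using P unfolding sylow_subgroup_def by simp
  then show sub: "P \<subseteq> carrier (abs_gal K)"
    by (rule subgroup.subset)
  show "subgroup P (abs_gal \<rat>)"
    by (rule \<Gamma>.incl_subgroup[OF subgroup_abs_gal_Rats[of K]]) (simp only: PV upd[symmetric])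
  have N: "gal_nhd \<rat> n \<lhd> abs_gal K"
    using gal_nhd_normal[of K n] unfolding gal_nhd_eq_Rats[OF n] .
  have "openin (krull_topology K) (gal_nhd \<rat> n)"
  proof (rule openin_krull_topologyI[OF alg K n])
    fix \<sigma> :: "'a \<Rightarrow> 'a" assume \<sigma>: "\<sigma> \<in> gal_nhd \<rat> n"
    have "\<sigma> <#\<^bsub>abs_gal K\<^esub> gal_nhd \<rat> n = gal_nhd \<rat> n"
      using V.coset_join3[OF _ normal_imp_subgroup[OF N] \<sigma>] n \<sigma> by blast
    then show "\<exists>m. \<sigma> <#\<^bsub>abs_gal K\<^esub> gal_nhd K m \<subseteq> gal_nhd \<rat> n"
      using gal_nhd_eq_Rats[OF n] by (metis order_refl)
  qed
  then have "\<not> p dvd card (rcosets\<^bsub>abs_gal K\<^esub> (P <#>\<^bsub>abs_gal K\<^esub> gal_nhd \<rat> n))"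
    using P N unfolding sylow_subgroup_def by blast
  moreover have "P <#>\<^bsub>abs_gal K\<^esub> gal_nhd \<rat> n = gal_nhd \<rat> n <#>\<^bsub>abs_gal K\<^esub> P"
    by (rule V.commut_normal[OF PV N])
  moreover have "gal_nhd \<rat> n <#>\<^bsub>abs_gal K\<^esub> P = gal_nhd \<rat> n <#>\<^bsub>abs_gal \<rat>\<^esub> P"
    by (subst upd) (simp add: set_mult_def)
  moreover have "card (rcosets\<^bsub>abs_gal K\<^esub> B) = \<Gamma>.index (carrier (abs_gal K)) B" for B
  proof -
    have "rcosets\<^bsub>abs_gal K\<^esub> B = (\<lambda>\<sigma>. B #>\<^bsub>abs_gal \<rat>\<^esub> \<sigma>) ` carrier (abs_gal K)"
      unfolding RCOSETS_def by (subst upd) (auto simp: r_coset_def)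
    then show ?thesis
      by (simp add: \<Gamma>.index_def)
  qed
  ultimately show "\<not> p dvd \<Gamma>.index (carrier (abs_gal K)) (gal_nhd \<rat> n <#>\<^bsub>abs_gal \<rat>\<^esub> P)"
    by simp
qed

text \<open>By Galois theory, \<open>K\<close> is the fixed field of \<open>Gal(K)\<close>; so an automorphism that conjugates \<open>Gal(L)\<close> to
  \<open>Gal(K)\<close> maps \<open>L\<close> onto \<open>K\<close>.\<close>

lemma conjugate_abs_gal_isomorphic:
  fixes K L :: "'a::{alg_closed_field, field_char_0} set"
  assumes alg: "\<And>x::'a. algebraic x" and K: "subfield K Qbar" and L: "subfield L Qbar"
    and g: "g \<in> carrier (abs_gal \<rat>)"
    and conj: "(\<lambda>\<sigma>. g \<otimes>\<^bsub>abs_gal \<rat>\<^esub> \<sigma> \<otimes>\<^bsub>abs_gal \<rat>\<^esub> inv\<^bsub>abs_gal \<rat>\<^esub> g) ` carrier (abs_gal L) = carrier (abs_gal K)"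
  shows "is_ring_iso (Qbar\<lparr>carrier := K\<rparr>) (Qbar\<lparr>carrier := L\<rparr>)"
proof -
  interpret \<Gamma>: group "abs_gal (\<rat> :: 'a set)"
    by (rule group_abs_gal)
  let ?i = "inv\<^bsub>abs_gal \<rat>\<^esub> g"
  have i: "?i \<in> carrier (abs_gal \<rat>)"
    using g by simp
  have gi: "g (?i x) = x" "?i (g x) = x" for x
    using abs_gal_inv_apply[OF g] by auto
  have conj_apply: "(g \<otimes>\<^bsub>abs_gal \<rat>\<^esub> \<sigma> \<otimes>\<^bsub>abs_gal \<rat>\<^esub> ?i) x = g (\<sigma> (?i x))"
    if "\<sigma> \<in> carrier (abs_gal \<rat>)" for \<sigma> x
    using abs_gal_mult_apply[OF \<Gamma>.m_closed[OF g that] i] abs_gal_mult_apply[OF g that] by simp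
  have "g x \<in> K" if x: "x \<in> L" for x
  proof (rule fixed_by_abs_gal[OF alg K])
    fix \<sigma> assume "\<sigma> \<in> carrier (abs_gal K)"
    then obtain \<tau> where \<tau>: "\<tau> \<in> carrier (abs_gal L)" "\<sigma> = g \<otimes>\<^bsub>abs_gal \<rat>\<^esub> \<tau> \<otimes>\<^bsub>abs_gal \<rat>\<^esub> ?i"
      unfolding conj[symmetric] by blast
    have "\<tau> x = x"
      using \<tau>(1) x by (simp add: mem_abs_gal)
    then show "\<sigma> (g x) = g x"
      unfolding \<tau>(2) using conj_apply[OF subsetD[OF abs_gal_le_Rats \<tau>(1)]] gi by simp
  qed
  moreover have i_L: "?i y \<in> L" if y: "y \<in> K" for y
  proof (rule fixed_by_abs_gal[OF alg L])
    fix \<tau> assume \<tau>: "\<tau> \<in> carrier (abs_gal L)"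
    have "g \<otimes>\<^bsub>abs_gal \<rat>\<^esub> \<tau> \<otimes>\<^bsub>abs_gal \<rat>\<^esub> ?i \<in> carrier (abs_gal K)"
      unfolding conj[symmetric] using \<tau> by blast
    then have "g (\<tau> (?i y)) = y"
      using y conj_apply[OF subsetD[OF abs_gal_le_Rats \<tau>]] by (auto simp: mem_abs_gal)
    then show "\<tau> (?i y) = ?i y"
      using gi(2) by metis
  qed
  ultimately have "bij_betw ?i K L"
    by (intro bij_betw_byWitness[where f' = g]) (use gi in auto)
  moreover have "field_automorphism ?i"
    using i by (simp add: mem_abs_gal)
  ultimately have "?i \<in> ring_iso (Qbar\<lparr>carrier := K\<rparr>) (Qbar\<lparr>carrier := L\<rparr>)"
    unfolding ring_iso_def ring_hom_def using i_L by (auto simp: field_automorphismD)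
  then show ?thesis
    unfolding is_ring_iso_def by blast
qed

theorem corollary3p2:
  fixes K L :: "'a::{alg_closed_field, field_char_0} set"
  assumes "\<And>x::'a. algebraic x"
    and "number_field K" and "number_field L"
    and "sylow_conjugate K L"
    and "Factorial_Ring.prime (ring.dim (Qbar :: 'a ring) \<rat> K)"
    and "Factorial_Ring.prime (ring.dim (Qbar :: 'a ring) \<rat> L)"
    and "solvable (gal (galois_closure K) \<rat>)"
  shows "is_ring_iso (Qbar\<lparr>carrier := K\<rparr>) (Qbar\<lparr>carrier := L\<rparr>)"
proof -
  note alg = assms(1)
  interpret \<Gamma>: group "abs_gal (\<rat> :: 'a set)"
    by (rule group_abs_gal)
  have K: "subfield K Qbar" "Qbar.finite_dimension \<rat> K" and L: "subfield L Qbar" "Qbar.finite_dimension \<rat> L"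
    using assms(2,3) unfolding number_field_def by auto
  obtain k l where "gal_nhd \<rat> k \<subseteq> carrier (abs_gal K)" "gal_nhd \<rat> l \<subseteq> carrier (abs_gal L)"
    using finite_extension_gal_nhd[OF alg subfield_Rats K(2)] finite_extension_gal_nhd[OF alg subfield_Rats L(2)]
    by metis
  then obtain n where n: "gal_nhd \<rat> n \<subseteq> carrier (abs_gal K)" "gal_nhd \<rat> n \<subseteq> carrier (abs_gal L)"
    using gal_nhd_decreasing[of k "max k l" \<rat>] gal_nhd_decreasing[of l "max k l" \<rat>]
    by (meson max.cobounded1 max.cobounded2 order_trans)
  have sylow: "\<exists>P g. subgroup P (abs_gal \<rat>) \<and> P \<subseteq> carrier (abs_gal K) \<and> g \<in> carrier (abs_gal \<rat>) \<and>
      (\<lambda>x. g \<otimes>\<^bsub>abs_gal \<rat>\<^esub> x \<otimes>\<^bsub>abs_gal \<rat>\<^esub> inv\<^bsub>abs_gal \<rat>\<^esub> g) ` P \<subseteq> carrier (abs_gal L) \<and>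
      \<not> p dvd \<Gamma>.index (carrier (abs_gal K)) (gal_nhd \<rat> n <#>\<^bsub>abs_gal \<rat>\<^esub> P) \<and>
      \<not> p dvd \<Gamma>.index (carrier (abs_gal L)) (gal_nhd \<rat> n <#>\<^bsub>abs_gal \<rat>\<^esub>
        (\<lambda>x. g \<otimes>\<^bsub>abs_gal \<rat>\<^esub> x \<otimes>\<^bsub>abs_gal \<rat>\<^esub> inv\<^bsub>abs_gal \<rat>\<^esub> g) ` P)"
    if p: "Factorial_Ring.prime p" for p :: nat
  proof -
    obtain P where P: "sylow_subgroup p (abs_gal K) (krull_topology K) P"
      using exists_sylow_subgroup_abs_gal[OF alg K(1) p] .
    obtain P' where P': "sylow_subgroup p (abs_gal L) (krull_topology L) P'"
      using exists_sylow_subgroup_abs_gal[OF alg L(1) p] .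
    note PK = sylow_subgroup_index[OF alg K(1) n(1) P]
    note PL = sylow_subgroup_index[OF alg L(1) n(2) P']
    obtain g where g: "g \<in> carrier (abs_gal \<rat>)"
      "P' = (g <#\<^bsub>abs_gal \<rat>\<^esub> P) #>\<^bsub>abs_gal \<rat>\<^esub> inv\<^bsub>abs_gal \<rat>\<^esub> g"
      using assms(4) p P P' unfolding sylow_conjugate_def conjugate_in_def by blast
    then have "P' = (\<lambda>x. g \<otimes>\<^bsub>abs_gal \<rat>\<^esub> x \<otimes>\<^bsub>abs_gal \<rat>\<^esub> inv\<^bsub>abs_gal \<rat>\<^esub> g) ` P"
      using \<Gamma>.conjugate_eq_image[OF g(1) subgroup.subset[OF PK(1)]] by simp
    then show ?thesis
      using PK PL(2,3) g(1) by (intro exI[of _ P] exI[of _ g]) simp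
  qed
  obtain x where x: "Qbar.simple_extension \<rat> x = K"
    using prime_degree_primitive[OF alg assms(2,5)] by blast
  have prime: "Factorial_Ring.prime (\<Gamma>.index (carrier (abs_gal \<rat>)) (carrier (abs_gal K)))"
    using index_abs_gal[OF alg x] assms(5) by simp
  obtain m where m: "(derived (abs_gal \<rat>) ^^ m) (carrier (abs_gal \<rat>)) \<subseteq> carrier (abs_gal K)"
    using derived_series_fixes[OF alg assms(7)] .
  have "\<exists>g\<in>carrier (abs_gal \<rat>).
      (\<lambda>x. g \<otimes>\<^bsub>abs_gal \<rat>\<^esub> x \<otimes>\<^bsub>abs_gal \<rat>\<^esub> inv\<^bsub>abs_gal \<rat>\<^esub> g) ` carrier (abs_gal L) = carrier (abs_gal K)"
    by (rule \<Gamma>.sylow_conjugate_prime_index_conjugate[OF gal_nhd_normal gal_nhd_finite_index[OF alg]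
          subgroup_abs_gal_Rats n(1) subgroup_abs_gal_Rats n(2) sylow prime m])
  then show ?thesis
    using conjugate_abs_gal_isomorphic[OF alg K(1) L(1)] by blast
qed

end
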